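(* Let $d\ge1$ and let $\Phi:M_d(\mathbb{C})\to M_d(\mathbb{C})$ be a completely positive linear map. The following are equivalent. (A) $\Phi$ has the form $\Phi(\rho)=\sum_k R_k\,\mathrm{Tr}(F_k\rho)$ (finite sum) with each $R_k$ a density matrix and each $F_k$ positive semi-definite. (B) $\Phi$ is entanglement breaking. (C) $(I\otimes\Phi)(|\beta\rangle\langle\beta|)$ is separable, where $|\beta\rangle=d^{-1/2}\sum_{j=1}^d|j\rangle\otimes|j\rangle$ is a maximally entangled state. (D) $\Phi$ can be written in operator sum form $\Phi(\rho)=\sum_kA_k\rho A_k^\dagger$ (finite sum) using only Kraus operators $A_k$ of rank one. (E) $\Upsilon\circ\Phi$ is completely positive for all positivity preserving maps $\Upsilon$. (F) $\Phi\circ\Upsilon$ is completely positive for all positivity preserving maps $\Upsilon$. A corresponding equivalence holds for trace-preserving maps: if $\Phi$ is completely positive and trace-preserving, then the following are equivalent: (A) with the additional condition that $\{F_k\}$ is a POVM; (B), i.e. $\Phi$ is EBT; (C); (D) with the additional condition $\sum_kA_k^\dagger A_k=I$; (E) with $\Upsilon$ restricted to trace-preserving positivity preserving maps; (F) with $\Upsilon$ restricted to trace-preserving positivity preserving maps.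
   Context: $M_d(\mathbb{C})$ is the algebra of complex $d\times d$ matrices and $\{|j\rangle\}_{j=1}^d$ is an orthonormal basis of $\mathbb{C}^d$. A density matrix is a positive semi-definite matrix of trace one. A POVM is a finite family $\{F_k\}$ of positive semi-definite matrices with $\sum_kF_k=I$. A positive semi-definite operator on a tensor product of two finite-dimensional Hilbert spaces is separable if it is a finite sum $\sum_iP_i\otimes Q_i$ with all $P_i,Q_i$ positive semi-definite (for a density matrix: a convex combination of products of density matrices). A completely positive map $\Phi$ on $M_d(\mathbb{C})$ is entanglement breaking if $(I\otimes\Phi)(\Gamma)$ is separable for every density matrix $\Gamma$ on $\mathbb{C}^n\otimes\mathbb{C}^d$ and every $n\ge1$ (here $I$ is an identity map); it is EBT if it is in addition trace-preserving. A linear map between matrix algebras is positivity preserving if it maps positive semi-definite matrices to positive semi-definite matrices. In (E), $\Upsilon$ ranges over all positivity preserving linear maps $M_d(\mathbb{C})\to M_m(\mathbb{C})$, $m\ge1$ arbitrary; in (F), over all positivity preserving linear maps $M_m(\mathbb{C})\to M_d(\mathbb{C})$, $m\ge1$ arbitrary. *)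

theory Defs
  imports Jordan_Normal_Form.Schur_Decomposition Jordan_Normal_Form.DL_Rank
begin

section \<open>Matrices and finite sums of matrices\<close>

text \<open>
  \<^typ>\<open>complex mat\<close> is not a commutative monoid type (there is no zero of unspecified size),
  so finite sums of \<open>n \<times> n\<close> matrices are taken entrywise.
\<close>

definition mat_sum :: "nat \<Rightarrow> ('i \<Rightarrow> complex mat) \<Rightarrow> 'i set \<Rightarrow> complex mat" where
  "mat_sum n f I = mat n n (\<lambda>rs. \<Sum>i\<in>I. f i $$ rs)"

definition mat_trace :: "complex mat \<Rightarrow> complex" where
  "mat_trace A = (\<Sum>i<dim_row A. A $$ (i, i))"

text \<open>
  In the order on \<^typ>\<open>complex\<close>, \<open>0 \<le> z\<close> means that \<open>z\<close> is real and nonnegative.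
  Over the complex numbers the condition below therefore forces \<open>A\<close> to be Hermitian.
\<close>

definition psd :: "nat \<Rightarrow> complex mat \<Rightarrow> bool" where
  "psd n A \<longleftrightarrow> A \<in> carrier_mat n n \<and> (\<forall>v\<in>carrier_vec n. 0 \<le> (A *\<^sub>v v) \<bullet>c v)"

definition density_matrix :: "nat \<Rightarrow> complex mat \<Rightarrow> bool" where
  "density_matrix n A \<longleftrightarrow> psd n A \<and> mat_trace A = 1"

definition povm :: "nat \<Rightarrow> nat \<Rightarrow> (nat \<Rightarrow> complex mat) \<Rightarrow> bool" where
  "povm n K F \<longleftrightarrow> (\<forall>k<K. psd n (F k)) \<and> mat_sum n F {..<K} = 1\<^sub>m n"

definition orthonormal_basis :: "nat \<Rightarrow> (nat \<Rightarrow> complex vec) \<Rightarrow> bool" where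
  "orthonormal_basis n b \<longleftrightarrow>
     (\<forall>j<n. b j \<in> carrier_vec n) \<and>
     (\<forall>i<n. \<forall>j<n. b i \<bullet>c b j = (if i = j then 1 else 0)) \<and>
     vectorspace.basis class_ring (module_vec TYPE(complex) n) (b ` {..<n})"


section \<open>Tensor products\<close>

text \<open>
  \<open>\<complex>\<^sup>n \<otimes> \<complex>\<^sup>m\<close> is identified with \<open>\<complex>\<^sup>n\<^sup>m\<close> by numbering the product basis vector with
  index pair \<open>(a, i)\<close>, \<open>a < n\<close>, \<open>i < m\<close>, as \<open>a * m + i\<close> (Kronecker convention).
\<close>

definition tensor_vec :: "complex vec \<Rightarrow> complex vec \<Rightarrow> complex vec" where
  "tensor_vec u v = vec (dim_vec u * dim_vec v)
     (\<lambda>r. u $ (r div dim_vec v) * v $ (r mod dim_vec v))"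

definition tensor_mat :: "complex mat \<Rightarrow> complex mat \<Rightarrow> complex mat" where
  "tensor_mat A B = mat (dim_row A * dim_row B) (dim_col A * dim_col B)
     (\<lambda>(r, s). A $$ (r div dim_row B, s div dim_col B) * B $$ (r mod dim_row B, s mod dim_col B))"

definition separable :: "nat \<Rightarrow> nat \<Rightarrow> complex mat \<Rightarrow> bool" where
  "separable n m X \<longleftrightarrow> psd (n * m) X \<and>
     (\<exists>K P Q. (\<forall>i<K. psd n (P i) \<and> psd m (Q i)) \<and>
        X = mat_sum (n * m) (\<lambda>i. tensor_mat (P i) (Q i)) {..<(K::nat)})"

definition ketbra :: "complex vec \<Rightarrow> complex mat" where
  "ketbra v = mat (dim_vec v) (dim_vec v) (\<lambda>(r, s). v $ r * cnj (v $ s))"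

definition max_entangled :: "nat \<Rightarrow> (nat \<Rightarrow> complex vec) \<Rightarrow> complex vec" where
  "max_entangled d b = complex_of_real (1 / sqrt (real d)) \<cdot>\<^sub>v
     finsum_vec TYPE(complex) (d * d) (\<lambda>j. tensor_vec (b j) (b j)) {..<d}"


section \<open>Linear maps between matrix algebras\<close>

text \<open>
  A map from \<open>M\<^sub>a(\<complex>)\<close> to \<open>M\<^sub>b(\<complex>)\<close> is represented by a function on all matrices, of which
  only the values on the \<open>a \<times> a\<close> matrices matter.
\<close>

definition lin_map :: "nat \<Rightarrow> nat \<Rightarrow> (complex mat \<Rightarrow> complex mat) \<Rightarrow> bool" where
  "lin_map a b \<Phi> \<longleftrightarrow>
     (\<forall>X\<in>carrier_mat a a. \<Phi> X \<in> carrier_mat b b) \<and>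
     (\<forall>X\<in>carrier_mat a a. \<forall>Y\<in>carrier_mat a a. \<Phi> (X + Y) = \<Phi> X + \<Phi> Y) \<and>
     (\<forall>c. \<forall>X\<in>carrier_mat a a. \<Phi> (c \<cdot>\<^sub>m X) = c \<cdot>\<^sub>m \<Phi> X)"

text \<open>
  \<open>block a X p q\<close> is the \<open>a \<times> a\<close> block of \<open>X\<close> at block position \<open>(p, q)\<close>. The map
  \<open>I \<otimes> \<Phi>\<close>, with \<open>I\<close> the identity on \<open>M\<^sub>n(\<complex>)\<close> and \<open>\<Phi>\<close> from \<open>M\<^sub>a(\<complex>)\<close> to \<open>M\<^sub>b(\<complex>)\<close>, applies
  \<open>\<Phi>\<close> to each block: \<open>X = \<Sum>\<^sub>p\<^sub>q E\<^sub>p\<^sub>q \<otimes> X\<^sub>p\<^sub>q\<close> is sent to \<open>\<Sum>\<^sub>p\<^sub>q E\<^sub>p\<^sub>q \<otimes> \<Phi>(X\<^sub>p\<^sub>q)\<close>. The lemmas below show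
  that it is the linear map sending \<open>A \<otimes> B\<close> to \<open>A \<otimes> \<Phi>(B)\<close>.
\<close>

definition block :: "nat \<Rightarrow> complex mat \<Rightarrow> nat \<Rightarrow> nat \<Rightarrow> complex mat" where
  "block a X p q = mat a a (\<lambda>(i, j). X $$ (p * a + i, q * a + j))"

definition id_tensor :: "nat \<Rightarrow> nat \<Rightarrow> nat \<Rightarrow> (complex mat \<Rightarrow> complex mat) \<Rightarrow> complex mat \<Rightarrow> complex mat" where
  "id_tensor n a b \<Phi> X = mat (n * b) (n * b)
     (\<lambda>(r, s). \<Phi> (block a X (r div b) (s div b)) $$ (r mod b, s mod b))"

lemma block_index_less:
  fixes p n a i :: nat
  assumes "p < n" "i < a"
  shows "p * a + i < n * a"
proof -
  have "p * a + i < Suc p * a" using assms by simp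
  also have "\<dots> \<le> n * a" using assms by (intro mult_le_mono1) simp
  finally show ?thesis .
qed

lemma block_tensor_mat:
  assumes "A \<in> carrier_mat n n" "B \<in> carrier_mat a a" "p < n" "q < n"
  shows "block a (tensor_mat A B) p q = A $$ (p, q) \<cdot>\<^sub>m B"
  using assms by (intro eq_matI) (auto simp: block_def tensor_mat_def block_index_less)

lemma block_carrier [simp]: "block a X p q \<in> carrier_mat a a"
  by (simp add: block_def)

lemma div_less_of_less_mult:
  fixes r n b :: nat
  assumes "r < n * b"
  shows "r div b < n" "r mod b < b"
proof -
  show "r div b < n" using assms by (simp add: less_mult_imp_div_less)
  show "r mod b < b" using assms by (cases b) auto
qed

lemma id_tensor_tensor_mat:
  assumes "lin_map a b \<Phi>" "A \<in> carrier_mat n n" "B \<in> carrier_mat a a"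
  shows "id_tensor n a b \<Phi> (tensor_mat A B) = tensor_mat A (\<Phi> B)"
proof -
  have B: "\<Phi> B \<in> carrier_mat b b" and hom: "\<Phi> (c \<cdot>\<^sub>m B) = c \<cdot>\<^sub>m \<Phi> B" for c
    using assms unfolding lin_map_def by auto
  show ?thesis
  proof (rule eq_matI)
    fix r s assume "r < dim_row (tensor_mat A (\<Phi> B))" "s < dim_col (tensor_mat A (\<Phi> B))"
    hence rs: "r < n * b" "s < n * b" using assms B by (auto simp: tensor_mat_def)
    show "id_tensor n a b \<Phi> (tensor_mat A B) $$ (r, s) = tensor_mat A (\<Phi> B) $$ (r, s)"
      using rs B assms div_less_of_less_mult[OF rs(1)] div_less_of_less_mult[OF rs(2)]
      by (simp add: id_tensor_def block_tensor_mat hom, simp add: tensor_mat_def)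
  qed (use assms B in \<open>auto simp: id_tensor_def tensor_mat_def\<close>)
qed

lemma id_tensor_linear:
  assumes "lin_map a b \<Phi>"
  shows "lin_map (n * a) (n * b) (id_tensor n a b \<Phi>)"
proof -
  have c: "\<Phi> X \<in> carrier_mat b b" if "X \<in> carrier_mat a a" for X
    using assms that unfolding lin_map_def by auto
  have add: "\<Phi> (X + Y) = \<Phi> X + \<Phi> Y" if "X \<in> carrier_mat a a" "Y \<in> carrier_mat a a" for X Y
    using assms that unfolding lin_map_def by auto
  have hom: "\<Phi> (k \<cdot>\<^sub>m X) = k \<cdot>\<^sub>m \<Phi> X" if "X \<in> carrier_mat a a" for k X
    using assms that unfolding lin_map_def by auto
  have badd: "block a (X + Y) p q = block a X p q + block a Y p q"
    if "X \<in> carrier_mat (n * a) (n * a)" "Y \<in> carrier_mat (n * a) (n * a)" "p < n" "q < n" for X Y p q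
    using that by (intro eq_matI) (auto simp: block_def block_index_less)
  have bhom: "block a (k \<cdot>\<^sub>m X) p q = k \<cdot>\<^sub>m block a X p q"
    if "X \<in> carrier_mat (n * a) (n * a)" "p < n" "q < n" for k X p q
    using that by (intro eq_matI) (auto simp: block_def block_index_less)
  have d: "\<Phi> (block a X p q) \<in> carrier_mat b b"
    "dim_row (\<Phi> (block a X p q)) = b" "dim_col (\<Phi> (block a X p q)) = b" for X p q
    using c[OF block_carrier, of X p q] by auto
  show ?thesis
    unfolding lin_map_def
    by (auto intro!: eq_matI
        simp: id_tensor_def badd bhom add hom d div_less_of_less_mult)
qed

definition positivity_preserving :: "nat \<Rightarrow> nat \<Rightarrow> (complex mat \<Rightarrow> complex mat) \<Rightarrow> bool" where
  "positivity_preserving a b \<Phi> \<longleftrightarrow> lin_map a b \<Phi> \<and> (\<forall>X. psd a X \<longrightarrow> psd b (\<Phi> X))"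

definition completely_positive :: "nat \<Rightarrow> nat \<Rightarrow> (complex mat \<Rightarrow> complex mat) \<Rightarrow> bool" where
  "completely_positive a b \<Phi> \<longleftrightarrow> lin_map a b \<Phi> \<and>
     (\<forall>n\<ge>1. positivity_preserving (n * a) (n * b) (id_tensor n a b \<Phi>))"

definition trace_preserving :: "nat \<Rightarrow> (complex mat \<Rightarrow> complex mat) \<Rightarrow> bool" where
  "trace_preserving a \<Phi> \<longleftrightarrow> (\<forall>X\<in>carrier_mat a a. mat_trace (\<Phi> X) = mat_trace X)"

definition entanglement_breaking :: "nat \<Rightarrow> (complex mat \<Rightarrow> complex mat) \<Rightarrow> bool" where
  "entanglement_breaking d \<Phi> \<longleftrightarrow> completely_positive d d \<Phi> \<and>
     (\<forall>n\<ge>1. \<forall>\<Gamma>. density_matrix (n * d) \<Gamma> \<longrightarrow> separable n d (id_tensor n d d \<Phi> \<Gamma>))"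

definition EBT :: "nat \<Rightarrow> (complex mat \<Rightarrow> complex mat) \<Rightarrow> bool" where
  "EBT d \<Phi> \<longleftrightarrow> entanglement_breaking d \<Phi> \<and> trace_preserving d \<Phi>"


section \<open>Representations of maps\<close>

definition holevo_rep ::
  "nat \<Rightarrow> nat \<Rightarrow> (nat \<Rightarrow> complex mat) \<Rightarrow> (nat \<Rightarrow> complex mat) \<Rightarrow> (complex mat \<Rightarrow> complex mat) \<Rightarrow> bool" where
  "holevo_rep d K R F \<Phi> \<longleftrightarrow>
     (\<forall>k<K. density_matrix d (R k) \<and> psd d (F k)) \<and>
     (\<forall>\<rho>\<in>carrier_mat d d. \<Phi> \<rho> = mat_sum d (\<lambda>k. mat_trace (F k * \<rho>) \<cdot>\<^sub>m R k) {..<K})"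

definition rank_one_kraus_rep ::
  "nat \<Rightarrow> nat \<Rightarrow> (nat \<Rightarrow> complex mat) \<Rightarrow> (complex mat \<Rightarrow> complex mat) \<Rightarrow> bool" where
  "rank_one_kraus_rep d K A \<Phi> \<longleftrightarrow>
     (\<forall>k<K. A k \<in> carrier_mat d d \<and> vec_space.rank d (A k) = 1) \<and>
     (\<forall>\<rho>\<in>carrier_mat d d. \<Phi> \<rho> = mat_sum d (\<lambda>k. A k * \<rho> * mat_adjoint (A k)) {..<K})"

end

theory Submission
  imports Defs "HOL-Analysis.Function_Topology" "HOL-Analysis.Elementary_Metric_Spaces"
begin

text \<open>
  Every condition is compared with separability of \<open>C = (I \<otimes> \<Phi>)(|\<beta>\<rangle>\<langle>\<beta>|)\<close>. A decomposition
  \<open>C = \<Sum> P\<^sub>i \<otimes> Q\<^sub>i\<close> is turned into \<open>\<Phi>(\<rho>) = \<Sum> Tr(F\<^sub>i \<rho>) Q\<^sub>i\<close>, because the blocks of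
  \<open>|\<beta>\<rangle>\<langle>\<beta>|\<close> span the matrix algebra. In this form \<open>\<Phi>\<close> breaks entanglement, remains of the same
  form after composition with a positive map on either side, and has rank-one Kraus operators
  obtained by splitting \<open>F\<^sub>i\<close> and \<open>Q\<^sub>i\<close> into rank-one matrices.

  For the converse from positive maps, the cone of separable matrices is closed: by Caratheodory a
  bounded number of product vectors suffices, so the distance from \<open>C\<close> to the cone is attained. The
  difference \<open>W\<close> between the nearest point and \<open>C\<close> is nonnegative on product vectors, and
  \<open>\<langle>W, C\<rangle> = - \<parallel>W\<parallel>\<^sup>2\<close>. Hence \<open>C\<close> is separable as soon as \<open>\<langle>W, C\<rangle> \<ge> 0\<close> for all \<open>W\<close> that are strictly positive
  on product vectors. Such a \<open>W\<close> is the Choi matrix of a positive map \<open>\<Upsilon>\<close>, and \<open>\<langle>W, C\<rangle>\<close> is, up to a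
  positive factor, a value of the quadratic form of \<open>(I \<otimes> (\<Upsilon> \<circ> \<Phi>))(|\<beta>\<rangle>\<langle>\<beta>|)\<close> or of
  \<open>(I \<otimes> (\<Phi> \<circ> \<Upsilon>))(|\<eta>\<rangle>\<langle>\<eta>|)\<close> for a suitable vector \<open>\<eta>\<close>. The map \<open>\<Upsilon>\<close> can moreover be made
  trace-preserving: in the first case by scaling it and adding one output dimension that collects
  the missing trace, in the second case by replacing \<open>\<Upsilon>(X)\<close> with \<open>\<Upsilon>(K X K\<^sup>\<dagger>)\<close>, where
  \<open>Tr \<Upsilon>(X) = Tr (S\<^sup>\<dagger> S X)\<close> and \<open>K = S\<^sup>-\<^sup>1\<close>.
\<close>

section \<open>Positive semi-definite matrices\<close>

lemma sum_mult_split: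
  fixes f :: "nat \<Rightarrow> 'a::comm_monoid_add"
  shows "(\<Sum>r<n * m. f r) = (\<Sum>p<n. \<Sum>i<m. f (p * m + i))"
proof -
  have "(\<Sum>r\<in>{p * m..<p * m + m}. f r) = (\<Sum>i<m. f (p * m + i))" for p
    by (rule sum.reindex_bij_witness[of _ "\<lambda>i. p * m + i" "\<lambda>r. r - p * m"]) auto
  then show ?thesis
    using sum.nat_group[of f m n] by simp
qed

text \<open>Matrices and vectors enter as functions of indices, so no carrier conditions arise and
  the topology of function spaces is available in the duality argument.\<close>

definition qf :: "nat \<Rightarrow> (nat \<Rightarrow> nat \<Rightarrow> complex) \<Rightarrow> (nat \<Rightarrow> complex) \<Rightarrow> complex" where
  "qf n A x = (\<Sum>i<n. \<Sum>j<n. cnj (x i) * A i j * x j)"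

lemma qf_cong:
  assumes "\<And>i j. i < n \<Longrightarrow> j < n \<Longrightarrow> A i j = B i j" "\<And>i. i < n \<Longrightarrow> x i = y i"
  shows "qf n A x = qf n B y"
  unfolding qf_def using assms by (intro sum.cong refl) auto

lemma qf_sum: "qf n (\<lambda>i j. \<Sum>k\<in>I. A k i j) x = (\<Sum>k\<in>I. qf n (A k) x)"
proof -
  have "qf n (\<lambda>i j. \<Sum>k\<in>I. A k i j) x = (\<Sum>i<n. \<Sum>j<n. \<Sum>k\<in>I. cnj (x i) * A k i j * x j)"
    unfolding qf_def by (simp add: sum_distrib_left sum_distrib_right)
  also have "\<dots> = (\<Sum>i<n. \<Sum>k\<in>I. \<Sum>j<n. cnj (x i) * A k i j * x j)"
    by (intro sum.cong refl sum.swap)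
  also have "\<dots> = (\<Sum>k\<in>I. qf n (A k) x)"
    unfolding qf_def by (rule sum.swap)
  finally show ?thesis .
qed

lemma qf_add: "qf n (\<lambda>i j. A i j + B i j) x = qf n A x + qf n B x"
  by (simp add: qf_def sum.distrib algebra_simps)

lemma qf_scale: "qf n (\<lambda>i j. c * A i j) x = c * qf n A x"
  by (simp add: qf_def sum_distrib_left algebra_simps)

lemma qf_rank_one:
  "qf n (\<lambda>i j. f i * cnj (g j)) x = (\<Sum>i<n. cnj (x i) * f i) * cnj (\<Sum>i<n. cnj (x i) * g i)"
  unfolding qf_def by (simp add: sum_product algebra_simps)

lemma qf_ketbra_sum:
  "qf n (\<lambda>i j. \<Sum>k\<in>I. f k i * cnj (f k j)) x =
    complex_of_real (\<Sum>k\<in>I. (cmod (\<Sum>i<n. cnj (x i) * f k i))\<^sup>2)"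
  by (simp only: qf_sum qf_rank_one complex_norm_square of_real_sum)

lemma qf_ketbra_sum_nonneg: "0 \<le> qf n (\<lambda>i j. \<Sum>k\<in>I. f k i * cnj (f k j)) x"
  unfolding qf_ketbra_sum by (simp add: less_eq_complex_def sum_nonneg)

lemma psd_iff:
  "psd n X \<longleftrightarrow> X \<in> carrier_mat n n \<and> (\<forall>x. 0 \<le> qf n (\<lambda>i j. X $$ (i, j)) x)"
proof -
  have eq: "(X *\<^sub>v v) \<bullet>c v = qf n (\<lambda>i j. X $$ (i, j)) (\<lambda>i. v $ i)"
    if "X \<in> carrier_mat n n" "v \<in> carrier_vec n" for v
    using that
    by (auto simp: scalar_prod_def qf_def sum_distrib_left sum_distrib_right row_def lessThan_atLeast0
        algebra_simps intro!: sum.cong)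
  show ?thesis
  proof (intro iffI conjI allI)
    assume "psd n X"
    then show c: "X \<in> carrier_mat n n" by (simp add: psd_def)
    fix x
    have "0 \<le> (X *\<^sub>v vec n x) \<bullet>c vec n x" using \<open>psd n X\<close> by (simp add: psd_def)
    also have "\<dots> = qf n (\<lambda>i j. X $$ (i, j)) x"
      by (subst eq[OF c]) (auto intro: qf_cong)
    finally show "0 \<le> qf n (\<lambda>i j. X $$ (i, j)) x" .
  next
    assume "X \<in> carrier_mat n n \<and> (\<forall>x. 0 \<le> qf n (\<lambda>i j. X $$ (i, j)) x)"
    then show "psd n X" by (simp add: psd_def eq)
  qed
qed

lemma psdD: "psd n X \<Longrightarrow> X \<in> carrier_mat n n" "psd n X \<Longrightarrow> 0 \<le> qf n (\<lambda>i j. X $$ (i, j)) x"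
  by (auto simp: psd_iff)

section \<open>Test vectors and Gram factorisation of positive matrices\<close>

lemma sum_single:
  fixes f :: "nat \<Rightarrow> 'a::comm_monoid_add"
  assumes "i < n" "\<And>j. j < n \<Longrightarrow> j \<noteq> i \<Longrightarrow> f j = 0"
  shows "(\<Sum>j<n. f j) = f i"
  using assms by (subst sum.mono_neutral_right[of "{..<n}" "{i}"]) auto

text \<open>Changing one coordinate is the only perturbation used: hermiticity, nonnegative
  diagonal, elimination and the zero-pivot case follow by choosing \<open>x\<close>,
  \<open>k\<close> and \<open>c\<close>.\<close>

lemma qf_add_unit:
  assumes "k < n"
  shows "qf n A (\<lambda>i. x i + (if i = k then c else 0)) =
    qf n A x + cnj c * (\<Sum>j<n. A k j * x j) + c * (\<Sum>i<n. cnj (x i) * A i k) + cnj c * c * A k k"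
proof -
  have "qf n A (\<lambda>i. x i + (if i = k then c else 0)) =
    (\<Sum>i<n. \<Sum>j<n. cnj (x i) * A i j * x j) + (\<Sum>i<n. \<Sum>j<n. (if i = k then cnj c * (A i j * x j) else 0))
    + (\<Sum>i<n. \<Sum>j<n. (if j = k then c * (cnj (x i) * A i j) else 0))
    + (\<Sum>i<n. \<Sum>j<n. (if i = k then (if j = k then cnj c * c * A i j else 0) else 0))"
    unfolding qf_def sum.distrib[symmetric] by (intro sum.cong refl) (auto simp: algebra_simps)
  also have "(\<Sum>i<n. \<Sum>j<n. (if i = k then cnj c * (A i j * x j) else 0)) = cnj c * (\<Sum>j<n. A k j * x j)"
    using assms by (subst sum_single[of k]) (auto simp: sum_distrib_left)
  also have "(\<Sum>i<n. \<Sum>j<n. (if j = k then c * (cnj (x i) * A i j) else 0)) = c * (\<Sum>i<n. cnj (x i) * A i k)"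
    using assms by (simp add: sum_distrib_left)
  also have "(\<Sum>i<n. \<Sum>j<n. (if i = k then (if j = k then cnj c * c * A i j else 0) else 0)) = cnj c * c * A k k"
    using assms by (subst sum_single[of k]) auto
  finally show ?thesis by (simp add: qf_def)
qed

text \<open>The choice \<open>c = 1\<close> makes the imaginary parts opposite, and
  \<open>c = \<i>\<close> makes the real parts equal.\<close>

lemma complex_hermitian_pair:
  fixes a b :: complex
  assumes "\<And>c. Im (cnj c * a + c * b) = 0"
  shows "a = cnj b"
  using assms[of 1] assms[of \<i>] by (simp add: complex_eq_iff)

text \<open>On e_j + c e_i the form is real for every \<open>c\<close>. Since the diagonal entries
  are real, the two cross terms together have no imaginary part.\<close>

lemma qf_nonneg_hermitian:
  assumes "\<And>x. 0 \<le> qf n A x" and "i < n" "j < n"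
  shows "A i j = cnj (A j i)"
proof -
  have diag: "0 \<le> A k k" if "k < n" for k
    using assms(1)[of "\<lambda>i. 0 + (if i = k then 1 else 0)"] unfolding qf_add_unit[OF that] by (simp add: qf_def)
  have "Im (cnj c * A i j + c * A j i) = 0" for c
  proof -
    have u: "qf n A (\<lambda>i. if i = j then 1 else 0) = A j j"
      using qf_add_unit[OF assms(3), of A "\<lambda>_. 0" 1] by (simp add: qf_def)
    have "qf n A (\<lambda>l. (if l = j then 1 else 0) + (if l = i then c else 0)) =
      A j j + cnj c * A i j + c * A j i + cnj c * c * A i i"
      unfolding qf_add_unit[OF assms(2)] u using assms
      by (subst (1 2) sum_single[of j]) auto
    then have "0 \<le> A j j + cnj c * A i j + c * A j i + cnj c * c * A i i"
      using assms(1) by metis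
    moreover have "Im (A i i) = 0" "Im (A j j) = 0"
      using diag[OF assms(2)] diag[OF assms(3)] by (auto simp: less_eq_complex_def)
    ultimately show ?thesis by (simp add: less_eq_complex_def)
  qed
  then show ?thesis by (rule complex_hermitian_pair)
qed

lemma qf_nonneg_diag:
  assumes "\<And>x. 0 \<le> qf n A x" and "k < n"
  shows "0 \<le> A k k"
  using assms(1)[of "\<lambda>i. 0 + (if i = k then 1 else 0)"] unfolding qf_add_unit[OF assms(2)] by (simp add: qf_def)

text \<open>Symmetric Gaussian elimination: subtracting the rank-one matrix built from column \<open>k\<close>
  clears that column and row while preserving positivity.\<close>
lemma qf_nonneg_eliminate:
  assumes pos: "\<And>x. 0 \<le> qf n A x" and k: "k < n" and nz: "A k k \<noteq> 0"
  shows "0 \<le> qf n (\<lambda>i j. A i j - A i k * cnj (A j k) / A k k) x"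
proof -
  define s where "s = (\<Sum>i<n. cnj (x i) * A i k)"
  have herm: "A i j = cnj (A j i)" if "i < n" "j < n" for i j
    using qf_nonneg_hermitian[of n A] pos that by blast
  have s': "(\<Sum>j<n. A k j * x j) = cnj s"
    unfolding s_def using herm[OF k] by (auto intro!: sum.cong)
  have real: "cnj (A k k) = A k k" using herm[OF k k] by simp
  have "qf n (\<lambda>i j. A i j - A i k * cnj (A j k) / A k k) x =
      qf n A x + (- 1 / A k k) * qf n (\<lambda>i j. A i k * cnj (A j k)) x"
    by (subst qf_scale[symmetric], subst qf_add[symmetric]) (auto intro!: qf_cong)
  also have "\<dots> = qf n A x - s * cnj s / A k k"
    unfolding qf_rank_one by (simp add: s_def)
  \<comment> \<open>Completing the square: this shift of coordinate \<open>k\<close> minimises the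
    form of \<open>A\<close>, and the minimum is the form of the reduced matrix.\<close>
  also have "\<dots> = qf n A (\<lambda>i. x i + (if i = k then - cnj s / A k k else 0))"
    unfolding qf_add_unit[OF k] s' s_def[symmetric] using nz real by (simp add: field_simps)
  finally show ?thesis using pos by simp
qed

text \<open>With a zero pivot the form along e_i + c e_k has no quadratic term in \<open>c\<close>,
  so a nonzero off-diagonal entry could make it negative.\<close>

lemma qf_nonneg_zero_diag:
  assumes pos: "\<And>x. 0 \<le> qf n A x" and k: "k < n" "i < n" and z: "A k k = 0"
  shows "A i k = 0"
proof (rule ccontr)
  assume nz: "A i k \<noteq> 0"
  have herm: "A k i = cnj (A i k)" using qf_nonneg_hermitian[of n A] pos k by blast
  have u: "qf n A (\<lambda>l. if l = i then 1 else 0) = A i i"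
    using qf_add_unit[OF k(2), of A "\<lambda>_. 0" 1] by (simp add: qf_def)
  have "A i i + cnj c * cnj (A i k) + c * A i k \<ge> 0" for c
  proof -
    have "qf n A (\<lambda>l. (if l = i then 1 else 0) + (if l = k then c else 0)) =
        A i i + cnj c * cnj (A i k) + c * A i k"
      unfolding qf_add_unit[OF k(1)] u using k z herm
      by (subst (1 2) sum_single[of i]) auto
    then show ?thesis using pos by metis
  qed
  \<comment> \<open>As \<open>A i i\<close> is real, this \<open>c\<close> gives the value - A i i -
    2.\<close>
  from this[of "- (A i i + 1) / A i k"]
  have "A i i - cnj (A i i + 1) - (A i i + 1) \<ge> 0" using nz by simp
  moreover have "A i i \<ge> 0" using qf_nonneg_diag[of n A] pos k by blast
  ultimately show False by (simp add: less_eq_complex_def)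
qed

text \<open>Outer-product Cholesky factorisation, used in place of a spectral decomposition. After
  \<open>m\<close> pivots the remainder \<open>B\<close> is still positive and its first
  \<open>m\<close> rows and columns vanish; for \<open>m = n\<close> nothing remains.\<close>

lemma qf_nonneg_decomp:
  assumes "\<And>x. 0 \<le> qf n A x"
  shows "\<exists>f. \<forall>i<n. \<forall>j<n. A i j = (\<Sum>k<n. f k i * cnj (f k j))"
proof -
  have "\<exists>f B. (\<forall>x. 0 \<le> qf n B x) \<and> (\<forall>i<n. \<forall>j<n. i < m \<or> j < m \<longrightarrow> B i j = 0) \<and>
      (\<forall>i<n. \<forall>j<n. A i j = B i j + (\<Sum>k<m. f k i * cnj (f k j)))" if "m \<le> n" for m
    using that
  proof (induction m)
    case 0
    show ?case using assms by auto
  next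
    case (Suc m)
    from Suc.IH[OF Suc_leD[OF Suc.prems]] obtain f B where pos: "\<And>x. 0 \<le> qf n B x"
      and z: "\<And>i j. i < n \<Longrightarrow> j < n \<Longrightarrow> i < m \<or> j < m \<Longrightarrow> B i j = 0"
      and eq: "\<And>i j. i < n \<Longrightarrow> j < n \<Longrightarrow> A i j = B i j + (\<Sum>k<m. f k i * cnj (f k j))"
      by blast
    have m: "m < n" using Suc by simp
    have herm: "B i j = cnj (B j i)" if "i < n" "j < n" for i j
      using qf_nonneg_hermitian[of n B] pos that by blast
    show ?case
    proof (cases "B m m = 0")
      case True
      \<comment> \<open>A zero pivot comes with a zero row and column, so the new factor is the zero
        vector.\<close>
      have zm: "B i m = 0" "B m i = 0" if "i < n" for i
        using qf_nonneg_zero_diag[of n B, OF pos m that True] herm[OF m that] by auto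
      show ?thesis
        using pos z zm eq by (intro exI[of _ "f(m := \<lambda>_. 0)"] exI[of _ B]) (auto simp: less_Suc_eq)
    next
      case False
      define c where "c = B m m"
      have c: "c \<ge> 0" unfolding c_def using qf_nonneg_diag[of n B] pos m by blast
      \<comment> \<open>Dividing the column by the square root of the pivot gives the subtracted
        matrix the form |f><f|.\<close>
      define q where "q = complex_of_real (sqrt (Re c))"
      have q: "q * q = c" "cnj q = q"
        using c unfolding q_def by (auto simp: less_eq_complex_def complex_eq_iff simp flip: of_real_mult)
      define B' where "B' = (\<lambda>i j. B i j - B i m * cnj (B j m) / B m m)"
      have "0 \<le> qf n B' x" for x
        unfolding B'_def by (rule qf_nonneg_eliminate[OF pos m False])
      moreover have "B' i j = 0" if "i < n" "j < n" "i < Suc m \<or> j < Suc m" for i j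
        using that z m herm[of i j] herm[of m j] herm[of m m] False unfolding B'_def
        by (auto simp: less_Suc_eq)
      moreover have "A i j = B' i j + (\<Sum>k<Suc m. (f(m := \<lambda>i. B i m / q)) k i * cnj ((f(m := \<lambda>i. B i m / q)) k j))"
        if "i < n" "j < n" for i j
        using eq[OF that] q unfolding B'_def by (simp add: c_def)
      ultimately show ?thesis by blast
    qed
  qed
  from this[of n] show ?thesis by auto
qed

lemma psd_decomp:
  assumes "psd n X"
  obtains f where "\<And>i j. i < n \<Longrightarrow> j < n \<Longrightarrow> X $$ (i, j) = (\<Sum>k<n. f k i * cnj (f k j))"
  using qf_nonneg_decomp[of n "\<lambda>i j. X $$ (i, j)"] psdD(2)[OF assms] by blast

text \<open>The index set is arbitrary: singletons serve for rank-one matrices, product sets for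
  tensor products and contractions.\<close>

lemma psdI_decomp:
  assumes "X \<in> carrier_mat n n"
    and "\<And>i j. i < n \<Longrightarrow> j < n \<Longrightarrow> X $$ (i, j) = (\<Sum>k\<in>I. f k i * cnj (f k j))"
  shows "psd n X"
  unfolding psd_iff
proof (intro conjI allI assms(1))
  fix x
  have "qf n (\<lambda>i j. X $$ (i, j)) x = qf n (\<lambda>i j. \<Sum>k\<in>I. f k i * cnj (f k j)) x"
    using assms(2) by (intro qf_cong) auto
  then show "0 \<le> qf n (\<lambda>i j. X $$ (i, j)) x" using qf_ketbra_sum_nonneg by simp
qed

lemma psd_hermitian:
  assumes "psd n X" "i < n" "j < n"
  shows "X $$ (i, j) = cnj (X $$ (j, i))"
  using qf_nonneg_hermitian[of n "\<lambda>i j. X $$ (i, j)"] psdD(2)[OF assms(1)] assms by blast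

section \<open>Closed cones of rank-one matrices and duality\<close>

text \<open>The Hilbert-Schmidt inner product Tr(A^dagger B), antilinear in the first
  argument.\<close>

definition frob :: "nat \<Rightarrow> (nat \<Rightarrow> nat \<Rightarrow> complex) \<Rightarrow> (nat \<Rightarrow> nat \<Rightarrow> complex) \<Rightarrow> complex" where
  "frob n A B = (\<Sum>r<n. \<Sum>s<n. cnj (A r s) * B r s)"

lemma frob_cong:
  assumes "\<And>i j. i < n \<Longrightarrow> j < n \<Longrightarrow> A i j = A' i j" "\<And>i j. i < n \<Longrightarrow> j < n \<Longrightarrow> B i j = B' i j"
  shows "frob n A B = frob n A' B'"
  unfolding frob_def using assms by (intro sum.cong refl) auto

lemma frob_diff_right: "frob n A (\<lambda>r s. B r s - C r s) = frob n A B - frob n A C"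
  by (simp add: frob_def algebra_simps sum_subtractf)

lemma frob_add_left: "frob n (\<lambda>r s. A r s + B r s) C = frob n A C + frob n B C"
  by (simp add: frob_def algebra_simps sum.distrib)

lemma frob_scale_left: "frob n (\<lambda>r s. c * A r s) B = cnj c * frob n A B"
  by (simp add: frob_def algebra_simps sum_distrib_left)

lemma frob_self: "Re (frob n A A) = (\<Sum>r<n. \<Sum>s<n. (cmod (A r s))\<^sup>2)"
  unfolding frob_def by (simp add: cmod_power2 sum.distrib flip: power2_eq_square)

lemma frob_rank_one: "frob n A (\<lambda>r s. z r * cnj (z s)) = cnj (qf n A z)"
  by (simp add: frob_def qf_def algebra_simps)

text \<open>The expansion of the squared norm of A + t B; at a minimiser its linear term yields the
  variational inequalities.\<close>

lemma frob_perturb: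
  "Re (frob n (\<lambda>r s. A r s + complex_of_real t * B r s) (\<lambda>r s. A r s + complex_of_real t * B r s)) =
    Re (frob n A A) + 2 * t * Re (frob n A B) + t\<^sup>2 * Re (frob n B B)"
  by (simp add: frob_def sum.distrib sum_distrib_left algebra_simps power2_eq_square)

section \<open>Perturbation arguments and compactness\<close>

lemma qf_hermitian_real:
  assumes "\<And>r s. r < n \<Longrightarrow> s < n \<Longrightarrow> A s r = cnj (A r s)"
  shows "Im (qf n A x) = 0"
proof -
  have "cnj (qf n A x) = (\<Sum>i<n. \<Sum>j<n. cnj (x j) * A j i * x i)"
    unfolding qf_def cnj_sum by (intro sum.cong refl) (simp add: assms[symmetric])
  also have "\<dots> = qf n A x" unfolding qf_def by (rule sum.swap)
  finally have "Im (cnj (qf n A x)) = Im (qf n A x)" by simp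
  then show ?thesis by simp
qed

text \<open>Division by \<open>t\<close> and the limit at 0 remove the quadratic term. The bound
  \<open>t < 1\<close> admits perturbations that shrink by \<open>sqrt (1 - t)\<close>.\<close>

lemma nonneg_of_quadratic_perturbation:
  fixes a b :: real
  assumes "\<And>t. 0 < t \<Longrightarrow> t < 1 \<Longrightarrow> 0 \<le> 2 * t * a + t\<^sup>2 * b"
  shows "0 \<le> a"
proof (rule ccontr)
  assume "\<not> 0 \<le> a"
  \<comment> \<open>The second bound keeps \<open>t * b\<close> at most \<open>- a\<close>, so
    \<open>2 * a + t * b\<close> stays negative.\<close>
  define t where "t = min (1 / 2) (- a / (\<bar>b\<bar> + 1))"
  have t: "0 < t" "t < 1" using \<open>\<not> 0 \<le> a\<close> by (auto simp: t_def divide_neg_pos)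
  have "t * b \<le> t * (\<bar>b\<bar> + 1)" using t by (intro mult_left_mono) auto
  also have "\<dots> \<le> (- a / (\<bar>b\<bar> + 1)) * (\<bar>b\<bar> + 1)" by (intro mult_right_mono) (auto simp: t_def)
  also have "\<dots> = - a" by simp
  finally have "2 * a + t * b < 0" using \<open>\<not> 0 \<le> a\<close> by simp
  then have "t * (2 * a + t * b) < 0" using t by (simp add: mult_pos_neg)
  then show False using assms[OF t] by (simp add: power2_eq_square algebra_simps)
qed

text \<open>The limit at 0; it later discards a multiple of the identity that was added for strict
  positivity.\<close>

lemma nonneg_of_linear_perturbation:
  fixes a b :: real
  assumes "\<And>t. 0 < t \<Longrightarrow> 0 \<le> a + t * b"
  shows "0 \<le> a"
proof (rule ccontr)
  assume "\<not> 0 \<le> a"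
  define t where "t = - a / (2 * (\<bar>b\<bar> + 1))"
  have t: "0 < t" using \<open>\<not> 0 \<le> a\<close> by (auto simp: t_def divide_neg_pos)
  have "t * b \<le> t * (\<bar>b\<bar> + 1)" using t by (intro mult_left_mono) auto
  also have "\<dots> = - a / 2" by (auto simp: t_def field_simps)
  finally show False using assms[OF t] \<open>\<not> 0 \<le> a\<close> by simp
qed

text \<open>Tychonoff's theorem, read in the product topology of the function type.\<close>

lemma compact_PiE_UNIV:
  fixes S :: "'i \<Rightarrow> 'a::topological_space set"
  assumes "\<And>i. compact (S i)"
  shows "compact (PiE UNIV S)"
proof -
  have "compactin (product_topology (\<lambda>i. euclidean) UNIV) (PiE UNIV S)"
    using assms by (simp add: compactin_PiE)
  then show ?thesis by (simp add: euclidean_product_topology)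
qed

text \<open>One step of Caratheodory's theorem for cones of rank-one Hermitian matrices.\<close>
lemma ketbra_sum_reduce:
  fixes x :: "nat \<Rightarrow> nat \<Rightarrow> complex" and M :: nat
  defines "N \<equiv> M * M"
  shows "\<exists>z. (\<forall>k<N. \<exists>l\<le>N. \<exists>c::real. z k = (\<lambda>r. complex_of_real c * x l r)) \<and>
    (\<forall>r<M. \<forall>s<M. (\<Sum>k\<le>N. x k r * cnj (x k s)) = (\<Sum>k<N. z k r * cnj (z k s)))"
proof -
  \<comment> \<open>There is one equation for each of the N = M * M entries and there are N + 1
    unknowns. A zero row makes the system square with determinant zero.\<close>
  define A where "A = mat\<^sub>r (Suc N) (Suc N) (\<lambda>t. if t = N then 0\<^sub>v (Suc N) else
    vec (Suc N) (\<lambda>k. x k (t div M) * cnj (x k (t mod M))))"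
  have A: "A \<in> carrier_mat (Suc N) (Suc N)" unfolding A_def by simp
  have "det A = 0" unfolding A_def by (rule det_row_0) auto
  with det_0_iff_vec_prod_zero_field[OF A] obtain v
    where v: "v \<in> carrier_vec (Suc N)" "v \<noteq> 0\<^sub>v (Suc N)" "A *\<^sub>v v = 0\<^sub>v (Suc N)" by auto
  have dep: "(\<Sum>k\<le>N. v $ k * (x k r * cnj (x k s))) = 0" if "r < M" "s < M" for r s
  proof -
    have t: "r * M + s < N" unfolding N_def using that by (rule block_index_less)
    have "(A *\<^sub>v v) $ (r * M + s) = 0" using v t by simp
    moreover have "(A *\<^sub>v v) $ (r * M + s) = (\<Sum>k\<le>N. v $ k * (x k r * cnj (x k s)))"
    proof -
      have "M \<noteq> 0" using that by auto
      have "(A *\<^sub>v v) $ (r * M + s) = row A (r * M + s) \<bullet> v" using t A by simp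
      also have "row A (r * M + s) = vec (Suc N) (\<lambda>k. x k r * cnj (x k s))"
        using t that \<open>M \<noteq> 0\<close> by (auto simp: A_def)
      also have "\<dots> \<bullet> v = (\<Sum>k\<le>N. v $ k * (x k r * cnj (x k s)))"
        unfolding scalar_prod_def using v(1)
        by (intro sum.cong) (auto simp: mult.commute)
      finally show ?thesis .
    qed
    ultimately show ?thesis by simp
  qed
  \<comment> \<open>Swapping \<open>r\<close> and \<open>s\<close> conjugates the rank-one matrices,
    so the conjugate coefficients satisfy the same relation, and hence so do the real and imaginary
    parts.\<close>
  have dep_cnj: "(\<Sum>k\<le>N. cnj (v $ k) * (x k r * cnj (x k s))) = 0" if "r < M" "s < M" for r s
  proof -
    have "(\<Sum>k\<le>N. cnj (v $ k) * (x k r * cnj (x k s))) = cnj (\<Sum>k\<le>N. v $ k * (x k s * cnj (x k r)))"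
      by (simp add: algebra_simps)
    then show ?thesis using dep[OF that(2,1)] by simp
  qed
  have comb: "(\<Sum>k\<le>N. (a * v $ k + b * cnj (v $ k)) * (x k r * cnj (x k s))) = 0"
    if "r < M" "s < M" for a b r s
  proof -
    have "(\<Sum>k\<le>N. (a * v $ k + b * cnj (v $ k)) * (x k r * cnj (x k s))) =
      a * (\<Sum>k\<le>N. v $ k * (x k r * cnj (x k s))) + b * (\<Sum>k\<le>N. cnj (v $ k) * (x k r * cnj (x k s)))"
      by (simp only: sum_distrib_left sum.distrib[symmetric]) (intro sum.cong refl, simp add: algebra_simps)
    then show ?thesis using dep[OF that] dep_cnj[OF that] by simp
  qed
  have "\<exists>k\<le>N. v $ k \<noteq> 0"
  proof (rule ccontr)
    assume "\<not> ?thesis"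
    then have "v = 0\<^sub>v (Suc N)" using v(1) by (intro eq_vecI) (auto simp: less_Suc_eq_le)
    with v(2) show False by simp
  qed
  then obtain k0 where k0: "k0 \<le> N" "v $ k0 \<noteq> 0" by blast
  obtain l :: "nat \<Rightarrow> real" where l0: "\<exists>k\<le>N. l k \<noteq> 0"
    and ldep: "\<And>r s. r < M \<Longrightarrow> s < M \<Longrightarrow> (\<Sum>k\<le>N. complex_of_real (l k) * (x k r * cnj (x k s))) = 0"
  proof (cases "Re (v $ k0) = 0")
    case False
    have "complex_of_real (Re c) = 1 / 2 * c + 1 / 2 * cnj c" for c by (simp add: complex_eq_iff)
    then show ?thesis using False k0 comb[of _ _ "1 / 2" "1 / 2"]
      by (intro that[of "\<lambda>k. Re (v $ k)"]) (auto simp only:)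
  next
    case True
    then have "Im (v $ k0) \<noteq> 0" using k0 by (simp add: complex_eq_iff)
    moreover have "complex_of_real (Im c) = (- \<i> / 2) * c + (\<i> / 2) * cnj c" for c by (simp add: complex_eq_iff)
    ultimately show ?thesis using k0 comb[of _ _ "- \<i> / 2" "\<i> / 2"]
      by (intro that[of "\<lambda>k. Im (v $ k)"]) (auto simp only:)
  qed
  \<comment> \<open>Eliminating a coefficient of maximal modulus keeps the remaining weights
    \<open>1 - l k / l m\<close> nonnegative.\<close>
  obtain m where m: "m \<le> N" "\<And>k. k \<le> N \<Longrightarrow> \<bar>l k\<bar> \<le> \<bar>l m\<bar>"
  proof -
    have fin: "finite ((\<lambda>k. \<bar>l k\<bar>) ` {..N})" by simp
    have "Max ((\<lambda>k. \<bar>l k\<bar>) ` {..N}) \<in> (\<lambda>k. \<bar>l k\<bar>) ` {..N}" by (rule Max_in[OF fin]) simp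
    then obtain m where m: "m \<le> N" "Max ((\<lambda>k. \<bar>l k\<bar>) ` {..N}) = \<bar>l m\<bar>" by blast
    have "\<bar>l k\<bar> \<le> \<bar>l m\<bar>" if "k \<le> N" for k
      unfolding m(2)[symmetric] using that by (intro Max_ge[OF fin]) simp
    with m(1) show ?thesis by (rule that)
  qed
  have lm: "l m \<noteq> 0" using l0 m(2) by fastforce
  define e where "e k = 1 - l k / l m" for k
  have e: "0 \<le> e k" if "k \<le> N" for k
    using m(2)[OF that] lm unfolding e_def
    by (simp add: divide_le_eq_1) linarith
  have em: "e m = 0" using lm by (simp add: e_def)
  \<comment> \<open>Index \<open>m\<close> has weight zero; the last vector takes its slot, so that
    the surviving indices are those below \<open>N\<close>.\<close>
  define \<tau> where "\<tau> k = (if k = m then N else k)" for k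
  define z where "z k = (\<lambda>r. complex_of_real (sqrt (e (\<tau> k))) * x (\<tau> k) r)" for k
  have \<tau>: "\<tau> k \<le> N" if "k < N" for k using that by (simp add: \<tau>_def)
  have "(\<Sum>k\<le>N. x k r * cnj (x k s)) = (\<Sum>k<N. z k r * cnj (z k s))" if "r < M" "s < M" for r s
  proof -
    define f where "f k = complex_of_real (e k) * (x k r * cnj (x k s))" for k
    have "(\<Sum>k\<le>N. x k r * cnj (x k s)) =
      (\<Sum>k\<le>N. f k) + (\<Sum>k\<le>N. complex_of_real (l k) * (x k r * cnj (x k s))) / complex_of_real (l m)"
      unfolding f_def e_def sum_divide_distrib sum.distrib[symmetric]
      by (intro sum.cong refl) (simp add: algebra_simps)
    then have 1: "(\<Sum>k\<le>N. x k r * cnj (x k s)) = (\<Sum>k\<le>N. f k)" using ldep[OF that] by simp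
    have "z k r * cnj (z k s) = f (\<tau> k)" if "k < N" for k
    proof -
      have "complex_of_real (e (\<tau> k)) = complex_of_real (sqrt (e (\<tau> k))) * complex_of_real (sqrt (e (\<tau> k)))"
        using e[OF \<tau>[OF that]] by (simp flip: of_real_mult)
      then show ?thesis unfolding z_def f_def by simp
    qed
    then have 2: "(\<Sum>k<N. z k r * cnj (z k s)) = (\<Sum>k<N. f (\<tau> k))" by simp
    have fm: "f m = 0" by (simp add: f_def em)
    have "(\<Sum>k\<le>N. f k) = (\<Sum>k<N. f (\<tau> k))"
    proof (cases "m = N")
      case True
      then show ?thesis using fm by (auto simp: \<tau>_def lessThan_Suc_atMost[symmetric] intro!: sum.cong)
    next
      case False
      then have mN: "m < N" using m(1) by simp
      have "(\<Sum>k<N. f (\<tau> k)) = f N + (\<Sum>k\<in>{..<N} - {m}. f k)"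
        using mN by (subst sum.remove[of _ m]) (auto simp: \<tau>_def intro!: sum.cong)
      moreover have "(\<Sum>k<N. f k) = (\<Sum>k\<in>{..<N} - {m}. f k)"
        using mN fm by (subst sum.remove[of _ m]) auto
      ultimately show ?thesis by (simp add: lessThan_Suc_atMost[symmetric])
    qed
    with 1 2 show ?thesis by simp
  qed
  then show ?thesis using \<tau> by (intro exI[of _ z]) (auto simp: z_def)
qed

section \<open>Projection onto a cone of rank-one matrices\<close>

lemma qf_identity: "qf n (\<lambda>r s. if r = s then c else 0) z = c * complex_of_real (\<Sum>r<n. (cmod (z r))\<^sup>2)"
  unfolding qf_def of_real_sum sum_distrib_left
  by (intro sum.cong refl, subst sum_single) (auto simp: complex_norm_square simp del: of_real_power)

lemma frob_identity: "frob n (\<lambda>r s. if r = s then 1 else 0) C = (\<Sum>r<n. C r r)"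
  unfolding frob_def by (intro sum.cong refl, subst sum_single) auto

text \<open>A disc is a closed part of the continuous image of a square.\<close>

lemma compact_cball_complex: "compact (cball (0::complex) B)"
proof -
  have "continuous_on ({- B..B} \<times> {- B..B}) (\<lambda>(x, y). complex_of_real x + \<i> * complex_of_real y)"
    unfolding case_prod_unfold by (intro continuous_intros)
  then have "compact ((\<lambda>(x, y). complex_of_real x + \<i> * complex_of_real y) ` ({- B..B} \<times> {- B..B}))"
    by (rule compact_continuous_image) (intro compact_Times compact_Icc)
  moreover have "cball (0::complex) B \<subseteq> (\<lambda>(x, y). complex_of_real x + \<i> * complex_of_real y) ` ({- B..B} \<times> {- B..B})"
  proof
    fix c :: complex assume "c \<in> cball 0 B"
    then have "\<bar>Re c\<bar> \<le> B" "\<bar>Im c\<bar> \<le> B"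
      using abs_Re_le_cmod[of c] abs_Im_le_cmod[of c] by auto
    then show "c \<in> (\<lambda>(x, y). complex_of_real x + \<i> * complex_of_real y) ` ({- B..B} \<times> {- B..B})"
      by (intro image_eqI[of _ _ "(Re c, Im c)"]) (auto simp: complex_eq_iff)
  qed
  ultimately show ?thesis by (metis closed_cball closed_Int_compact inf.absorb1)
qed

lemma real_scaled_ketbra:
  "(complex_of_real c * a) * cnj (complex_of_real c * b) = complex_of_real (c * c) * (a * cnj b)"
  by simp

text \<open>The distance from \<open>C\<close> to sums of \<open>M * M\<close> rank-one matrices is
  attained; the variational inequalities at the minimiser together with \<open>dual\<close> force it
  to be zero. The assumption \<open>trunc\<close> allows coordinates beyond \<open>M\<close> to be
  set to zero, which makes the search space compact.\<close>

lemma cone_duality: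
  fixes Z :: "(nat \<Rightarrow> complex) set" and C :: "nat \<Rightarrow> nat \<Rightarrow> complex" and M :: nat
  assumes "closed Z"
    and scale: "\<And>z c. z \<in> Z \<Longrightarrow> (\<lambda>r. complex_of_real c * z r) \<in> Z"
    and trunc: "\<And>z. z \<in> Z \<Longrightarrow> (\<lambda>r. if r < M then z r else 0) \<in> Z"
    and zero: "(\<lambda>_. 0) \<in> Z"
    and herm: "\<And>r s. r < M \<Longrightarrow> s < M \<Longrightarrow> C s r = cnj (C r s)"
    and dual: "\<And>W \<delta>. 0 < \<delta> \<Longrightarrow> (\<And>z. z \<in> Z \<Longrightarrow> complex_of_real (\<delta> * (\<Sum>r<M. (cmod (z r))\<^sup>2)) \<le> qf M W z)
      \<Longrightarrow> 0 \<le> Re (frob M W C)"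
  obtains z where "\<And>k. z k \<in> Z" "\<And>r s. r < M \<Longrightarrow> s < M \<Longrightarrow> C r s = (\<Sum>k<M * M. z k r * cnj (z k s))"
proof -
  define N where "N = M * M"
  define Y where "Y z r s = (\<Sum>k<N. z k r * cnj (z k s))" for z :: "nat \<Rightarrow> nat \<Rightarrow> complex" and r s
  define D where "D z r s = Y z r s - C r s" for z r s
  define g where "g z = Re (frob M (D z) (D z))" for z
  have g_sum: "g z = (\<Sum>r<M. \<Sum>s<M. (cmod (D z r s))\<^sup>2)" for z
    unfolding g_def by (rule frob_self)
  define G where "G = g (\<lambda>_ _. 0)"
  \<comment> \<open>If \<open>z\<close> is no farther from \<open>C\<close> than the zero tuple, a
    diagonal entry of \<open>Y z\<close> exceeds that of \<open>C\<close> in modulus by at most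
    \<open>sqrt G\<close>; this bounds all relevant coordinates by \<open>B\<close>.\<close>
  define B where "B = sqrt ((\<Sum>r<M. cmod (C r r)) + sqrt G)"
  define K where "K = (PiE UNIV (\<lambda>_. Z \<inter> PiE UNIV (\<lambda>_. cball 0 B)) :: (nat \<Rightarrow> nat \<Rightarrow> complex) set)"
  have Y_herm: "Y z s r = cnj (Y z r s)" for z r s
    unfolding Y_def by (simp add: mult.commute)
  have B: "0 \<le> B" unfolding B_def G_def g_sum by (intro real_sqrt_ge_zero add_nonneg_nonneg sum_nonneg) auto
  have "compact K"
    unfolding K_def by (intro compact_PiE_UNIV closed_Int_compact \<open>closed Z\<close> compact_cball_complex)
  moreover have K0: "(\<lambda>_ _. 0) \<in> K"
    using zero B by (auto simp: K_def)
  moreover have "continuous_on K g"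
  proof -
    have coord: "continuous_on K (\<lambda>z. z k r)" for k r
      by (rule continuous_on_product_then_coordinatewise)
        (rule continuous_on_subset[OF continuous_on_product_coordinates], simp)
    show ?thesis
      unfolding g_sum[abs_def] D_def Y_def
      by (intro continuous_intros coord)
  qed
  ultimately obtain z0 where z0: "z0 \<in> K" and min_K: "\<And>z. z \<in> K \<Longrightarrow> g z0 \<le> g z"
    using continuous_attains_inf[of K g] by blast
  have z0_Z: "z0 k \<in> Z" for k using z0 by (auto simp: K_def)
  have bounded: "cmod (z k r) \<le> B" if "g z \<le> G" "k < N" "r < M" for z k r
  proof -
    have "(cmod (z k r))\<^sup>2 \<le> (\<Sum>k<N. (cmod (z k r))\<^sup>2)"
      using that(2) by (intro member_le_sum) auto
    also have "\<dots> = Re (Y z r r)"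
      unfolding Y_def Re_sum by (intro sum.cong refl) (simp add: cmod_power2 flip: power2_eq_square)
    also have "\<dots> \<le> cmod (C r r + D z r r)"
      unfolding D_def by (simp add: complex_Re_le_cmod)
    also have "\<dots> \<le> cmod (C r r) + cmod (D z r r)" by (rule norm_triangle_ineq)
    also have "cmod (C r r) \<le> (\<Sum>r<M. cmod (C r r))" using that(3) by (intro member_le_sum) auto
    also have "cmod (D z r r) \<le> sqrt (g z)"
    proof (rule real_le_rsqrt)
      have "(cmod (D z r r))\<^sup>2 \<le> (\<Sum>s<M. (cmod (D z r s))\<^sup>2)" using that(3) by (intro member_le_sum) auto
      also have "\<dots> \<le> g z" unfolding g_sum using that(3)
        by (intro member_le_sum[of r "{..<M}" "\<lambda>r. \<Sum>s<M. (cmod (D z r s))\<^sup>2"]) (auto intro: sum_nonneg)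
      finally show "(cmod (D z r r))\<^sup>2 \<le> g z" .
    qed
    also have "sqrt (g z) \<le> sqrt G" using that(1) by simp
    finally show ?thesis unfolding B_def by (intro real_le_rsqrt) simp
  qed
  \<comment> \<open>A tuple worse than zero cannot beat the minimum over \<open>K\<close>; any other
    tuple has a truncation in \<open>K\<close> at the same distance.\<close>
  have min: "g z0 \<le> g z" if z: "\<And>k. k < N \<Longrightarrow> z k \<in> Z" for z
  proof (cases "g z \<le> G")
    case False
    then show ?thesis using min_K[OF K0] unfolding G_def by simp
  next
    case True
    \<comment> \<open>Both the tuple index and the coordinate are cut off, because membership in
      \<open>K\<close> bounds the value at every natural number.\<close>
    define z' where "z' k r = (if k < N then (if r < M then z k r else 0) else 0)" for k r
    have "z' k \<in> Z" for k
      using trunc[OF z[of k]] zero unfolding z'_def by (cases "k < N") auto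
    moreover have "cmod (z' k r) \<le> B" for k r
      using bounded[OF True] B unfolding z'_def by auto
    ultimately have "z' \<in> K" unfolding K_def by auto
    moreover have "Y z' r s = Y z r s" if "r < M" "s < M" for r s
      unfolding Y_def z'_def using that by (intro sum.cong refl) auto
    then have "g z' = g z" unfolding g_def D_def by (intro arg_cong[of _ _ Re] frob_cong) auto
    ultimately show ?thesis using min_K by metis
  qed
  have D_herm: "D z s r = cnj (D z r s)" if "r < M" "s < M" for z r s
    unfolding D_def by (simp add: Y_herm[of z s r] herm[OF that])
  \<comment> \<open>Adding t |z><z| to the nearest point gives N + 1 generators, which
    \<open>ketbra_sum_reduce\<close> brings back to \<open>N\<close>. Minimality then makes the
    derivative in this direction nonnegative.\<close>
  have block_pos: "0 \<le> Re (qf M (D z0) z)" if z: "z \<in> Z" for z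
  proof (rule nonneg_of_quadratic_perturbation)
    fix t :: real assume t: "0 < t" "t < 1"
    define x where "x k = (if k < N then z0 k else (\<lambda>r. complex_of_real (sqrt t) * z r))" for k
    have "x k \<in> Z" for k unfolding x_def using z0_Z scale[OF z] by auto
    moreover obtain y where y: "\<forall>k<N. \<exists>l\<le>N. \<exists>c::real. y k = (\<lambda>r. complex_of_real c * x l r)"
      and yY: "\<forall>r<M. \<forall>s<M. (\<Sum>k\<le>N. x k r * cnj (x k s)) = (\<Sum>k<N. y k r * cnj (y k s))"
      using ketbra_sum_reduce[of M x] unfolding N_def by blast
    ultimately have "y k \<in> Z" if "k < N" for k
      using that scale by fastforce
    then have "g z0 \<le> g y" by (rule min)
    moreover have "D y r s = D z0 r s + complex_of_real t * (z r * cnj (z s))" if "r < M" "s < M" for r s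
    proof -
      have "Y y r s = (\<Sum>k\<le>N. x k r * cnj (x k s))" using yY that by (simp add: Y_def)
      also have "\<dots> = Y z0 r s + x N r * cnj (x N s)"
        by (simp add: Y_def x_def lessThan_Suc_atMost[symmetric])
      also have "x N r * cnj (x N s) = complex_of_real (sqrt t * sqrt t) * (z r * cnj (z s))"
        unfolding x_def by (simp only: less_irrefl if_False real_scaled_ketbra)
      finally show ?thesis using t by (simp add: D_def)
    qed
    then have "g y = g z0 + 2 * t * Re (frob M (D z0) (\<lambda>r s. z r * cnj (z s))) +
        t\<^sup>2 * Re (frob M (\<lambda>r s. z r * cnj (z s)) (\<lambda>r s. z r * cnj (z s)))"
      unfolding g_def frob_perturb[symmetric] by (intro arg_cong[of _ _ Re] frob_cong) auto
    ultimately show "0 \<le> 2 * t * Re (qf M (D z0) z) + t\<^sup>2 * Re (frob M (\<lambda>r s. z r * cnj (z s)) (\<lambda>r s. z r * cnj (z s)))"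
      by (simp add: frob_rank_one)
  qed
  \<comment> \<open>Shrinking the nearest point by the factor \<open>1 - t\<close> stays in the
    cone.\<close>
  have orth: "0 \<le> - Re (frob M (D z0) (Y z0))"
  proof (rule nonneg_of_quadratic_perturbation)
    fix t :: real assume t: "0 < t" "t < 1"
    define y where "y k r = complex_of_real (sqrt (1 - t)) * z0 k r" for k r
    have "g z0 \<le> g y" by (rule min) (auto simp: y_def[abs_def] intro!: scale z0_Z)
    moreover have "D y r s = D z0 r s + complex_of_real (- t) * Y z0 r s" for r s
    proof -
      have "y k r * cnj (y k s) = complex_of_real (sqrt (1 - t) * sqrt (1 - t)) * (z0 k r * cnj (z0 k s))" for k
        unfolding y_def by (rule real_scaled_ketbra)
      then have "Y y r s = complex_of_real (1 - t) * Y z0 r s"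
        unfolding Y_def sum_distrib_left using t by simp
      then show ?thesis by (simp add: D_def algebra_simps)
    qed
    then have "g y = g z0 + 2 * (- t) * Re (frob M (D z0) (Y z0)) + (- t)\<^sup>2 * Re (frob M (Y z0) (Y z0))"
      unfolding g_def frob_perturb[symmetric] by (intro arg_cong[of _ _ Re] frob_cong) auto
    ultimately show "0 \<le> 2 * t * - Re (frob M (D z0) (Y z0)) + t\<^sup>2 * Re (frob M (Y z0) (Y z0))" by simp
  qed
  have "0 \<le> Re (frob M (D z0) C)"
  proof (rule nonneg_of_linear_perturbation)
    fix t :: real assume t: "0 < t"
    \<comment> \<open>The multiple of the identity supplies the margin \<open>\<delta> = t\<close>
      that \<open>dual\<close> demands.\<close>
    define W where "W r s = D z0 r s + complex_of_real t * (if r = s then 1 else 0)" for r s :: nat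
    have "complex_of_real (t * (\<Sum>r<M. (cmod (z r))\<^sup>2)) \<le> qf M W z" if "z \<in> Z" for z
    proof -
      have "qf M W z = qf M (D z0) z + complex_of_real (t * (\<Sum>r<M. (cmod (z r))\<^sup>2))"
        unfolding W_def qf_add qf_scale qf_identity by simp
      moreover have "0 \<le> qf M (D z0) z"
        using block_pos[OF that] qf_hermitian_real[OF D_herm] by (simp add: less_eq_complex_def)
      ultimately show ?thesis by simp
    qed
    from dual[OF t this] have "0 \<le> Re (frob M W C)" .
    also have "frob M W C = frob M (D z0) C + complex_of_real t * (\<Sum>r<M. C r r)"
      unfolding W_def frob_add_left frob_scale_left frob_identity by simp
    finally show "0 \<le> Re (frob M (D z0) C) + t * Re (\<Sum>r<M. C r r)" by simp
  qed
  \<comment> \<open>The squared distance is <D, Y> - <D, C>. The real part of the first term is at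
    most zero by \<open>orth\<close>, that of <D, C> is nonnegative by \<open>dual\<close>.\<close>
  moreover have "frob M (D z0) (D z0) = frob M (D z0) (Y z0) - frob M (D z0) C"
    unfolding frob_diff_right[symmetric] D_def[abs_def] ..
  ultimately have g_le: "g z0 \<le> 0" using orth by (simp add: g_def)
  have le_g: "(cmod (D z0 r s))\<^sup>2 \<le> g z0" if "r < M" "s < M" for r s
  proof -
    have "(cmod (D z0 r s))\<^sup>2 \<le> (\<Sum>s<M. (cmod (D z0 r s))\<^sup>2)" using that by (intro member_le_sum) auto
    also have "\<dots> \<le> g z0" unfolding g_sum using that
      by (intro member_le_sum[of r "{..<M}" "\<lambda>r. \<Sum>s<M. (cmod (D z0 r s))\<^sup>2"]) (auto intro: sum_nonneg)
    finally show ?thesis .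
  qed
  have "D z0 r s = 0" if "r < M" "s < M" for r s
    using order_trans[OF le_g[OF that] g_le] by simp
  then show ?thesis using z0_Z by (intro that[of z0]) (auto simp: D_def Y_def N_def)
qed

section \<open>Rank, traces and linear maps in coordinates\<close>

context vec_space
begin

lemma lin_indpt_singleton:
  assumes "v \<in> carrier_vec n" "v \<noteq> 0\<^sub>v n"
  shows "lin_indpt {v}"
proof -
  have "lin_indpt {}" unfolding lin_dep_def by auto
  moreover have "v \<notin> span {}" using assms span_empty by auto
  ultimately show ?thesis using lin_dep_iff_in_span[of "{}" v] assms by auto
qed

text \<open>A nonzero column spans all the others, since two independent columns would give rank at
  least two.\<close>

lemma rank_one_product:
  assumes A: "A \<in> carrier_mat n nc" and "rank A = 1"
  shows "\<exists>f g. \<forall>i<n. \<forall>j<nc. A $$ (i, j) = f i * g j"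
proof -
  have cols: "set (cols A) \<subseteq> carrier_vec n" using A cols_dim by blast
  have colI: "col A j \<in> set (cols A)" if "j < nc" for j
    using that A by (metis carrier_matD(2) cols_length cols_nth nth_mem)
  show ?thesis
  proof (cases "\<exists>v\<in>set (cols A). v \<noteq> 0\<^sub>v n")
    case True
    then obtain v where v: "v \<in> set (cols A)" "v \<noteq> 0\<^sub>v n" by blast
    have ind: "lin_indpt {v}" using lin_indpt_singleton v cols by blast
    have "\<exists>c. \<forall>i<n. A $$ (i, j) = v $ i * c" if j: "j < nc" for j
    proof (cases "col A j = v")
      case True
      then show ?thesis using j A by (intro exI[of _ 1]) auto
    next
      case False
      have "lin_dep ({v} \<union> {col A j})"
      proof (rule ccontr)
        assume "\<not> ?thesis"
        from rank_ge_card_indpt[OF A _ this] have "card ({v} \<union> {col A j}) \<le> 1"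
          using v(1) colI[OF j] assms(2) by auto
        with False show False by simp
      qed
      then have "col A j \<in> span {v}"
        using lin_dep_iff_in_span[of "{v}" "col A j"] ind False cols v(1) colI[OF j] by auto
      then obtain a where a: "lincomb a {v} = col A j"
        using finite_in_span[of "{v}" "col A j"] cols v(1) by auto
      have "A $$ (i, j) = v $ i * a v" if "i < n" for i
      proof -
        have "lincomb a {v} $ i = a v * v $ i"
          using lincomb_index[OF that, of "{v}" a] cols v(1) by auto
        then show ?thesis using a that j A by simp
      qed
      then show ?thesis by blast
    qed
    then obtain g where "\<And>i j. j < nc \<Longrightarrow> i < n \<Longrightarrow> A $$ (i, j) = v $ i * g j" by metis
    then show ?thesis by (intro exI[of _ "\<lambda>i. v $ i"] exI[of _ g]) auto
  next
    case False
    then have "A $$ (i, j) = 0" if "i < n" "j < nc" for i j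
      using colI[OF that(2)] that A by (metis carrier_matD index_col index_zero_vec(1))
    then show ?thesis by (intro exI[of _ "\<lambda>_. 0"]) auto
  qed
qed

lemma rank_product_eq_one:
  assumes A: "A \<in> carrier_mat n nc" and prod: "\<And>i j. i < n \<Longrightarrow> j < nc \<Longrightarrow> A $$ (i, j) = f i * g j"
    and nz: "A \<noteq> 0\<^sub>m n nc"
  shows "rank A = 1"
proof -
  have "rank A \<le> 1" by (rule rank_le_1_product_entries[OF A]) (use A prod in auto)
  moreover have "1 \<le> rank A"
  proof -
    obtain i j where ij: "i < n" "j < nc" "A $$ (i, j) \<noteq> 0"
      using nz A by (metis eq_matI carrier_matD index_zero_mat)
    then have "col A j \<noteq> 0\<^sub>v n" using A by (metis carrier_matD index_col index_zero_vec(1))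
    moreover have "col A j \<in> carrier_vec n" using A by auto
    moreover have "col A j \<in> set (cols A)"
      using ij A by (metis carrier_matD(2) cols_length cols_nth nth_mem)
    ultimately show ?thesis
      using rank_ge_card_indpt[OF A, of "{col A j}"] lin_indpt_singleton by auto
  qed
  ultimately show ?thesis by simp
qed

end

section \<open>Entries of products, sums and linear images\<close>

lemma mat_adjoint_index:
  fixes A :: "complex mat"
  assumes "A \<in> carrier_mat n m" "i < m" "j < n"
  shows "mat_adjoint A $$ (i, j) = cnj (A $$ (j, i))"
  using assms unfolding mat_adjoint_def by (auto simp: mat_of_rows_index)

lemma mat_adjoint_carrier:
  fixes A :: "complex mat"
  assumes "A \<in> carrier_mat n m"
  shows "mat_adjoint A \<in> carrier_mat m n"
  using assms unfolding mat_adjoint_def by auto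

lemma mult_mat_index:
  assumes "A \<in> carrier_mat n k" "B \<in> carrier_mat k m" "i < n" "j < m"
  shows "(A * B) $$ (i, j) = (\<Sum>l<k. A $$ (i, l) * B $$ (l, j))"
  using assms by (auto simp: scalar_prod_def lessThan_atLeast0)

lemma sandwich_index:
  fixes A X :: "complex mat"
  assumes "A \<in> carrier_mat n m" "X \<in> carrier_mat m m" "i < n" "j < n"
  shows "(A * X * mat_adjoint A) $$ (i, j) = (\<Sum>a<m. \<Sum>b<m. A $$ (i, a) * X $$ (a, b) * cnj (A $$ (j, b)))"
proof -
  have "(A * X * mat_adjoint A) $$ (i, j) = (\<Sum>b<m. (\<Sum>a<m. A $$ (i, a) * X $$ (a, b)) * cnj (A $$ (j, b)))"
    using assms mat_adjoint_carrier[OF assms(1)]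
    by (subst mult_mat_index[of _ n m]) (auto simp: mult_mat_index[of _ n m] mat_adjoint_index[OF assms(1)] intro!: sum.cong simp del: index_mult_mat)
  also have "\<dots> = (\<Sum>a<m. \<Sum>b<m. A $$ (i, a) * X $$ (a, b) * cnj (A $$ (j, b)))"
    unfolding sum_distrib_right by (rule sum.swap)
  finally show ?thesis .
qed

lemma mat_sum_carrier [simp]: "mat_sum n f I \<in> carrier_mat n n"
  by (simp add: mat_sum_def)

lemma mat_sum_dim [simp]: "dim_row (mat_sum n f I) = n" "dim_col (mat_sum n f I) = n"
  by (simp_all add: mat_sum_def)

lemma mat_sum_index [simp]: "i < n \<Longrightarrow> j < n \<Longrightarrow> mat_sum n f I $$ (i, j) = (\<Sum>k\<in>I. f k $$ (i, j))"
  by (simp add: mat_sum_def)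

lemma mat_trace_eq: "A \<in> carrier_mat n n \<Longrightarrow> mat_trace A = (\<Sum>i<n. A $$ (i, i))"
  by (auto simp: mat_trace_def)

lemma mat_trace_mult:
  assumes "A \<in> carrier_mat n n" "B \<in> carrier_mat n n"
  shows "mat_trace (A * B) = (\<Sum>i<n. \<Sum>j<n. A $$ (i, j) * B $$ (j, i))"
  using assms by (auto simp: mat_trace_eq[of _ n] mult_mat_index[of _ n n _ n] simp del: index_mult_mat intro!: sum.cong)

lemma lin_mapD:
  assumes "lin_map a b \<Phi>"
  shows "X \<in> carrier_mat a a \<Longrightarrow> \<Phi> X \<in> carrier_mat b b"
    and "X \<in> carrier_mat a a \<Longrightarrow> Y \<in> carrier_mat a a \<Longrightarrow> \<Phi> (X + Y) = \<Phi> X + \<Phi> Y"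
    and "X \<in> carrier_mat a a \<Longrightarrow> \<Phi> (c \<cdot>\<^sub>m X) = c \<cdot>\<^sub>m \<Phi> X"
  using assms by (auto simp: lin_map_def)

lemma lin_map_sum:
  assumes "lin_map a b \<Phi>" "finite I" "\<And>k. k \<in> I \<Longrightarrow> Y k \<in> carrier_mat a a"
  shows "\<Phi> (mat_sum a (\<lambda>k. c k \<cdot>\<^sub>m Y k) I) = mat_sum b (\<lambda>k. c k \<cdot>\<^sub>m \<Phi> (Y k)) I"
  using assms(2,3)
proof (induction I)
  case empty
  have "\<Phi> (0\<^sub>m a a) = \<Phi> (0 \<cdot>\<^sub>m 0\<^sub>m a a)" by simp
  also have "\<dots> = 0 \<cdot>\<^sub>m \<Phi> (0\<^sub>m a a)" by (rule lin_mapD(3)[OF assms(1)]) simp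
  also have "\<dots> = 0\<^sub>m b b" using lin_mapD(1)[OF assms(1), of "0\<^sub>m a a"] by (intro eq_matI) auto
  finally have "\<Phi> (0\<^sub>m a a) = 0\<^sub>m b b" .
  moreover have "mat_sum a (\<lambda>k. c k \<cdot>\<^sub>m Y k) {} = 0\<^sub>m a a" by (rule eq_matI) (auto simp: mat_sum_def)
  moreover have "mat_sum b (\<lambda>k. c k \<cdot>\<^sub>m \<Phi> (Y k)) {} = 0\<^sub>m b b" by (rule eq_matI) (auto simp: mat_sum_def)
  ultimately show ?case by simp
next
  case (insert x I)
  have ins: "mat_sum n (\<lambda>k. c k \<cdot>\<^sub>m Z k) (insert x I) = c x \<cdot>\<^sub>m Z x + mat_sum n (\<lambda>k. c k \<cdot>\<^sub>m Z k) I"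
    if "Z x \<in> carrier_mat n n" for n and Z :: "'a \<Rightarrow> complex mat"
    using that insert.hyps by (intro eq_matI) (auto simp: mat_sum_def)
  have Y: "Y x \<in> carrier_mat a a" using insert.prems by simp
  have "\<Phi> (mat_sum a (\<lambda>k. c k \<cdot>\<^sub>m Y k) (insert x I)) = c x \<cdot>\<^sub>m \<Phi> (Y x) + \<Phi> (mat_sum a (\<lambda>k. c k \<cdot>\<^sub>m Y k) I)"
    unfolding ins[of Y a, OF Y] using Y by (simp add: lin_mapD(2,3)[OF assms(1)])
  also have "\<dots> = mat_sum b (\<lambda>k. c k \<cdot>\<^sub>m \<Phi> (Y k)) (insert x I)"
    using insert.IH insert.prems ins[of "\<lambda>k. \<Phi> (Y k)" b, OF lin_mapD(1)[OF assms(1) Y]] by simp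
  finally show ?case .
qed

lemma smult_mat_index:
  assumes "A \<in> carrier_mat n m" "i < n" "j < m"
  shows "(c \<cdot>\<^sub>m A) $$ (i, j) = c * A $$ (i, j)"
  using assms by auto

lemma lin_map_expand:
  assumes "lin_map a b \<Phi>" "finite I" "\<And>k. k \<in> I \<Longrightarrow> Y k \<in> carrier_mat a a" "X \<in> carrier_mat a a"
    and "\<And>i j. i < a \<Longrightarrow> j < a \<Longrightarrow> X $$ (i, j) = (\<Sum>k\<in>I. c k * Y k $$ (i, j))"
    and "r < b" "s < b"
  shows "\<Phi> X $$ (r, s) = (\<Sum>k\<in>I. c k * \<Phi> (Y k) $$ (r, s))"
proof -
  have X: "X = mat_sum a (\<lambda>k. c k \<cdot>\<^sub>m Y k) I"
    using assms(4,5) smult_mat_index[OF assms(3)] by (intro eq_matI) (auto intro!: sum.cong)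
  have "\<Phi> X = mat_sum b (\<lambda>k. c k \<cdot>\<^sub>m \<Phi> (Y k)) I"
    unfolding X by (rule lin_map_sum[OF assms(1-3)])
  then show ?thesis
    using assms(6,7) smult_mat_index[OF lin_mapD(1)[OF assms(1) assms(3)]] by (auto intro!: sum.cong)
qed

lemma id_tensor_index:
  assumes "p < n" "q < n" "i < b" "j < b"
  shows "id_tensor n a b \<Phi> X $$ (p * b + i, q * b + j) = \<Phi> (block a X p q) $$ (i, j)"
  using assms by (simp add: id_tensor_def block_index_less)

lemma tensor_mat_index:
  assumes "A \<in> carrier_mat n n" "B \<in> carrier_mat m m" "p < n" "q < n" "i < m" "j < m"
  shows "tensor_mat A B $$ (p * m + i, q * m + j) = A $$ (p, q) * B $$ (i, j)"
  using assms by (simp add: tensor_mat_def block_index_less)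

lemma tensor_mat_carrier:
  assumes "A \<in> carrier_mat n n" "B \<in> carrier_mat m m"
  shows "tensor_mat A B \<in> carrier_mat (n * m) (n * m)"
  using assms by (auto simp: tensor_mat_def)

lemma block_index: "i < a \<Longrightarrow> j < a \<Longrightarrow> block a X p q $$ (i, j) = X $$ (p * a + i, q * a + j)"
  by (simp add: block_def)

lemma pair_index_exhaust:
  fixes r n m :: nat
  assumes "r < n * m"
  obtains p i where "p < n" "i < m" "r = p * m + i"
  using that[of "r div m" "r mod m"] div_less_of_less_mult[OF assms] by simp

lemma tensor_index_eqI:
  assumes "X \<in> carrier_mat (n * m) (n * m)" "Y \<in> carrier_mat (n * m) (n * m)"
    and "\<And>p q i j. p < n \<Longrightarrow> q < n \<Longrightarrow> i < m \<Longrightarrow> j < m \<Longrightarrow>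
      X $$ (p * m + i, q * m + j) = Y $$ (p * m + i, q * m + j)"
  shows "X = Y"
proof (rule eq_matI)
  fix r s assume rs: "r < dim_row Y" "s < dim_col Y"
  then obtain p i q j where "p < n" "i < m" "r = p * m + i" "q < n" "j < m" "s = q * m + j"
    using assms(2) by (metis carrier_matD pair_index_exhaust)
  then show "X $$ (r, s) = Y $$ (r, s)" using assms(3) by simp
qed (use assms in auto)

text \<open>Tensor products of the Gram vectors of \<open>P\<close> and \<open>Q\<close> are Gram
  vectors of the tensor product.\<close>

lemma psd_tensor_mat:
  assumes "psd n P" "psd m Q"
  shows "psd (n * m) (tensor_mat P Q)"
proof -
  obtain f where f: "\<And>i j. i < n \<Longrightarrow> j < n \<Longrightarrow> P $$ (i, j) = (\<Sum>k<n. f k i * cnj (f k j))"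
    using psd_decomp[OF assms(1)] by metis
  obtain g where g: "\<And>i j. i < m \<Longrightarrow> j < m \<Longrightarrow> Q $$ (i, j) = (\<Sum>k<m. g k i * cnj (g k j))"
    using psd_decomp[OF assms(2)] by metis
  define h where "h = (\<lambda>(k, l) r. f k (r div m) * g l (r mod m))"
  note c = psdD(1)[OF assms(1)] psdD(1)[OF assms(2)]
  show ?thesis
  proof (rule psdI_decomp[where I = "{..<n} \<times> {..<m}" and f = h])
    fix r s assume rs: "r < n * m" "s < n * m"
    have "tensor_mat P Q $$ (r, s) = P $$ (r div m, s div m) * Q $$ (r mod m, s mod m)"
      using c rs by (simp add: tensor_mat_def)
    also have "\<dots> = (\<Sum>k<n. \<Sum>l<m. (f k (r div m) * cnj (f k (s div m))) * (g l (r mod m) * cnj (g l (s mod m))))"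
      using div_less_of_less_mult[OF rs(1)] div_less_of_less_mult[OF rs(2)] by (simp add: f g sum_product)
    also have "\<dots> = (\<Sum>k\<in>{..<n} \<times> {..<m}. h k r * cnj (h k s))"
      unfolding sum.cartesian_product by (intro sum.cong refl) (auto simp: h_def)
    finally show "tensor_mat P Q $$ (r, s) = (\<Sum>k\<in>{..<n} \<times> {..<m}. h k r * cnj (h k s))" .
  qed (use c tensor_mat_carrier in auto)
qed

lemma psd_mat_sum:
  assumes "\<And>k. k \<in> I \<Longrightarrow> psd n (X k)"
  shows "psd n (mat_sum n X I)"
  unfolding psd_iff
proof (intro conjI allI mat_sum_carrier)
  fix x
  have "qf n (\<lambda>i j. mat_sum n X I $$ (i, j)) x = qf n (\<lambda>i j. \<Sum>k\<in>I. X k $$ (i, j)) x"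
    by (rule qf_cong) auto
  also have "0 \<le> \<dots>" unfolding qf_sum using psdD(2)[OF assms] by (intro sum_nonneg) auto
  finally show "0 \<le> qf n (\<lambda>i j. mat_sum n X I $$ (i, j)) x" .
qed

lemma psd_smult:
  assumes "psd n X" "0 \<le> c"
  shows "psd n (c \<cdot>\<^sub>m X)"
  unfolding psd_iff
proof (intro conjI allI)
  fix x
  have "qf n (\<lambda>i j. (c \<cdot>\<^sub>m X) $$ (i, j)) x = qf n (\<lambda>i j. c * X $$ (i, j)) x"
    using psdD(1)[OF assms(1)] by (intro qf_cong) auto
  also have "0 \<le> \<dots>" unfolding qf_scale using psdD(2)[OF assms(1)] assms(2) by simp
  finally show "0 \<le> qf n (\<lambda>i j. (c \<cdot>\<^sub>m X) $$ (i, j)) x" .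
qed (use psdD(1)[OF assms(1)] in auto)

section \<open>Matrix units and traces of positive matrices\<close>

definition mat_unit :: "nat \<Rightarrow> nat \<Rightarrow> nat \<Rightarrow> complex mat" where
  "mat_unit n i j = mat n n (\<lambda>(r, s). if r = i \<and> s = j then 1 else 0)"

lemma mat_unit_carrier [simp]: "mat_unit n i j \<in> carrier_mat n n"
  by (simp add: mat_unit_def)

lemma mat_unit_expand:
  assumes "r < n" "s < n"
  shows "X $$ (r, s) = (\<Sum>k\<in>{..<n} \<times> {..<n}. X $$ k * mat_unit n (fst k) (snd k) $$ (r, s))"
  using assms by (subst sum.mono_neutral_right[of _ "{(r, s)}"]) (auto simp: mat_unit_def)

lemma lin_map_mat_unit_expand:
  assumes "lin_map a b \<Phi>" "X \<in> carrier_mat a a" "r < b" "s < b"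
  shows "\<Phi> X $$ (r, s) = (\<Sum>i<a. \<Sum>j<a. X $$ (i, j) * \<Phi> (mat_unit a i j) $$ (r, s))"
proof -
  have "\<Phi> X $$ (r, s) = (\<Sum>k\<in>{..<a} \<times> {..<a}. X $$ k * \<Phi> (mat_unit a (fst k) (snd k)) $$ (r, s))"
    using assms by (intro lin_map_expand[OF assms(1)] mat_unit_expand) auto
  then show ?thesis by (simp add: sum.cartesian_product case_prod_unfold)
qed

lemma sum_swap3: "(\<Sum>i\<in>A. \<Sum>j\<in>B. \<Sum>k\<in>C. f i j k) = (\<Sum>k\<in>C. \<Sum>i\<in>A. \<Sum>j\<in>B. f i j k)"
proof -
  have "(\<Sum>i\<in>A. \<Sum>j\<in>B. \<Sum>k\<in>C. f i j k) = (\<Sum>i\<in>A. \<Sum>k\<in>C. \<Sum>j\<in>B. f i j k)"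
    by (intro sum.cong[OF refl] sum.swap)
  also have "\<dots> = (\<Sum>k\<in>C. \<Sum>i\<in>A. \<Sum>j\<in>B. f i j k)" by (rule sum.swap)
  finally show ?thesis .
qed

text \<open>Splitting \<open>F\<close> into matrices |f><f| turns the trace into a sum of values <f,
  G f>.\<close>

lemma mat_trace_psd_mult_nonneg:
  assumes "psd n F" "psd n G"
  shows "0 \<le> mat_trace (F * G)"
proof -
  obtain f where f: "\<And>i j. i < n \<Longrightarrow> j < n \<Longrightarrow> F $$ (i, j) = (\<Sum>k<n. f k i * cnj (f k j))"
    using psd_decomp[OF assms(1)] by metis
  have "mat_trace (F * G) = (\<Sum>i<n. \<Sum>j<n. \<Sum>k<n. cnj (f k j) * G $$ (j, i) * f k i)"
    unfolding mat_trace_mult[OF psdD(1)[OF assms(1)] psdD(1)[OF assms(2)]]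
    by (intro sum.cong refl) (simp add: f sum_distrib_left mult_ac)
  also have "\<dots> = (\<Sum>k<n. \<Sum>i<n. \<Sum>j<n. cnj (f k j) * G $$ (j, i) * f k i)"
    by (rule sum_swap3)
  also have "\<dots> = (\<Sum>k<n. qf n (\<lambda>i j. G $$ (i, j)) (f k))"
    unfolding qf_def by (intro sum.cong refl sum.swap)
  finally show ?thesis using psdD(2)[OF assms(2)] by (simp add: sum_nonneg)
qed

lemma mat_trace_psd_nonneg: "psd n A \<Longrightarrow> 0 \<le> mat_trace A"
  using psdD(1)[of n A] qf_nonneg_diag[of n "\<lambda>i j. A $$ (i, j)"] psdD(2)[of n A]
  by (auto simp: mat_trace_eq[of _ n] intro!: sum_nonneg)

text \<open>A zero trace kills the diagonal, and a zero diagonal entry kills its column.\<close>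

lemma psd_trace_zero:
  assumes "psd n A" "mat_trace A = 0" "i < n" "j < n"
  shows "A $$ (i, j) = 0"
proof -
  have pos: "0 \<le> A $$ (k, k)" if "k < n" for k
    using qf_nonneg_diag[of n "\<lambda>i j. A $$ (i, j)"] psdD(2)[OF assms(1)] that by auto
  have "(\<Sum>k<n. A $$ (k, k)) = 0" using assms(2) psdD(1)[OF assms(1)] by (simp add: mat_trace_eq)
  then have "A $$ (j, j) = 0"
    using sum_nonneg_eq_0_iff[of "{..<n}" "\<lambda>k. A $$ (k, k)"] pos assms(4) by auto
  then show ?thesis
    using qf_nonneg_zero_diag[of n "\<lambda>i j. A $$ (i, j)" j i] psdD(2)[OF assms(1)] assms(3,4) by auto
qed

section \<open>Measure-and-prepare maps\<close>

text \<open>The partial trace of (I \<otimes> F) \<Gamma> over the second factor: the unnormalised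
  state of the first factor after outcome \<open>F\<close>.\<close>

definition partial_measure :: "nat \<Rightarrow> nat \<Rightarrow> complex mat \<Rightarrow> complex mat \<Rightarrow> complex mat" where
  "partial_measure n a F \<Gamma> = mat n n (\<lambda>(p, q). mat_trace (F * block a \<Gamma> p q))"

lemma psd_partial_measure:
  assumes "psd a F" "psd (n * a) \<Gamma>"
  shows "psd n (partial_measure n a F \<Gamma>)"
proof -
  obtain f where f: "\<And>i j. i < a \<Longrightarrow> j < a \<Longrightarrow> F $$ (i, j) = (\<Sum>k<a. f k i * cnj (f k j))"
    using psd_decomp[OF assms(1)] by metis
  obtain g where g: "\<And>r s. r < n * a \<Longrightarrow> s < n * a \<Longrightarrow> \<Gamma> $$ (r, s) = (\<Sum>l<n * a. g l r * cnj (g l s))"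
    using psd_decomp[OF assms(2)] by metis
  \<comment> \<open>The Gram vector \<open>g l\<close> of \<Gamma>, contracted with
    \<open>f k\<close> on the second factor.\<close>
  define h where "h = (\<lambda>(k, l) p. \<Sum>j<a. cnj (f k j) * g l (p * a + j))"
  show ?thesis
  proof (rule psdI_decomp[where I = "{..<a} \<times> {..<n * a}" and f = h])
    fix p q assume pq: "p < n" "q < n"
    have "partial_measure n a F \<Gamma> $$ (p, q) = (\<Sum>i<a. \<Sum>j<a. F $$ (i, j) * \<Gamma> $$ (p * a + j, q * a + i))"
      using pq by (simp add: partial_measure_def mat_trace_mult[OF psdD(1)[OF assms(1)]] block_index)
    also have "\<dots> = (\<Sum>i<a. \<Sum>j<a. \<Sum>(k, l)\<in>{..<a} \<times> {..<n * a}.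
        (cnj (f k j) * g l (p * a + j)) * cnj (cnj (f k i) * g l (q * a + i)))"
    proof (intro sum.cong[OF refl])
      fix i j assume "i \<in> {..<a}" "j \<in> {..<a}"
      then have ij: "i < a" "j < a" by auto
      show "F $$ (i, j) * \<Gamma> $$ (p * a + j, q * a + i) = (\<Sum>(k, l)\<in>{..<a} \<times> {..<n * a}.
          (cnj (f k j) * g l (p * a + j)) * cnj (cnj (f k i) * g l (q * a + i)))"
        unfolding f[OF ij] g[OF block_index_less[OF pq(1) ij(2)] block_index_less[OF pq(2) ij(1)]]
          sum_product sum.cartesian_product
        by (intro sum.cong refl) (auto simp: algebra_simps)
    qed
    also have "\<dots> = (\<Sum>(k, l)\<in>{..<a} \<times> {..<n * a}. \<Sum>i<a. \<Sum>j<a.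
        (cnj (f k j) * g l (p * a + j)) * cnj (cnj (f k i) * g l (q * a + i)))"
      unfolding case_prod_unfold by (rule sum_swap3)
    also have "\<dots> = (\<Sum>kl\<in>{..<a} \<times> {..<n * a}. h kl p * cnj (h kl q))"
      unfolding h_def case_prod_unfold cnj_sum sum_product by (intro sum.cong[OF refl] sum.swap)
    finally show "partial_measure n a F \<Gamma> $$ (p, q) = (\<Sum>kl\<in>{..<a} \<times> {..<n * a}. h kl p * cnj (h kl q))" .
  qed (simp add: partial_measure_def)
qed

text \<open>The Holevo form with unnormalised \<open>R k\<close> and arbitrary dimensions, which
  makes it stable under composition with positive maps.\<close>

definition measure_prepare ::
  "nat \<Rightarrow> nat \<Rightarrow> nat \<Rightarrow> (nat \<Rightarrow> complex mat) \<Rightarrow> (nat \<Rightarrow> complex mat) \<Rightarrow> (complex mat \<Rightarrow> complex mat) \<Rightarrow> bool" where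
  "measure_prepare a m K F R \<Psi> \<longleftrightarrow> (\<forall>k<K. psd a (F k) \<and> psd m (R k)) \<and>
     (\<forall>\<rho>\<in>carrier_mat a a. \<Psi> \<rho> = mat_sum m (\<lambda>k. mat_trace (F k * \<rho>) \<cdot>\<^sub>m R k) {..<K})"

lemma holevo_rep_measure_prepare: "holevo_rep d K R F \<Phi> \<Longrightarrow> measure_prepare d d K F R \<Phi>"
  by (auto simp: holevo_rep_def measure_prepare_def density_matrix_def)

text \<open>Each outcome leaves a conditional state of the first factor next to the prepared
  \<open>R k\<close>. Separability of the output and complete positivity are read off from this
  form.\<close>

lemma id_tensor_measure_prepare:
  assumes "measure_prepare a m K F R \<Psi>"
  shows "id_tensor n a m \<Psi> \<Gamma> =
    mat_sum (n * m) (\<lambda>k. tensor_mat (partial_measure n a (F k) \<Gamma>) (R k)) {..<K}"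
proof (rule tensor_index_eqI[of _ n m])
  fix p q i j assume pq: "p < n" "q < n" "i < m" "j < m"
  have R: "R k \<in> carrier_mat m m" if "k < K" for k
    using assms that by (auto simp: measure_prepare_def psd_def)
  have "id_tensor n a m \<Psi> \<Gamma> $$ (p * m + i, q * m + j) = \<Psi> (block a \<Gamma> p q) $$ (i, j)"
    using pq by (rule id_tensor_index)
  also have "\<dots> = mat_sum m (\<lambda>k. mat_trace (F k * block a \<Gamma> p q) \<cdot>\<^sub>m R k) {..<K} $$ (i, j)"
    using assms by (simp add: measure_prepare_def)
  also have "\<dots> = (\<Sum>k<K. mat_trace (F k * block a \<Gamma> p q) * R k $$ (i, j))"
    using pq smult_mat_index[OF R] by (auto intro!: sum.cong)
  also have "\<dots> = mat_sum (n * m) (\<lambda>k. tensor_mat (partial_measure n a (F k) \<Gamma>) (R k)) {..<K} $$ (p * m + i, q * m + j)"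
  proof -
    have "tensor_mat (partial_measure n a (F k) \<Gamma>) (R k) $$ (p * m + i, q * m + j) =
        mat_trace (F k * block a \<Gamma> p q) * R k $$ (i, j)" if "k < K" for k
      using pq tensor_mat_index[OF _ R[OF that] pq, of "partial_measure n a (F k) \<Gamma>"]
      by (simp add: partial_measure_def)
    then show ?thesis using pq by (simp add: block_index_less)
  qed
  finally show "id_tensor n a m \<Psi> \<Gamma> $$ (p * m + i, q * m + j) =
    mat_sum (n * m) (\<lambda>k. tensor_mat (partial_measure n a (F k) \<Gamma>) (R k)) {..<K} $$ (p * m + i, q * m + j)" .
qed (auto simp: id_tensor_def)

lemma separable_measure_prepare:
  assumes "measure_prepare a m K F R \<Psi>" "psd (n * a) \<Gamma>"
  shows "separable n m (id_tensor n a m \<Psi> \<Gamma>)"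
proof -
  have P: "\<forall>k<K. psd n (partial_measure n a (F k) \<Gamma>) \<and> psd m (R k)"
    using assms by (auto simp: measure_prepare_def intro: psd_partial_measure)
  then have "psd (n * m) (id_tensor n a m \<Psi> \<Gamma>)"
    unfolding id_tensor_measure_prepare[OF assms(1)] by (intro psd_mat_sum psd_tensor_mat) auto
  with P show ?thesis
    unfolding separable_def
    by (intro conjI exI[of _ K] exI[of _ "\<lambda>k. partial_measure n a (F k) \<Gamma>"] exI[of _ R])
      (simp_all add: id_tensor_measure_prepare[OF assms(1)])
qed

lemma completely_positive_measure_prepare:
  assumes "lin_map a m \<Psi>" "measure_prepare a m K F R \<Psi>"
  shows "completely_positive a m \<Psi>"
  using assms separable_measure_prepare[OF assms(2)]
  by (auto simp: completely_positive_def positivity_preserving_def separable_def id_tensor_linear)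

section \<open>Composition with positive maps and normalisation\<close>

lemma lin_map_comp:
  assumes "lin_map a b \<Phi>" "lin_map b c \<Upsilon>"
  shows "lin_map a c (\<Upsilon> \<circ> \<Phi>)"
  using lin_mapD[OF assms(1)] lin_mapD[OF assms(2)] by (auto simp: lin_map_def)

lemma measure_prepare_post:
  assumes "measure_prepare a b K F R \<Phi>" "positivity_preserving b c \<Upsilon>"
  shows "measure_prepare a c K F (\<lambda>k. \<Upsilon> (R k)) (\<Upsilon> \<circ> \<Phi>)"
proof -
  have lin: "lin_map b c \<Upsilon>" using assms(2) by (simp add: positivity_preserving_def)
  have R: "R k \<in> carrier_mat b b" if "k \<in> {..<K}" for k
    using assms(1) that by (auto simp: measure_prepare_def psd_def)
  show ?thesis
    using assms lin_map_sum[OF lin, of "{..<K}" R] R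
    by (auto simp: measure_prepare_def positivity_preserving_def)
qed

lemma mat_trace_mult_lin_map:
  assumes "lin_map a b \<Upsilon>" "X \<in> carrier_mat a a" "F \<in> carrier_mat b b"
  shows "mat_trace (F * \<Upsilon> X) = (\<Sum>i<a. \<Sum>j<a. X $$ (i, j) * mat_trace (F * \<Upsilon> (mat_unit a i j)))"
proof -
  note c = lin_mapD(1)[OF assms(1)]
  have "mat_trace (F * \<Upsilon> X) = (\<Sum>r<b. \<Sum>s<b. \<Sum>i<a. \<Sum>j<a. X $$ (i, j) * (F $$ (r, s) * \<Upsilon> (mat_unit a i j) $$ (s, r)))"
    unfolding mat_trace_mult[OF assms(3) c[OF assms(2)]]
    by (intro sum.cong refl, subst lin_map_mat_unit_expand[OF assms(1,2)])
      (auto simp: sum_distrib_left mult_ac)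
  also have "\<dots> = (\<Sum>r<b. \<Sum>i<a. \<Sum>j<a. \<Sum>s<b. X $$ (i, j) * (F $$ (r, s) * \<Upsilon> (mat_unit a i j) $$ (s, r)))"
    by (rule sum.cong[OF refl]) (rule sum_swap3[symmetric])
  also have "\<dots> = (\<Sum>i<a. \<Sum>j<a. \<Sum>r<b. \<Sum>s<b. X $$ (i, j) * (F $$ (r, s) * \<Upsilon> (mat_unit a i j) $$ (s, r)))"
    by (rule sum_swap3[symmetric])
  also have "\<dots> = (\<Sum>i<a. \<Sum>j<a. X $$ (i, j) * mat_trace (F * \<Upsilon> (mat_unit a i j)))"
    by (simp add: mat_trace_mult[OF assms(3) c] sum_distrib_left)
  finally show ?thesis .
qed

text \<open>The new effects are the images of \<open>F k\<close> under the adjoint of \<Upsilon> for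
  the trace pairing, which explains the index swap. Their form at \<open>x\<close> is the trace of
  \<open>F k\<close> against the image of |x><x|, hence nonnegative.\<close>

lemma measure_prepare_pre:
  assumes "measure_prepare b c K F R \<Phi>" "positivity_preserving a b \<Upsilon>"
  shows "measure_prepare a c K (\<lambda>k. mat a a (\<lambda>(j, i). mat_trace (F k * \<Upsilon> (mat_unit a i j)))) R (\<Phi> \<circ> \<Upsilon>)"
    (is "measure_prepare a c K ?F R _")
proof -
  have lin: "lin_map a b \<Upsilon>" using assms(2) by (simp add: positivity_preserving_def)
  have F: "psd b (F k)" if "k < K" for k
    using assms(1) that by (auto simp: measure_prepare_def)
  have tr: "mat_trace (?F k * X) = mat_trace (F k * \<Upsilon> X)" if "X \<in> carrier_mat a a" "k < K" for X k
  proof -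
    have "mat_trace (?F k * X) = (\<Sum>j<a. \<Sum>i<a. X $$ (i, j) * mat_trace (F k * \<Upsilon> (mat_unit a i j)))"
      using that by (subst mat_trace_mult[of _ a]) (auto simp: mult.commute)
    also have "\<dots> = mat_trace (F k * \<Upsilon> X)"
      unfolding mat_trace_mult_lin_map[OF lin that(1) psdD(1)[OF F[OF that(2)]]] by (rule sum.swap)
    finally show ?thesis .
  qed
  have "psd a (?F k)" if k: "k < K" for k
    unfolding psd_iff
  proof (intro conjI allI)
    fix x :: "nat \<Rightarrow> complex"
    define X where "X = mat a a (\<lambda>(i, j). x i * cnj (x j))"
    have X: "X \<in> carrier_mat a a" by (simp add: X_def)
    have "qf a (\<lambda>i j. ?F k $$ (i, j)) x = mat_trace (?F k * X)"
      by (subst mat_trace_mult[of _ a]) (auto simp: X_def qf_def algebra_simps intro!: sum.cong)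
    also have "\<dots> = mat_trace (F k * \<Upsilon> X)" by (rule tr[OF X k])
    also have "0 \<le> \<dots>"
    proof (rule mat_trace_psd_mult_nonneg[OF F[OF k]])
      have "psd a X"
        by (rule psdI_decomp[where I = "{0 :: nat}" and f = "\<lambda>_. x"]) (auto simp: X_def)
      then show "psd b (\<Upsilon> X)" using assms(2) by (simp add: positivity_preserving_def)
    qed
    finally show "0 \<le> qf a (\<lambda>i j. ?F k $$ (i, j)) x" .
  qed simp
  moreover have "(\<Phi> \<circ> \<Upsilon>) \<rho> = mat_sum c (\<lambda>k. mat_trace (?F k * \<rho>) \<cdot>\<^sub>m R k) {..<K}"
    if "\<rho> \<in> carrier_mat a a" for \<rho>
  proof -
    have "(\<Phi> \<circ> \<Upsilon>) \<rho> = mat_sum c (\<lambda>k. mat_trace (F k * \<Upsilon> \<rho>) \<cdot>\<^sub>m R k) {..<K}"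
      using assms(1) lin_mapD(1)[OF lin that] by (simp add: measure_prepare_def)
    also have "\<dots> = mat_sum c (\<lambda>k. mat_trace (?F k * \<rho>) \<cdot>\<^sub>m R k) {..<K}"
      unfolding mat_sum_def by (intro cong_mat refl sum.cong) (simp add: tr[OF that])
    finally show ?thesis .
  qed
  ultimately show ?thesis using assms(1) by (auto simp: measure_prepare_def)
qed

lemma measure_prepare_normalize:
  assumes "measure_prepare d d K F R \<Phi>" "d \<ge> 1"
  shows "\<exists>R' F'. holevo_rep d K R' F' \<Phi>"
proof -
  define t where "t k = mat_trace (R k)" for k
  \<comment> \<open>If the trace is zero, then \<open>R k\<close> vanishes and so does the rescaled
    effect; any density matrix can stand in, and \<open>d \<ge> 1\<close> provides this one.\<close>
  define R' where "R' k = (if t k = 0 then mat_unit d 0 0 else (1 / t k) \<cdot>\<^sub>m R k)" for k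
  define F' where "F' k = t k \<cdot>\<^sub>m F k" for k
  have psd: "psd d (F k)" "psd d (R k)" if "k < K" for k
    using assms(1) that by (auto simp: measure_prepare_def)
  have t: "0 \<le> t k" if "k < K" for k
    unfolding t_def by (rule mat_trace_psd_nonneg[OF psd(2)[OF that]])
  have unit: "density_matrix d (mat_unit d 0 0)"
  proof -
    have "psd d (mat_unit d 0 0)"
      by (rule psdI_decomp[where I = "{0 :: nat}" and f = "\<lambda>_ i. if i = 0 then 1 else 0"])
        (auto simp: mat_unit_def)
    moreover have "mat_trace (mat_unit d 0 0) = 1"
      unfolding mat_trace_eq[OF mat_unit_carrier] using assms(2)
      by (subst sum_single[of 0]) (auto simp: mat_unit_def)
    ultimately show ?thesis by (simp add: density_matrix_def)
  qed
  have "density_matrix d (R' k)" if k: "k < K" for k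
  proof (cases "t k = 0")
    case False
    have c: "R k \<in> carrier_mat d d" by (rule psdD(1)[OF psd(2)[OF k]])
    have "0 \<le> 1 / t k" using t[OF k] by (auto simp: less_eq_complex_def Re_divide Im_divide)
    then have "psd d ((1 / t k) \<cdot>\<^sub>m R k)" by (rule psd_smult[OF psd(2)[OF k]])
    moreover have "mat_trace ((1 / t k) \<cdot>\<^sub>m R k) = 1"
      using c False unfolding t_def by (simp add: mat_trace_eq[of _ d] flip: sum_divide_distrib)
    ultimately show ?thesis using False by (simp add: density_matrix_def R'_def)
  qed (simp add: R'_def unit)
  moreover have "psd d (F' k)" if "k < K" for k
    unfolding F'_def by (intro psd_smult psd t that)
  moreover have "\<Phi> \<rho> = mat_sum d (\<lambda>k. mat_trace (F' k * \<rho>) \<cdot>\<^sub>m R' k) {..<K}"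
    if \<rho>: "\<rho> \<in> carrier_mat d d" for \<rho>
  proof -
    have "(mat_trace (F k * \<rho>) \<cdot>\<^sub>m R k) $$ (i, j) = (mat_trace (F' k * \<rho>) \<cdot>\<^sub>m R' k) $$ (i, j)"
      if "k < K" "i < d" "j < d" for k i j
    proof -
      have c: "R k \<in> carrier_mat d d" "F k \<in> carrier_mat d d" using psd[OF that(1)] psdD(1) by auto
      have tr: "mat_trace (F' k * \<rho>) = t k * mat_trace (F k * \<rho>)"
        using c \<rho> by (simp add: F'_def mat_trace_mult[of _ d] sum_distrib_left algebra_simps)
      show ?thesis
        using tr c that psd_trace_zero[OF psd(2)[OF that(1)] _ that(2,3)]
          smult_mat_index[OF mat_unit_carrier that(2,3)]
        by (auto simp: R'_def t_def)
    qed
    then have "mat_sum d (\<lambda>k. mat_trace (F k * \<rho>) \<cdot>\<^sub>m R k) {..<K} =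
        mat_sum d (\<lambda>k. mat_trace (F' k * \<rho>) \<cdot>\<^sub>m R' k) {..<K}"
      by (intro eq_matI) (auto simp: mat_sum_def intro!: sum.cong simp del: index_smult_mat)
    then show ?thesis using assms(1) \<rho> by (simp add: measure_prepare_def)
  qed
  ultimately show ?thesis by (auto simp: holevo_rep_def)
qed

section \<open>Rank-one Kraus operators\<close>

text \<open>When F_k and R_k are split into matrices |f><f| and |r><r|, the term Tr(F_k \<rho>) R_k
  becomes a sum of |r><f| \<rho> |f><r|.\<close>

lemma rank_one_kraus_of_measure_prepare:
  assumes "measure_prepare d d K F R \<Phi>"
  shows "\<exists>K A. rank_one_kraus_rep d K A \<Phi>"
proof -
  have psd: "psd d (F k)" "psd d (R k)" if "k < K" for k
    using assms that by (auto simp: measure_prepare_def)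
  have "\<exists>f. k < K \<longrightarrow> (\<forall>i<d. \<forall>j<d. F k $$ (i, j) = (\<Sum>l<d. f l i * cnj (f l j)))" for k
    using qf_nonneg_decomp[of d "\<lambda>i j. F k $$ (i, j)"] psdD(2)[OF psd(1)] by (cases "k < K") auto
  then obtain f where f: "\<And>k i j. k < K \<Longrightarrow> i < d \<Longrightarrow> j < d \<Longrightarrow> F k $$ (i, j) = (\<Sum>l<d. f k l i * cnj (f k l j))"
    by metis
  have "\<exists>r. k < K \<longrightarrow> (\<forall>i<d. \<forall>j<d. R k $$ (i, j) = (\<Sum>m<d. r m i * cnj (r m j)))" for k
    using qf_nonneg_decomp[of d "\<lambda>i j. R k $$ (i, j)"] psdD(2)[OF psd(2)] by (cases "k < K") auto
  then obtain r where r: "\<And>k i j. k < K \<Longrightarrow> i < d \<Longrightarrow> j < d \<Longrightarrow> R k $$ (i, j) = (\<Sum>m<d. r k m i * cnj (r k m j))"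
    by metis
  define B where "B = (\<lambda>(k, l, m). mat d d (\<lambda>(i, j). r k m i * cnj (f k l j)))"
  define J where "J = {..<K} \<times> {..<d} \<times> {..<d}"
  \<comment> \<open>Zero operators contribute nothing but have rank zero, so they are dropped before
    renumbering.\<close>
  define I where "I = {x \<in> J. B x \<noteq> 0\<^sub>m d d}"
  have B: "B x \<in> carrier_mat d d" for x by (simp add: B_def case_prod_unfold)
  have fin: "finite J" "finite I" by (auto simp: J_def I_def)
  have rep: "\<Phi> \<rho> $$ (i, j) = (\<Sum>x\<in>I. (B x * \<rho> * mat_adjoint (B x)) $$ (i, j))"
    if \<rho>: "\<rho> \<in> carrier_mat d d" and ij: "i < d" "j < d" for \<rho> i j
  proof -
    have tr: "mat_trace (F k * \<rho>) = (\<Sum>l<d. \<Sum>a<d. \<Sum>c<d. cnj (f k l a) * \<rho> $$ (a, c) * f k l c)"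
      if k: "k < K" for k
    proof -
      have "mat_trace (F k * \<rho>) = (\<Sum>c<d. \<Sum>a<d. \<Sum>l<d. cnj (f k l a) * \<rho> $$ (a, c) * f k l c)"
        unfolding mat_trace_mult[OF psdD(1)[OF psd(1)[OF k]] \<rho>]
        by (intro sum.cong refl) (simp add: f[OF k] sum_distrib_left mult_ac)
      also have "\<dots> = (\<Sum>l<d. \<Sum>c<d. \<Sum>a<d. cnj (f k l a) * \<rho> $$ (a, c) * f k l c)"
        by (rule sum_swap3)
      also have "\<dots> = (\<Sum>l<d. \<Sum>a<d. \<Sum>c<d. cnj (f k l a) * \<rho> $$ (a, c) * f k l c)"
        by (rule sum.cong[OF refl]) (rule sum.swap)
      finally show ?thesis .
    qed
    have entry: "(B (k, l, m) * \<rho> * mat_adjoint (B (k, l, m))) $$ (i, j) =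
        (\<Sum>a<d. \<Sum>c<d. cnj (f k l a) * \<rho> $$ (a, c) * f k l c) * (r k m i * cnj (r k m j))" for k l m
      unfolding sandwich_index[OF B \<rho> ij] sum_distrib_right
      using ij by (intro sum.cong refl) (simp add: B_def mult_ac)
    have "\<Phi> \<rho> $$ (i, j) = (\<Sum>k<K. mat_trace (F k * \<rho>) * R k $$ (i, j))"
      using assms \<rho> ij smult_mat_index[OF psdD(1)[OF psd(2)] ij]
      by (simp add: measure_prepare_def)
    also have "\<dots> = (\<Sum>k<K. \<Sum>l<d. \<Sum>m<d. (B (k, l, m) * \<rho> * mat_adjoint (B (k, l, m))) $$ (i, j))"
      unfolding entry using ij by (intro sum.cong refl) (simp add: tr r sum_product)
    also have "\<dots> = (\<Sum>x\<in>J. (B x * \<rho> * mat_adjoint (B x)) $$ (i, j))"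
      by (simp add: J_def sum.cartesian_product case_prod_unfold)
    also have "\<dots> = (\<Sum>x\<in>I. (B x * \<rho> * mat_adjoint (B x)) $$ (i, j))"
    proof (rule sum.mono_neutral_right[OF fin(1)])
      show "\<forall>x\<in>J - I. (B x * \<rho> * mat_adjoint (B x)) $$ (i, j) = 0"
      proof
        fix x assume "x \<in> J - I"
        then have "B x = 0\<^sub>m d d" by (simp add: I_def)
        then show "(B x * \<rho> * mat_adjoint (B x)) $$ (i, j) = 0"
          unfolding sandwich_index[OF B \<rho> ij] using ij by simp
      qed
    qed (auto simp: I_def)
    finally show ?thesis .
  qed
  obtain h where h: "bij_betw h {..<card I} I"
    using ex_bij_betw_nat_finite[OF fin(2)] by (auto simp: atLeast0LessThan)
  have "rank_one_kraus_rep d (card I) (B \<circ> h) \<Phi>"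
    unfolding rank_one_kraus_rep_def
  proof (intro conjI allI impI ballI)
    fix x assume "x < card I"
    then have "h x \<in> I" using h by (auto simp: bij_betw_def)
    then have nz: "B (h x) \<noteq> 0\<^sub>m d d" by (simp add: I_def)
    obtain k l m where "h x = (k, l, m)" by (cases "h x") auto
    then have "B (h x) $$ (i, j) = r k m i * cnj (f k l j)" if "i < d" "j < d" for i j
      using that by (simp add: B_def)
    then show "vec_space.rank d ((B \<circ> h) x) = 1"
      using vec_space.rank_product_eq_one[OF B _ nz] by simp
  next
    fix \<rho> :: "complex mat" assume \<rho>: "\<rho> \<in> carrier_mat d d"
    have "\<Phi> \<rho> \<in> carrier_mat d d"
      using assms \<rho> by (simp add: measure_prepare_def)
    moreover have "\<Phi> \<rho> $$ (i, j) = (\<Sum>k<card I. (B (h k) * \<rho> * mat_adjoint (B (h k))) $$ (i, j))"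
      if "i < d" "j < d" for i j
      unfolding rep[OF \<rho> that] by (rule sum.reindex_bij_betw[OF h, symmetric])
    ultimately show "\<Phi> \<rho> = mat_sum d (\<lambda>k. (B \<circ> h) k * \<rho> * mat_adjoint ((B \<circ> h) k)) {..<card I}"
      by (intro eq_matI) (auto simp del: index_mult_mat)
  qed (simp add: B)
  then show ?thesis by blast
qed

text \<open>For A = f g^T, the matrix A \<rho> A^dagger is |f><f| times Tr(F \<rho>) with F =
  conj(g) g^T.\<close>

lemma measure_prepare_of_rank_one_kraus:
  assumes "rank_one_kraus_rep d K A \<Phi>"
  shows "\<exists>F R. measure_prepare d d K F R \<Phi>"
proof -
  have A: "A k \<in> carrier_mat d d" "vec_space.rank d (A k) = 1" if "k < K" for k
    using assms that by (auto simp: rank_one_kraus_rep_def)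
  have "\<exists>f g. k < K \<longrightarrow> (\<forall>i<d. \<forall>j<d. A k $$ (i, j) = f i * g j)" for k
    using vec_space.rank_one_product[OF A] by blast
  then obtain f g where fg: "\<And>k i j. k < K \<Longrightarrow> i < d \<Longrightarrow> j < d \<Longrightarrow> A k $$ (i, j) = f k i * g k j"
    by metis
  define F where "F k = mat d d (\<lambda>(i, j). cnj (g k i) * g k j)" for k
  define R where "R k = mat d d (\<lambda>(i, j). f k i * cnj (f k j))" for k
  have "psd d (F k)" for k
    by (rule psdI_decomp[where I = "{0 :: nat}" and f = "\<lambda>_ i. cnj (g k i)"]) (auto simp: F_def)
  moreover have "psd d (R k)" for k
    by (rule psdI_decomp[where I = "{0 :: nat}" and f = "\<lambda>_. f k"]) (auto simp: R_def)
  moreover have "\<Phi> \<rho> = mat_sum d (\<lambda>k. mat_trace (F k * \<rho>) \<cdot>\<^sub>m R k) {..<K}"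
    if \<rho>: "\<rho> \<in> carrier_mat d d" for \<rho>
  proof -
    have "(A k * \<rho> * mat_adjoint (A k)) $$ (i, j) = (mat_trace (F k * \<rho>) \<cdot>\<^sub>m R k) $$ (i, j)"
      if k: "k < K" and ij: "i < d" "j < d" for k i j
    proof -
      have c: "F k \<in> carrier_mat d d" "R k \<in> carrier_mat d d" by (simp_all add: F_def R_def)
      have "(A k * \<rho> * mat_adjoint (A k)) $$ (i, j) =
          (\<Sum>a<d. \<Sum>c<d. (cnj (g k c) * g k a * \<rho> $$ (a, c)) * (f k i * cnj (f k j)))"
        unfolding sandwich_index[OF A(1)[OF k] \<rho> ij]
        using ij by (intro sum.cong refl) (simp add: fg[OF k] mult_ac)
      also have "\<dots> = (\<Sum>a<d. \<Sum>c<d. cnj (g k c) * g k a * \<rho> $$ (a, c)) * (f k i * cnj (f k j))"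
        unfolding sum_distrib_right ..
      also have "(\<Sum>a<d. \<Sum>c<d. cnj (g k c) * g k a * \<rho> $$ (a, c)) = mat_trace (F k * \<rho>)"
        unfolding mat_trace_mult[OF c(1) \<rho>] by (subst sum.swap) (simp add: F_def)
      finally show ?thesis using ij by (simp add: smult_mat_index[OF c(2)] R_def)
    qed
    then have "mat_sum d (\<lambda>k. A k * \<rho> * mat_adjoint (A k)) {..<K} = mat_sum d (\<lambda>k. mat_trace (F k * \<rho>) \<cdot>\<^sub>m R k) {..<K}"
      by (intro eq_matI) (auto intro!: sum.cong simp del: index_mult_mat index_smult_mat)
    then show ?thesis using assms \<rho> by (simp add: rank_one_kraus_rep_def)
  qed
  ultimately show ?thesis
    by (intro exI[of _ F] exI[of _ R]) (auto simp: measure_prepare_def)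
qed

section \<open>Trace preservation\<close>

lemma sum_mat_unit:
  assumes "i < n" "j < n"
  shows "(\<Sum>a<n. \<Sum>b<n. g a b * mat_unit n i j $$ (a, b)) = g i j"
proof -
  have "(\<Sum>a<n. \<Sum>b<n. g a b * mat_unit n i j $$ (a, b)) =
      (\<Sum>a<n. \<Sum>b<n. if a = i then (if b = j then g a b else 0) else 0)"
    by (intro sum.cong refl) (auto simp: mat_unit_def)
  also have "\<dots> = g i j" using assms by (subst sum_single[of i]) auto
  finally show ?thesis .
qed

lemma mat_trace_mat_unit: "i < n \<Longrightarrow> j < n \<Longrightarrow> mat_trace (mat_unit n i j) = (if i = j then 1 else 0)"
  unfolding mat_trace_eq[OF mat_unit_carrier]
  by (subst sum_single[of i]) (auto simp: mat_unit_def)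

lemma mat_trace_mult_mat_unit:
  assumes "F \<in> carrier_mat n n" "i < n" "j < n"
  shows "mat_trace (F * mat_unit n j i) = F $$ (i, j)"
  unfolding mat_trace_mult[OF assms(1) mat_unit_carrier]
  by (subst sum.swap) (rule sum_mat_unit[OF assms(3,2)])

text \<open>The trace of \<open>F k\<close> against the matrix unit E_ji is its entry (i, j), so
  trace preservation on matrix units fixes the sum of the effects. Any Holevo representation of such
  a map therefore already uses a POVM.\<close>

lemma holevo_rep_povm:
  assumes "holevo_rep d K R F \<Phi>" "trace_preserving d \<Phi>"
  shows "povm d K F"
proof -
  have R: "R k \<in> carrier_mat d d" "mat_trace (R k) = 1" and F: "psd d (F k)" if "k < K" for k
    using assms(1) that by (auto simp: holevo_rep_def density_matrix_def psd_def)
  have "mat_sum d F {..<K} = 1\<^sub>m d"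
  proof (rule eq_matI)
    fix i j assume "i < dim_row (1\<^sub>m d :: complex mat)" "j < dim_col (1\<^sub>m d :: complex mat)"
    then have ij: "i < d" "j < d" by auto
    have "(\<Sum>k<K. F k $$ (i, j)) = (\<Sum>k<K. F k $$ (i, j) * mat_trace (R k))"
      by (simp add: R)
    also have "\<dots> = (\<Sum>k<K. \<Sum>a<d. F k $$ (i, j) * R k $$ (a, a))"
      by (simp add: mat_trace_eq[OF R(1)] sum_distrib_left)
    also have "\<dots> = (\<Sum>a<d. \<Sum>k<K. F k $$ (i, j) * R k $$ (a, a))" by (rule sum.swap)
    also have "\<dots> = (\<Sum>a<d. \<Phi> (mat_unit d j i) $$ (a, a))"
      using assms(1) ij smult_mat_index[OF R(1)]
      by (simp add: holevo_rep_def mat_trace_mult_mat_unit[OF psdD(1)[OF F]])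
    also have "\<dots> = mat_trace (\<Phi> (mat_unit d j i))"
      using assms(1) by (subst mat_trace_eq[of _ d]) (auto simp: holevo_rep_def)
    also have "\<dots> = mat_trace (mat_unit d j i)"
      using assms(2) by (simp add: trace_preserving_def)
    finally show "mat_sum d F {..<K} $$ (i, j) = 1\<^sub>m d $$ (i, j)"
      using ij by (auto simp: mat_trace_mat_unit)
  qed auto
  then show ?thesis using F by (simp add: povm_def)
qed

text \<open>The trace of A E_ji A^dagger is the entry (i, j) of A^dagger A, so matrix units again
  suffice.\<close>

lemma kraus_rep_trace_preserving:
  assumes "rank_one_kraus_rep d K A \<Phi>" "trace_preserving d \<Phi>"
  shows "mat_sum d (\<lambda>k. mat_adjoint (A k) * A k) {..<K} = 1\<^sub>m d"
proof (rule eq_matI)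
  fix i j assume "i < dim_row (1\<^sub>m d :: complex mat)" "j < dim_col (1\<^sub>m d :: complex mat)"
  then have ij: "i < d" "j < d" by auto
  have A: "A k \<in> carrier_mat d d" if "k < K" for k
    using assms(1) that by (auto simp: rank_one_kraus_rep_def)
  have sandwich: "(A k * mat_unit d j i * mat_adjoint (A k)) $$ (c, c) = cnj (A k $$ (c, i)) * A k $$ (c, j)"
    if "k < K" "c < d" for k c
    unfolding sandwich_index[OF A[OF that(1)] mat_unit_carrier that(2,2)]
    using sum_mat_unit[OF ij(2,1), of "\<lambda>a b. cnj (A k $$ (c, b)) * A k $$ (c, a)"]
    by (simp add: mult_ac)
  have "mat_sum d (\<lambda>k. mat_adjoint (A k) * A k) {..<K} $$ (i, j) = (\<Sum>k<K. \<Sum>c<d. cnj (A k $$ (c, i)) * A k $$ (c, j))"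
    using ij by (auto simp: mult_mat_index[OF mat_adjoint_carrier[OF A] A] mat_adjoint_index[OF A]
        simp del: index_mult_mat intro!: sum.cong)
  also have "\<dots> = (\<Sum>c<d. \<Sum>k<K. cnj (A k $$ (c, i)) * A k $$ (c, j))" by (rule sum.swap)
  also have "\<dots> = (\<Sum>c<d. \<Phi> (mat_unit d j i) $$ (c, c))"
    using assms(1) by (simp add: rank_one_kraus_rep_def sandwich del: index_mult_mat)
  also have "\<dots> = mat_trace (\<Phi> (mat_unit d j i))"
    using assms(1) by (subst mat_trace_eq[of _ d]) (auto simp: rank_one_kraus_rep_def)
  also have "\<dots> = mat_trace (mat_unit d j i)"
    using assms(2) by (simp add: trace_preserving_def)
  finally show "mat_sum d (\<lambda>k. mat_adjoint (A k) * A k) {..<K} $$ (i, j) = 1\<^sub>m d $$ (i, j)"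
    using ij by (auto simp: mat_trace_mat_unit)
qed auto

section \<open>The maximally entangled state\<close>

text \<open>The coefficient matrix V = B B^T of the sum of b_j \<otimes> b_j, where B has columns
  b_j. For a complex basis it need not be the identity, but it is symmetric and unitary.\<close>

definition entangled_coeff :: "nat \<Rightarrow> (nat \<Rightarrow> complex vec) \<Rightarrow> nat \<Rightarrow> nat \<Rightarrow> complex" where
  "entangled_coeff d b p i = (\<Sum>j<d. b j $ p * b j $ i)"

lemma entangled_coeff_sym: "entangled_coeff d b p i = entangled_coeff d b i p"
  by (simp add: entangled_coeff_def mult.commute)

lemma orthonormal_basis_inner:
  assumes "orthonormal_basis d b" "i < d" "j < d"
  shows "(\<Sum>p<d. b i $ p * cnj (b j $ p)) = (if i = j then 1 else 0)"
proof -
  have "b i \<in> carrier_vec d" "b j \<in> carrier_vec d" and eq: "b i \<bullet>c b j = (if i = j then 1 else 0)"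
    using assms by (auto simp: orthonormal_basis_def)
  then have "b i \<bullet>c b j = (\<Sum>p<d. b i $ p * cnj (b j $ p))"
    unfolding scalar_prod_def by (intro sum.cong) auto
  with eq show ?thesis by simp
qed

text \<open>A left inverse of a square matrix is a right inverse, so orthonormal columns give
  orthonormal rows.\<close>

lemma orthonormal_basis_complete:
  assumes "orthonormal_basis d b" "p < d" "q < d"
  shows "(\<Sum>j<d. b j $ p * cnj (b j $ q)) = (if p = q then 1 else 0)"
proof -
  define U where "U = mat d d (\<lambda>(p, j). b j $ p)"
  define V where "V = mat d d (\<lambda>(j, p). cnj (b j $ p))"
  have c: "U \<in> carrier_mat d d" "V \<in> carrier_mat d d" by (simp_all add: U_def V_def)
  have "V * U = 1\<^sub>m d"
  proof (rule eq_matI)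
    fix i j assume "i < dim_row (1\<^sub>m d :: complex mat)" "j < dim_col (1\<^sub>m d :: complex mat)"
    then have ij: "i < d" "j < d" by auto
    show "(V * U) $$ (i, j) = 1\<^sub>m d $$ (i, j)"
      unfolding mult_mat_index[OF c(2,1) ij]
      using ij orthonormal_basis_inner[OF assms(1) ij(2,1)] by (simp add: U_def V_def mult.commute)
  qed (auto simp: U_def V_def)
  then have "U * V = 1\<^sub>m d" by (rule mat_mult_left_right_inverse[OF c(2,1)])
  then have "(U * V) $$ (p, q) = (if p = q then 1 else 0)" using assms by simp
  then show ?thesis
    unfolding mult_mat_index[OF c assms(2,3)] using assms(2,3) by (simp add: U_def V_def)
qed

lemma entangled_coeff_unitary:
  assumes "orthonormal_basis d b" "p < d" "q < d"
  shows "(\<Sum>i<d. entangled_coeff d b p i * cnj (entangled_coeff d b q i)) = (if p = q then 1 else 0)"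
proof -
  have "(\<Sum>i<d. entangled_coeff d b p i * cnj (entangled_coeff d b q i)) =
      (\<Sum>i<d. \<Sum>j<d. \<Sum>k<d. (b j $ p * cnj (b k $ q)) * (b j $ i * cnj (b k $ i)))"
    unfolding entangled_coeff_def cnj_sum sum_product by (intro sum.cong refl) (simp add: mult_ac)
  also have "\<dots> = (\<Sum>j<d. \<Sum>k<d. \<Sum>i<d. (b j $ p * cnj (b k $ q)) * (b j $ i * cnj (b k $ i)))"
    by (rule sum_swap3[symmetric])
  also have "\<dots> = (\<Sum>j<d. \<Sum>k<d. if j = k then b j $ p * cnj (b k $ q) else 0)"
    by (intro sum.cong refl) (simp add: orthonormal_basis_inner[OF assms(1)] flip: sum_distrib_left)
  also have "\<dots> = (\<Sum>j<d. b j $ p * cnj (b j $ q))" by simp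
  finally show ?thesis using orthonormal_basis_complete[OF assms] by simp
qed

lemma max_entangled_dim:
  assumes "orthonormal_basis d b"
  shows "dim_vec (max_entangled d b) = d * d"
proof -
  have "finsum_vec TYPE(complex) (d * d) (\<lambda>j. tensor_vec (b j) (b j)) {..<d} \<in> carrier_vec (d * d)"
    using assms by (intro finsum_vec_closed) (auto simp: tensor_vec_def orthonormal_basis_def)
  then show ?thesis by (simp add: max_entangled_def)
qed

lemma max_entangled_index:
  assumes "orthonormal_basis d b" "p < d" "i < d"
  shows "max_entangled d b $ (p * d + i) = complex_of_real (1 / sqrt (real d)) * entangled_coeff d b p i"
proof -
  have r: "p * d + i < d * d" by (rule block_index_less[OF assms(2,3)])
  have c: "b j \<in> carrier_vec d" if "j < d" for j using assms(1) that by (simp add: orthonormal_basis_def)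
  have "finsum_vec TYPE(complex) (d * d) (\<lambda>j. tensor_vec (b j) (b j)) {..<d} $ (p * d + i) =
      (\<Sum>j<d. tensor_vec (b j) (b j) $ (p * d + i))"
    using carrier_vecD[OF c] by (intro index_finsum_vec r) (auto simp: tensor_vec_def)
  also have "\<dots> = entangled_coeff d b p i"
    unfolding entangled_coeff_def
  proof (intro sum.cong refl)
    fix j assume "j \<in> {..<d}"
    then have "dim_vec (b j) = d" using c by auto
    then show "tensor_vec (b j) (b j) $ (p * d + i) = b j $ p * b j $ i"
      using r assms(3) by (simp add: tensor_vec_def)
  qed
  finally show ?thesis
    using max_entangled_dim[OF assms(1)] r by (simp add: max_entangled_def)
qed

lemma block_ketbra_max_entangled:
  assumes "orthonormal_basis d b" "p < d" "q < d"
  shows "block d (ketbra (max_entangled d b)) p q =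
    complex_of_real (1 / real d) \<cdot>\<^sub>m mat d d (\<lambda>(k, l). entangled_coeff d b p k * cnj (entangled_coeff d b q l))"
proof (rule eq_matI)
  fix k l
  assume "k < dim_row (complex_of_real (1 / real d) \<cdot>\<^sub>m mat d d (\<lambda>(k, l). entangled_coeff d b p k * cnj (entangled_coeff d b q l)))"
    and "l < dim_col (complex_of_real (1 / real d) \<cdot>\<^sub>m mat d d (\<lambda>(k, l). entangled_coeff d b p k * cnj (entangled_coeff d b q l)))"
  then have kl: "k < d" "l < d" by auto
  have sq: "complex_of_real (1 / real d) = complex_of_real (1 / sqrt (real d)) * complex_of_real (1 / sqrt (real d))"
    by (simp flip: of_real_mult)
  have "block d (ketbra (max_entangled d b)) p q $$ (k, l) =
      max_entangled d b $ (p * d + k) * cnj (max_entangled d b $ (q * d + l))"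
    using kl assms by (simp add: block_index ketbra_def max_entangled_dim block_index_less)
  also have "\<dots> = complex_of_real (1 / real d) * (entangled_coeff d b p k * cnj (entangled_coeff d b q l))"
    unfolding max_entangled_index[OF assms(1,2) kl(1)] max_entangled_index[OF assms(1,3) kl(2)] sq by simp
  finally show "block d (ketbra (max_entangled d b)) p q $$ (k, l) =
    (complex_of_real (1 / real d) \<cdot>\<^sub>m mat d d (\<lambda>(k, l). entangled_coeff d b p k * cnj (entangled_coeff d b q l))) $$ (k, l)"
    using kl by simp
qed (auto simp: block_def)

lemma density_matrix_max_entangled:
  assumes "orthonormal_basis d b" "d \<ge> 1"
  shows "density_matrix (d * d) (ketbra (max_entangled d b))"
proof -
  have c: "ketbra (max_entangled d b) \<in> carrier_mat (d * d) (d * d)"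
    by (simp add: ketbra_def max_entangled_dim[OF assms(1)])
  have "psd (d * d) (ketbra (max_entangled d b))"
    by (rule psdI_decomp[OF c, where I = "{0 :: nat}" and f = "\<lambda>_ r. max_entangled d b $ r"])
      (auto simp: ketbra_def max_entangled_dim[OF assms(1)])
  moreover have "mat_trace (ketbra (max_entangled d b)) = 1"
  proof -
    have "mat_trace (ketbra (max_entangled d b)) = (\<Sum>p<d. \<Sum>i<d. block d (ketbra (max_entangled d b)) p p $$ (i, i))"
      unfolding mat_trace_eq[OF c] sum_mult_split by (simp add: block_index)
    also have "\<dots> = (\<Sum>p<d. complex_of_real (1 / real d) * (\<Sum>i<d. entangled_coeff d b p i * cnj (entangled_coeff d b p i)))"
      by (intro sum.cong refl) (simp add: block_ketbra_max_entangled[OF assms(1)] sum_distrib_left)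
    also have "\<dots> = (\<Sum>p<d. complex_of_real (1 / real d))"
      by (intro sum.cong refl) (simp add: entangled_coeff_unitary[OF assms(1)])
    also have "\<dots> = 1" using assms(2) by simp
    finally show ?thesis .
  qed
  ultimately show ?thesis by (simp add: density_matrix_def)
qed

text \<open>The operators \<open>|v\<^sub>p\<rangle>\<langle>v\<^sub>q|\<close>, with \<open>v\<^sub>p\<close> the \<open>p\<close>-th row of the unitary \<open>entangled_coeff\<close>, are the
  blocks of the maximally entangled state (up to the factor \<open>d\<close>) and span the matrix algebra, so
  \<open>\<Phi>\<close> can be read off from its value on that state.\<close>
lemma id_tensor_max_entangled_index:
  assumes "orthonormal_basis d b" "lin_map d m \<Phi>" "p < d" "q < d" "i < m" "j < m"
  shows "id_tensor d d m \<Phi> (ketbra (max_entangled d b)) $$ (p * m + i, q * m + j) =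
    complex_of_real (1 / real d) * \<Phi> (mat d d (\<lambda>(k, l). entangled_coeff d b p k * cnj (entangled_coeff d b q l))) $$ (i, j)"
proof -
  define X where "X = mat d d (\<lambda>(k, l). entangled_coeff d b p k * cnj (entangled_coeff d b q l))"
  have X: "X \<in> carrier_mat d d" by (simp add: X_def)
  show ?thesis
    unfolding id_tensor_index[OF assms(3-6)] block_ketbra_max_entangled[OF assms(1,3,4)]
      X_def[symmetric] lin_mapD(3)[OF assms(2) X]
    by (rule smult_mat_index[OF lin_mapD(1)[OF assms(2) X] assms(5,6)])
qed

text \<open>Comparing blocks gives \<Phi>(|v_p><v_q|) as d times the sum of P_t(p,q) Q_t. Expanding
  \<rho> in these operators leaves coefficients of Q_t that are traces against positive
  matrices.\<close>

lemma measure_prepare_of_separable: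
  assumes "orthonormal_basis d b" "lin_map d d \<Phi>" "d \<ge> 1"
    and "separable d d (id_tensor d d d \<Phi> (ketbra (max_entangled d b)))"
  shows "\<exists>K F R. measure_prepare d d K F R \<Phi>"
proof -
  define V where "V = entangled_coeff d b"
  define W where "W = (\<lambda>(p, q). mat d d (\<lambda>(k, l). V p k * cnj (V q l)))"
  \<comment> \<open>Symmetry carries orthonormality of the rows over to the columns.\<close>
  have V: "(\<Sum>p<d. V p i * cnj (V p j)) = (if i = j then 1 else 0)" if "i < d" "j < d" for i j
    using entangled_coeff_unitary[OF assms(1) that] unfolding V_def
    by (subst (1 2) entangled_coeff_sym)
  obtain K :: nat and P Q where PQ': "\<forall>t<K. psd d (P t) \<and> psd d (Q t)"
    and eq: "id_tensor d d d \<Phi> (ketbra (max_entangled d b)) = mat_sum (d * d) (\<lambda>t. tensor_mat (P t) (Q t)) {..<K}"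
    using assms(4) unfolding separable_def by blast
  have PQ: "psd d (P t)" "psd d (Q t)" if "t < K" for t using PQ' that by auto
  have \<Phi>W: "\<Phi> (W (p, q)) $$ (i, j) = (\<Sum>t<K. of_nat d * P t $$ (p, q) * Q t $$ (i, j))"
    if pq: "p < d" "q < d" and ij: "i < d" "j < d" for p q i j
  proof -
    have "complex_of_real (1 / real d) * \<Phi> (W (p, q)) $$ (i, j) =
        mat_sum (d * d) (\<lambda>t. tensor_mat (P t) (Q t)) {..<K} $$ (p * d + i, q * d + j)"
      unfolding eq[symmetric] id_tensor_max_entangled_index[OF assms(1,2) pq ij] by (simp add: W_def V_def)
    also have "\<dots> = (\<Sum>t<K. P t $$ (p, q) * Q t $$ (i, j))"
      using block_index_less[OF pq(1) ij(1)] block_index_less[OF pq(2) ij(2)]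
        tensor_mat_index[OF psdD(1)[OF PQ(1)] psdD(1)[OF PQ(2)] pq ij] by simp
    finally have "\<Phi> (W (p, q)) $$ (i, j) = of_nat d * (\<Sum>t<K. P t $$ (p, q) * Q t $$ (i, j))"
      using assms(3) by (simp add: field_simps)
    then show ?thesis by (simp add: sum_distrib_left mult.assoc)
  qed
  \<comment> \<open>The coefficient of |v_p><v_q| in \<rho> is <v_p| \<rho> |v_q>.\<close>
  define x where "x \<rho> = (\<lambda>(p, q). \<Sum>k<d. \<Sum>l<d. cnj (V p k) * \<rho> $$ (k, l) * V q l)" for \<rho> :: "complex mat"
  have expand: "\<rho> $$ (i, j) = (\<Sum>s\<in>{..<d} \<times> {..<d}. x \<rho> s * W s $$ (i, j))"
    if "i < d" "j < d" for \<rho> i j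
  proof -
    have "(\<Sum>s\<in>{..<d} \<times> {..<d}. x \<rho> s * W s $$ (i, j)) =
        (\<Sum>p<d. \<Sum>q<d. x \<rho> (p, q) * W (p, q) $$ (i, j))"
      by (simp add: sum.cartesian_product case_prod_unfold)
    also have "\<dots> = (\<Sum>p<d. \<Sum>q<d. \<Sum>k<d. \<Sum>l<d. \<rho> $$ (k, l) * ((V p i * cnj (V p k)) * (V q l * cnj (V q j))))"
      unfolding x_def W_def prod.case sum_distrib_right
      using that by (intro sum.cong refl) (simp add: mult_ac)
    also have "\<dots> = (\<Sum>k<d. \<Sum>l<d. \<Sum>p<d. \<Sum>q<d. \<rho> $$ (k, l) * ((V p i * cnj (V p k)) * (V q l * cnj (V q j))))"
      by (subst sum_swap3, rule sum.cong[OF refl], rule sum_swap3)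
    also have "\<dots> = (\<Sum>k<d. \<Sum>l<d. \<rho> $$ (k, l) * ((\<Sum>p<d. V p i * cnj (V p k)) * (\<Sum>q<d. V q l * cnj (V q j))))"
      unfolding sum_product unfolding sum_distrib_left ..
    also have "\<dots> = (\<Sum>k<d. \<Sum>l<d. if k = i then (if l = j then \<rho> $$ (k, l) else 0) else 0)"
      using that by (intro sum.cong refl) (auto simp: V)
    also have "\<dots> = \<rho> $$ (i, j)"
      using that by (subst sum_single[of i]) auto
    finally show ?thesis by simp
  qed
  \<comment> \<open>This is d V^T P_t^T conj(V), chosen so that Tr(F_t \<rho>) is the sum over p, q
    of the coefficients \<open>x\<close> times d P_t(p,q).\<close>
  define F where "F t = mat d d (\<lambda>(j, i). of_nat d * (\<Sum>p<d. \<Sum>q<d. P t $$ (p, q) * cnj (V p i) * V q j))" for t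
  have F_carrier: "F t \<in> carrier_mat d d" for t by (simp add: F_def)
  have "psd d (F t)" if t: "t < K" for t
  proof -
    obtain f where f: "\<And>p q. p < d \<Longrightarrow> q < d \<Longrightarrow> P t $$ (p, q) = (\<Sum>k<d. f k p * cnj (f k q))"
      using psd_decomp[OF PQ(1)[OF t]] by metis
    define h where "h k j = complex_of_real (sqrt (real d)) * (\<Sum>q<d. cnj (f k q) * V q j)" for k j
    show ?thesis
    proof (rule psdI_decomp[OF F_carrier, where I = "{..<d}" and f = h])
      fix j i assume ji: "j < d" "i < d"
      have "(\<Sum>p<d. \<Sum>q<d. P t $$ (p, q) * cnj (V p i) * V q j) =
          (\<Sum>p<d. \<Sum>q<d. \<Sum>k<d. (cnj (f k q) * V q j) * cnj (cnj (f k p) * V p i))"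
        by (intro sum.cong refl) (simp add: f sum_distrib_left mult_ac)
      also have "\<dots> = (\<Sum>k<d. \<Sum>p<d. \<Sum>q<d. (cnj (f k q) * V q j) * cnj (cnj (f k p) * V p i))"
        by (rule sum_swap3)
      also have "\<dots> = (\<Sum>k<d. (\<Sum>q<d. cnj (f k q) * V q j) * cnj (\<Sum>p<d. cnj (f k p) * V p i))"
        unfolding cnj_sum sum_product by (rule sum.cong[OF refl]) (rule sum.swap)
      finally have "F t $$ (j, i) = of_nat d * (\<Sum>k<d. (\<Sum>q<d. cnj (f k q) * V q j) * cnj (\<Sum>p<d. cnj (f k p) * V p i))"
        using ji by (simp add: F_def)
      also have "\<dots> = (\<Sum>k<d. h k j * cnj (h k i))"
        unfolding h_def real_scaled_ketbra by (subst sum_distrib_left) simp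
      finally show "F t $$ (j, i) = (\<Sum>k<d. h k j * cnj (h k i))" .
    qed
  qed
  moreover have "\<Phi> \<rho> = mat_sum d (\<lambda>t. mat_trace (F t * \<rho>) \<cdot>\<^sub>m Q t) {..<K}" if \<rho>: "\<rho> \<in> carrier_mat d d" for \<rho>
  proof (rule eq_matI)
    fix i j assume "i < dim_row (mat_sum d (\<lambda>t. mat_trace (F t * \<rho>) \<cdot>\<^sub>m Q t) {..<K})"
      "j < dim_col (mat_sum d (\<lambda>t. mat_trace (F t * \<rho>) \<cdot>\<^sub>m Q t) {..<K})"
    then have ij: "i < d" "j < d" by auto
    have tr: "mat_trace (F t * \<rho>) = (\<Sum>p<d. \<Sum>q<d. x \<rho> (p, q) * (of_nat d * P t $$ (p, q)))" for t
    proof -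
      have "mat_trace (F t * \<rho>) = (\<Sum>l<d. \<Sum>k<d. \<Sum>p<d. \<Sum>q<d. cnj (V p k) * \<rho> $$ (k, l) * V q l * (of_nat d * P t $$ (p, q)))"
        unfolding mat_trace_mult[OF F_carrier \<rho>]
        by (intro sum.cong refl) (simp add: F_def sum_distrib_left sum_distrib_right mult_ac)
      also have "\<dots> = (\<Sum>p<d. \<Sum>q<d. \<Sum>l<d. \<Sum>k<d. cnj (V p k) * \<rho> $$ (k, l) * V q l * (of_nat d * P t $$ (p, q)))"
        by (subst sum_swap3, rule sum.cong[OF refl], rule sum_swap3)
      also have "\<dots> = (\<Sum>p<d. \<Sum>q<d. x \<rho> (p, q) * (of_nat d * P t $$ (p, q)))"
        unfolding x_def prod.case sum_distrib_right
        by (intro sum.cong[OF refl] sum.swap)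
      finally show ?thesis .
    qed
    have "\<Phi> \<rho> $$ (i, j) = (\<Sum>s\<in>{..<d} \<times> {..<d}. x \<rho> s * \<Phi> (W s) $$ (i, j))"
      by (rule lin_map_expand[OF assms(2) _ _ \<rho> expand ij]) (auto simp: W_def)
    also have "\<dots> = (\<Sum>p<d. \<Sum>q<d. x \<rho> (p, q) * \<Phi> (W (p, q)) $$ (i, j))"
      by (simp add: sum.cartesian_product case_prod_unfold)
    also have "\<dots> = (\<Sum>p<d. \<Sum>q<d. \<Sum>t<K. x \<rho> (p, q) * (of_nat d * P t $$ (p, q)) * Q t $$ (i, j))"
      using ij by (intro sum.cong refl) (simp add: \<Phi>W sum_distrib_left mult.assoc)
    also have "\<dots> = (\<Sum>t<K. \<Sum>p<d. \<Sum>q<d. x \<rho> (p, q) * (of_nat d * P t $$ (p, q)) * Q t $$ (i, j))"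
      by (rule sum_swap3)
    also have "\<dots> = (\<Sum>t<K. mat_trace (F t * \<rho>) * Q t $$ (i, j))"
      unfolding tr sum_distrib_right ..
    also have "\<dots> = mat_sum d (\<lambda>t. mat_trace (F t * \<rho>) \<cdot>\<^sub>m Q t) {..<K} $$ (i, j)"
      using ij smult_mat_index[OF psdD(1)[OF PQ(2)] ij] by simp
    finally show "\<Phi> \<rho> $$ (i, j) = mat_sum d (\<lambda>t. mat_trace (F t * \<rho>) \<cdot>\<^sub>m Q t) {..<K} $$ (i, j)" .
  qed (use lin_mapD(1)[OF assms(2) \<rho>] in auto)
  ultimately have "measure_prepare d d K F Q \<Phi>" using PQ by (auto simp: measure_prepare_def)
  then show ?thesis by blast
qed

section \<open>Duality for separable matrices\<close>

definition tensor_fun :: "nat \<Rightarrow> (nat \<Rightarrow> complex) \<Rightarrow> (nat \<Rightarrow> complex) \<Rightarrow> nat \<Rightarrow> complex" where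
  "tensor_fun m u v = (\<lambda>r. u (r div m) * v (r mod m))"

lemma tensor_fun_index: "i < m \<Longrightarrow> tensor_fun m u v (p * m + i) = u p * v i"
  by (simp add: tensor_fun_def)

lemma qf_mult_split:
  "qf (n * m) A x = (\<Sum>p<n. \<Sum>i<m. \<Sum>q<n. \<Sum>j<m. cnj (x (p * m + i)) * A (p * m + i) (q * m + j) * x (q * m + j))"
  by (simp add: qf_def sum_mult_split)

lemma qf_tensor_fun:
  "qf (n * m) A (tensor_fun m u v) =
    (\<Sum>p<n. \<Sum>i<m. \<Sum>q<n. \<Sum>j<m. cnj (u p) * cnj (v i) * A (p * m + i) (q * m + j) * (u q * v j))"
  unfolding qf_mult_split by (intro sum.cong refl) (simp add: tensor_fun_index)

lemma frob_mult_split: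
  "frob (n * m) A B = (\<Sum>p<n. \<Sum>q<n. \<Sum>i<m. \<Sum>j<m. cnj (A (p * m + i) (q * m + j)) * B (p * m + i) (q * m + j))"
  unfolding frob_def sum_mult_split by (intro sum.cong[OF refl] sum.swap)

lemma norm_tensor_fun:
  "(\<Sum>r<n * m. (cmod (tensor_fun m u v r))\<^sup>2) = (\<Sum>p<n. (cmod (u p))\<^sup>2) * (\<Sum>i<m. (cmod (v i))\<^sup>2)"
  unfolding sum_mult_split sum_product
  by (intro sum.cong refl) (simp add: tensor_fun_index norm_mult power_mult_distrib)

text \<open>The vector is the sum of e_p \<otimes> e_p; testing on it turns positivity into a
  Hilbert-Schmidt pairing. The case \<open>n < m\<close> occurs with an added output
  dimension.\<close>

lemma qf_diagonal_vector:
  assumes "n \<le> m"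
  shows "qf (n * m) A (\<lambda>r. if r mod m = r div m then 1 else 0) = (\<Sum>p<n. \<Sum>q<n. A (p * m + p) (q * m + q))"
proof -
  have "qf (n * m) A (\<lambda>r. if r mod m = r div m then 1 else 0) =
      (\<Sum>p<n. \<Sum>i<m. \<Sum>q<n. \<Sum>j<m. if i = p then (if j = q then A (p * m + i) (q * m + j) else 0) else 0)"
    unfolding qf_mult_split by (intro sum.cong refl) auto
  also have "\<dots> = (\<Sum>p<n. \<Sum>q<n. A (p * m + p) (q * m + q))"
  proof (rule sum.cong[OF refl])
    fix p assume "p \<in> {..<n}"
    then have "p < m" using assms by simp
    then have "(\<Sum>i<m. \<Sum>q<n. \<Sum>j<m. if i = p then (if j = q then A (p * m + i) (q * m + j) else 0) else 0) =
        (\<Sum>q<n. \<Sum>j<m. if j = q then A (p * m + p) (q * m + j) else 0)"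
      by (subst sum_single[of p]) auto
    also have "\<dots> = (\<Sum>q<n. A (p * m + p) (q * m + q))"
      using assms by (intro sum.cong refl) auto
    finally show "(\<Sum>i<m. \<Sum>q<n. \<Sum>j<m. if i = p then (if j = q then A (p * m + i) (q * m + j) else 0) else 0) =
        (\<Sum>q<n. A (p * m + p) (q * m + q))" .
  qed
  finally show ?thesis .
qed

text \<open>Vanishing of all these \<open>2 \<times> 2\<close> minors describes the product vectors by a closed condition.\<close>
definition product_vectors :: "nat \<Rightarrow> nat \<Rightarrow> (nat \<Rightarrow> complex) set" where
  "product_vectors n m = {z. \<forall>p<n. \<forall>q<n. \<forall>i<m. \<forall>j<m.
     z (p * m + i) * z (q * m + j) = z (p * m + j) * z (q * m + i)}"

lemma closed_product_vectors: "closed (product_vectors n m)"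
  unfolding product_vectors_def
  by (intro closed_Collect_all closed_Collect_imp closed_Collect_eq open_Collect_const continuous_intros
      continuous_on_product_coordinates)

text \<open>A nonzero entry serves as pivot: its column gives \<open>u\<close>, its row divided by
  the pivot gives \<open>v\<close>.\<close>

lemma product_vectors_factor:
  assumes "z \<in> product_vectors n m"
  shows "\<exists>u v. \<forall>p<n. \<forall>i<m. z (p * m + i) = u p * v i"
proof (cases "\<exists>p<n. \<exists>i<m. z (p * m + i) \<noteq> 0")
  case True
  then obtain p0 i0 where 0: "p0 < n" "i0 < m" "z (p0 * m + i0) \<noteq> 0" by blast
  have "z (p * m + i) = z (p * m + i0) * (z (p0 * m + i) / z (p0 * m + i0))" if "p < n" "i < m" for p i
  proof -
    have "z (p * m + i) * z (p0 * m + i0) = z (p * m + i0) * z (p0 * m + i)"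
      using assms 0(1,2) that by (simp add: product_vectors_def)
    then show ?thesis using 0(3) by (simp add: field_simps)
  qed
  then show ?thesis
    by (intro exI[of _ "\<lambda>p. z (p * m + i0)"] exI[of _ "\<lambda>i. z (p0 * m + i) / z (p0 * m + i0)"]) auto
next
  case False
  then show ?thesis by (intro exI[of _ "\<lambda>_. 0"]) auto
qed

text \<open>\<open>cone_duality\<close> for product vectors. The margin \<delta> is what later makes
  a trace functional invertible.\<close>

lemma separable_of_dual:
  assumes C: "psd (n * m) C"
    and dual: "\<And>W \<delta>. 0 < \<delta> \<Longrightarrow>
      (\<And>u v. complex_of_real (\<delta> * ((\<Sum>p<n. (cmod (u p))\<^sup>2) * (\<Sum>i<m. (cmod (v i))\<^sup>2))) \<le> qf (n * m) W (tensor_fun m u v))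
      \<Longrightarrow> 0 \<le> Re (frob (n * m) W (\<lambda>r s. C $$ (r, s)))"
  shows "separable n m C"
proof -
  obtain z where z: "\<And>k. z k \<in> product_vectors n m"
    and Cz: "\<And>r s. r < n * m \<Longrightarrow> s < n * m \<Longrightarrow> C $$ (r, s) = (\<Sum>k<(n * m) * (n * m). z k r * cnj (z k s))"
  proof (rule cone_duality[of "product_vectors n m" "n * m" "\<lambda>r s. C $$ (r, s)"])
    show "closed (product_vectors n m)" by (rule closed_product_vectors)
    show "(\<lambda>r. complex_of_real c * z r) \<in> product_vectors n m" if "z \<in> product_vectors n m" for z c
      using that by (simp add: product_vectors_def mult_ac)
    show "(\<lambda>r. if r < n * m then z r else 0) \<in> product_vectors n m" if "z \<in> product_vectors n m" for z
      using that by (simp add: product_vectors_def block_index_less)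
    show "(\<lambda>_. 0) \<in> product_vectors n m" by (simp add: product_vectors_def)
    show "C $$ (s, r) = cnj (C $$ (r, s))" if "r < n * m" "s < n * m" for r s
      using psd_hermitian[OF C that(2,1)] .
    show "0 \<le> Re (frob (n * m) W (\<lambda>r s. C $$ (r, s)))"
      if "0 < \<delta>" and W: "\<And>z. z \<in> product_vectors n m \<Longrightarrow> complex_of_real (\<delta> * (\<Sum>r<n * m. (cmod (z r))\<^sup>2)) \<le> qf (n * m) W z"
      for W \<delta>
    proof (rule dual[OF that(1)])
      fix u v
      have "tensor_fun m u v \<in> product_vectors n m"
        by (simp add: product_vectors_def tensor_fun_index)
      from W[OF this] show "complex_of_real (\<delta> * ((\<Sum>p<n. (cmod (u p))\<^sup>2) * (\<Sum>i<m. (cmod (v i))\<^sup>2))) \<le> qf (n * m) W (tensor_fun m u v)"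
        unfolding norm_tensor_fun .
    qed
  qed (rule that)
  obtain u v where uv: "\<And>k p i. p < n \<Longrightarrow> i < m \<Longrightarrow> z k (p * m + i) = u k p * v k i"
    using product_vectors_factor[OF z] by metis
  define P where "P k = mat n n (\<lambda>(p, q). u k p * cnj (u k q))" for k
  define Q where "Q k = mat m m (\<lambda>(i, j). v k i * cnj (v k j))" for k
  have c: "P k \<in> carrier_mat n n" "Q k \<in> carrier_mat m m" for k by (simp_all add: P_def Q_def)
  have "psd n (P k)" for k
    by (rule psdI_decomp[OF c(1), where I = "{0 :: nat}" and f = "\<lambda>_. u k"]) (auto simp: P_def)
  moreover have "psd m (Q k)" for k
    by (rule psdI_decomp[OF c(2), where I = "{0 :: nat}" and f = "\<lambda>_. v k"]) (auto simp: Q_def)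
  moreover have "C = mat_sum (n * m) (\<lambda>k. tensor_mat (P k) (Q k)) {..<(n * m) * (n * m)}"
  proof (rule tensor_index_eqI[of _ n m])
    fix p q i j assume pq: "p < n" "q < n" "i < m" "j < m"
    have "C $$ (p * m + i, q * m + j) = (\<Sum>k<(n * m) * (n * m). tensor_mat (P k) (Q k) $$ (p * m + i, q * m + j))"
      unfolding tensor_mat_index[OF c pq] Cz[OF block_index_less[OF pq(1,3)] block_index_less[OF pq(2,4)]]
        uv[OF pq(1,3)] uv[OF pq(2,4)]
      using pq by (intro sum.cong refl) (simp add: P_def Q_def mult_ac)
    then show "C $$ (p * m + i, q * m + j) =
        mat_sum (n * m) (\<lambda>k. tensor_mat (P k) (Q k)) {..<(n * m) * (n * m)} $$ (p * m + i, q * m + j)"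
      using pq by (simp add: block_index_less)
  qed (use psdD(1)[OF C] in auto)
  ultimately show ?thesis unfolding separable_def using C by blast
qed

section \<open>Maps given by coefficients\<close>

text \<open>The number \<open>w p q i j\<close> is entry (p, q) of the image of the matrix unit
  E_ij, so \<open>w\<close> is a Choi matrix with its indices separated.\<close>

definition coeff_map :: "nat \<Rightarrow> nat \<Rightarrow> (nat \<Rightarrow> nat \<Rightarrow> nat \<Rightarrow> nat \<Rightarrow> complex) \<Rightarrow> complex mat \<Rightarrow> complex mat" where
  "coeff_map a m w X = mat m m (\<lambda>(p, q). \<Sum>i<a. \<Sum>j<a. w p q i j * X $$ (i, j))"

lemma coeff_map_index:
  "p < m \<Longrightarrow> q < m \<Longrightarrow> coeff_map a m w X $$ (p, q) = (\<Sum>i<a. \<Sum>j<a. w p q i j * X $$ (i, j))"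
  by (simp add: coeff_map_def)

lemma lin_map_coeff_map: "lin_map a m (coeff_map a m w)"
  unfolding lin_map_def
  by (auto simp: coeff_map_def algebra_simps sum.distrib sum_distrib_left intro!: eq_matI)

text \<open>By the Gram factorisation it suffices to test inputs |v><v|.\<close>

lemma positivity_preserving_coeff_map:
  assumes "\<And>v x. 0 \<le> qf m (\<lambda>p q. \<Sum>i<a. \<Sum>j<a. w p q i j * (v i * cnj (v j))) x"
  shows "positivity_preserving a m (coeff_map a m w)"
  unfolding positivity_preserving_def
proof (intro conjI allI impI lin_map_coeff_map)
  fix X assume X: "psd a X"
  obtain f where f: "\<And>i j. i < a \<Longrightarrow> j < a \<Longrightarrow> X $$ (i, j) = (\<Sum>k<a. f k i * cnj (f k j))"
    using psd_decomp[OF X] by metis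
  show "psd m (coeff_map a m w X)"
    unfolding psd_iff
  proof (intro conjI allI)
    fix x
    have "qf m (\<lambda>p q. coeff_map a m w X $$ (p, q)) x =
        qf m (\<lambda>p q. \<Sum>k<a. \<Sum>i<a. \<Sum>j<a. w p q i j * (f k i * cnj (f k j))) x"
    proof (rule qf_cong)
      fix p q assume pq: "p < m" "q < m"
      have "coeff_map a m w X $$ (p, q) = (\<Sum>i<a. \<Sum>j<a. \<Sum>k<a. w p q i j * (f k i * cnj (f k j)))"
        unfolding coeff_map_index[OF pq] by (intro sum.cong refl) (simp add: f sum_distrib_left)
      also have "\<dots> = (\<Sum>k<a. \<Sum>i<a. \<Sum>j<a. w p q i j * (f k i * cnj (f k j)))" by (rule sum_swap3)
      finally show "coeff_map a m w X $$ (p, q) = (\<Sum>k<a. \<Sum>i<a. \<Sum>j<a. w p q i j * (f k i * cnj (f k j)))" .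
    qed simp
    also have "0 \<le> \<dots>" by (subst qf_sum) (intro sum_nonneg assms)
    finally show "0 \<le> qf m (\<lambda>p q. coeff_map a m w X $$ (p, q)) x" .
  qed (simp add: coeff_map_def)
qed

lemma trace_preserving_coeff_map:
  assumes "\<And>i j. i < a \<Longrightarrow> j < a \<Longrightarrow> (\<Sum>p<m. w p p i j) = (if i = j then 1 else 0)"
  shows "trace_preserving a (coeff_map a m w)"
  unfolding trace_preserving_def
proof
  fix X :: "complex mat" assume X: "X \<in> carrier_mat a a"
  have "mat_trace (coeff_map a m w X) = (\<Sum>p<m. \<Sum>i<a. \<Sum>j<a. w p p i j * X $$ (i, j))"
    by (subst mat_trace_eq[of _ m]) (auto simp: coeff_map_def)
  also have "\<dots> = (\<Sum>i<a. \<Sum>j<a. \<Sum>p<m. w p p i j * X $$ (i, j))" by (rule sum_swap3[symmetric])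
  also have "\<dots> = (\<Sum>i<a. \<Sum>j<a. if i = j then X $$ (i, j) else 0)"
    by (intro sum.cong refl) (simp add: assms flip: sum_distrib_right)
  also have "\<dots> = mat_trace X" unfolding mat_trace_eq[OF X] by simp
  finally show "mat_trace (coeff_map a m w X) = mat_trace X" .
qed

lemma qf_Suc_block_diag:
  assumes "\<And>p. p < n \<Longrightarrow> A p n = 0" "\<And>p. p < n \<Longrightarrow> A n p = 0"
  shows "qf (Suc n) A x = qf n A x + cnj (x n) * x n * A n n"
  using assms by (simp add: qf_def mult_ac)

lemma qf_tensor_fun_unit:
  assumes "s < n"
  shows "qf (n * m) W (tensor_fun m (\<lambda>p. if p = s then 1 else 0) v) =
    (\<Sum>i<m. \<Sum>j<m. cnj (v i) * W (s * m + i) (s * m + j) * v j)"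
proof -
  have "qf (n * m) W (tensor_fun m (\<lambda>p. if p = s then 1 else 0) v) =
      (\<Sum>p<n. \<Sum>i<m. \<Sum>q<n. \<Sum>j<m. if p = s then (if q = s then cnj (v i) * W (p * m + i) (q * m + j) * v j else 0) else 0)"
    unfolding qf_tensor_fun by (intro sum.cong refl) auto
  also have "\<dots> = (\<Sum>i<m. \<Sum>q<n. \<Sum>j<m. if q = s then cnj (v i) * W (s * m + i) (q * m + j) * v j else 0)"
    using assms by (subst sum_single[of s]) auto
  also have "\<dots> = (\<Sum>i<m. \<Sum>j<m. cnj (v i) * W (s * m + i) (s * m + j) * v j)"
    using assms by (intro sum.cong[OF refl]) (subst sum_single[of s], auto)
  finally show ?thesis .
qed

lemma psd_ketbra: "dim_vec v = n \<Longrightarrow> psd n (ketbra v)"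
  by (rule psdI_decomp[where I = "{0 :: nat}" and f = "\<lambda>_ r. v $ r"]) (auto simp: ketbra_def)

lemma completely_positiveD:
  assumes "completely_positive a b \<Phi>" "n \<ge> 1" "psd (n * a) X"
  shows "psd (n * b) (id_tensor n a b \<Phi> X)"
  using assms by (auto simp: completely_positive_def positivity_preserving_def)

lemma cnj_nonneg_iff: "0 \<le> cnj z \<longleftrightarrow> 0 \<le> z"
  by (simp add: less_eq_complex_def)

lemma psd_id_tensor_max_entangled:
  assumes "orthonormal_basis d b" "completely_positive d m \<Phi>" "d \<ge> 1"
  shows "psd (d * m) (id_tensor d d m \<Phi> (ketbra (max_entangled d b)))"
  using assms completely_positiveD psd_ketbra[OF max_entangled_dim[OF assms(1)]] by blast

section \<open>Post-composition with positive maps\<close>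

text \<open>The functional \<open>W\<close> becomes a positive map, completed to a trace-preserving
  one by an extra output dimension. Complete positivity of the composite, tested on a single vector,
  gives the required inequality.\<close>

lemma separable_of_post_composition:
  assumes onb: "orthonormal_basis d b" and d: "d \<ge> 1" and cp: "completely_positive d d \<Phi>"
    and post: "\<And>m \<Upsilon>. m \<ge> 1 \<Longrightarrow> positivity_preserving d m \<Upsilon> \<Longrightarrow> trace_preserving d \<Upsilon> \<Longrightarrow>
      completely_positive d m (\<Upsilon> \<circ> \<Phi>)"
  shows "separable d d (id_tensor d d d \<Phi> (ketbra (max_entangled d b)))"
proof (rule separable_of_dual)
  define C where "C = id_tensor d d d \<Phi> (ketbra (max_entangled d b))"
  show "psd (d * d) (id_tensor d d d \<Phi> (ketbra (max_entangled d b)))"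
    using psd_id_tensor_max_entangled onb cp d by blast
  fix W :: "nat \<Rightarrow> nat \<Rightarrow> complex" and \<delta> :: real
  assume \<delta>: "0 < \<delta>"
    and W_ge: "\<And>u v. complex_of_real (\<delta> * ((\<Sum>p<d. (cmod (u p))\<^sup>2) * (\<Sum>i<d. (cmod (v i))\<^sup>2))) \<le> qf (d * d) W (tensor_fun d u v)"
  have W: "0 \<le> qf (d * d) W (tensor_fun d u v)" for u v
  proof -
    have "0 \<le> complex_of_real (\<delta> * ((\<Sum>p<d. (cmod (u p))\<^sup>2) * (\<Sum>i<d. (cmod (v i))\<^sup>2)))"
      using \<delta> by (simp add: less_eq_complex_def sum_nonneg)
    then show ?thesis using W_ge order_trans by blast
  qed
  \<comment> \<open>After division by \<open>c\<close> the map given by \<open>W\<close> has trace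
    at most |v|^2 on |v><v|; the summand 1 keeps \<open>c\<close> positive.\<close>
  define c where "c = 1 + (\<Sum>s<d. \<Sum>i<d. \<Sum>j<d. cmod (W (s * d + i) (s * d + j)))"
  have c: "0 < c" unfolding c_def by (intro add_pos_nonneg sum_nonneg) auto
  \<comment> \<open>The leading corner carries the scaled \<open>W\<close>, conjugated to match the
    antilinear slot of \<open>frob\<close>; entry (d, d) collects the missing trace.\<close>
  define w where "w p q i j = (if p < d \<and> q < d then cnj (W (p * d + i) (q * d + j)) / complex_of_real c
      else if p = d \<and> q = d then (if i = j then 1 else 0) - (\<Sum>s<d. cnj (W (s * d + i) (s * d + j))) / complex_of_real c
      else 0)" for p q i j
  have pos: "0 \<le> qf (Suc d) (\<lambda>p q. \<Sum>i<d. \<Sum>j<d. w p q i j * (v i * cnj (v j))) x" for v x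
  proof -
    define A where "A = (\<lambda>p q. \<Sum>i<d. \<Sum>j<d. w p q i j * (v i * cnj (v j)))"
    \<comment> \<open>For input |v><v|, the form of the corner at \<open>x\<close> is
      \<open>W\<close> at the product vector conj(x) \<otimes> v.\<close>
    have "qf d A x = qf (d * d) W (tensor_fun d (\<lambda>p. cnj (x p)) v) / complex_of_real c" (is "_ = ?B / _")
    proof -
      have "qf d A x = (\<Sum>p<d. \<Sum>q<d. \<Sum>i<d. \<Sum>j<d. cnj (x p) * (cnj (W (p * d + i) (q * d + j)) * (v i * cnj (v j))) * x q / complex_of_real c)"
        unfolding qf_def A_def by (intro sum.cong refl) (simp add: w_def sum_distrib_left sum_distrib_right)
      also have "\<dots> = cnj (\<Sum>p<d. \<Sum>q<d. \<Sum>i<d. \<Sum>j<d. x p * cnj (v i) * W (p * d + i) (q * d + j) * (cnj (x q) * v j)) / complex_of_real c"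
        unfolding cnj_sum sum_divide_distrib by (intro sum.cong refl) (simp add: mult_ac)
      also have "(\<Sum>p<d. \<Sum>q<d. \<Sum>i<d. \<Sum>j<d. x p * cnj (v i) * W (p * d + i) (q * d + j) * (cnj (x q) * v j)) = ?B"
        unfolding qf_tensor_fun complex_cnj_cnj by (intro sum.cong[OF refl] sum.swap)
      also have "cnj ?B = ?B" using W by (simp add: complex_eq_iff less_eq_complex_def)
      finally show ?thesis .
    qed
    then have 1: "0 \<le> qf d A x" using W c by (simp add: less_eq_complex_def)
    \<comment> \<open>The trace of the corner at |v><v| is \<tau> / c, and \<open>S\<close> is the
      trace of |v><v|; the last diagonal entry is their difference.\<close>
    define \<tau> where "\<tau> = (\<Sum>s<d. \<Sum>i<d. \<Sum>j<d. cnj (v i) * W (s * d + i) (s * d + j) * v j)"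
    define S where "S = (\<Sum>i<d. (cmod (v i))\<^sup>2)"
    have \<tau>: "0 \<le> \<tau>"
      unfolding \<tau>_def
    proof (rule sum_nonneg)
      fix s assume "s \<in> {..<d}"
      then have "s < d" by simp
      from W[of "\<lambda>p. if p = s then 1 else 0" v, unfolded qf_tensor_fun_unit[OF this]]
      show "0 \<le> (\<Sum>i<d. \<Sum>j<d. cnj (v i) * W (s * d + i) (s * d + j) * v j)" .
    qed
    have v_le: "cmod (v i) * cmod (v j) \<le> S" if "i < d" "j < d" for i j
    proof -
      have le: "(cmod (v k))\<^sup>2 \<le> S" if "k < d" for k
        unfolding S_def using that by (intro member_le_sum) auto
      have "2 * (cmod (v i) * cmod (v j)) \<le> (cmod (v i))\<^sup>2 + (cmod (v j))\<^sup>2"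
        using sum_squares_bound[of "cmod (v i)" "cmod (v j)"] by simp
      then show ?thesis using le[OF that(1)] le[OF that(2)] by simp
    qed
    have S0: "0 \<le> S" unfolding S_def by (intro sum_nonneg) auto
    have "cmod \<tau> \<le> (\<Sum>s<d. \<Sum>i<d. \<Sum>j<d. cmod (W (s * d + i) (s * d + j)) * S)"
      unfolding \<tau>_def
    proof (intro sum_norm_le)
      fix s i j assume "s \<in> {..<d}" "i \<in> {..<d}" "j \<in> {..<d}"
      then show "cmod (cnj (v i) * W (s * d + i) (s * d + j) * v j) \<le> cmod (W (s * d + i) (s * d + j)) * S"
        using mult_left_mono[OF v_le, of i j "cmod (W (s * d + i) (s * d + j))"] by (simp add: norm_mult mult_ac)
    qed
    also have "\<dots> \<le> c * S" unfolding c_def distrib_right sum_distrib_right using S0 by simp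
    finally have \<tau>_le: "Re \<tau> / c \<le> S" using complex_Re_le_cmod[of \<tau>] c by (simp add: field_simps)
    have "A d d = complex_of_real S - \<tau> / complex_of_real c"
    proof -
      have "A d d = (\<Sum>i<d. \<Sum>j<d. (if i = j then v i * cnj (v j) else 0)
          - (\<Sum>s<d. v i * cnj (W (s * d + i) (s * d + j)) * cnj (v j)) / complex_of_real c)"
        unfolding A_def
        by (intro sum.cong refl) (simp add: w_def algebra_simps sum_distrib_left sum_distrib_right)
      also have "\<dots> = (\<Sum>i<d. v i * cnj (v i)) -
          (\<Sum>i<d. \<Sum>j<d. \<Sum>s<d. v i * cnj (W (s * d + i) (s * d + j)) * cnj (v j)) / complex_of_real c"
        by (simp add: sum_subtractf sum_divide_distrib)
      also have "(\<Sum>i<d. \<Sum>j<d. \<Sum>s<d. v i * cnj (W (s * d + i) (s * d + j)) * cnj (v j)) = cnj \<tau>"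
        unfolding \<tau>_def cnj_sum by (subst sum_swap3) simp
      also have "cnj \<tau> = \<tau>" using \<tau> by (simp add: complex_eq_iff less_eq_complex_def)
      also have "(\<Sum>i<d. v i * cnj (v i)) = complex_of_real S"
        unfolding S_def of_real_sum by (intro sum.cong refl) (rule complex_norm_square[symmetric])
      finally show ?thesis .
    qed
    then have 2: "0 \<le> A d d" using \<tau> \<tau>_le c by (simp add: less_eq_complex_def)
    have "qf (Suc d) A x = qf d A x + cnj (x d) * x d * A d d"
      by (rule qf_Suc_block_diag) (auto simp: A_def w_def)
    moreover have "0 \<le> cnj (x d) * x d * A d d"
      by (rule mult_nonneg_nonneg[OF _ 2]) (simp add: less_eq_complex_def)
    ultimately show ?thesis using 1 by (simp add: A_def)
  qed
  have tr: "(\<Sum>p<Suc d. w p p i j) = (if i = j then 1 else 0)" for i j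
    by (simp add: w_def sum_divide_distrib)
  define \<Upsilon> where "\<Upsilon> = coeff_map d (Suc d) w"
  have "completely_positive d (Suc d) (\<Upsilon> \<circ> \<Phi>)"
    unfolding \<Upsilon>_def using pos tr
    by (intro post positivity_preserving_coeff_map trace_preserving_coeff_map) auto
  then have "psd (d * Suc d) (id_tensor d d (Suc d) (\<Upsilon> \<circ> \<Phi>) (ketbra (max_entangled d b)))"
    using psd_id_tensor_max_entangled onb d by blast
  \<comment> \<open>Only output indices below \<open>d\<close> occur in this vector, so the
    trace-collecting entry drops out.\<close>
  from psdD(2)[OF this, of "\<lambda>r. if r mod Suc d = r div Suc d then 1 else 0"]
  have "0 \<le> (\<Sum>p<d. \<Sum>q<d. id_tensor d d (Suc d) (\<Upsilon> \<circ> \<Phi>) (ketbra (max_entangled d b)) $$ (p * Suc d + p, q * Suc d + q))"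
    unfolding qf_diagonal_vector[OF le_SucI[OF order_refl]] .
  also have "\<dots> = (\<Sum>p<d. \<Sum>q<d. \<Sum>i<d. \<Sum>j<d. cnj (W (p * d + i) (q * d + j)) * C $$ (p * d + i, q * d + j) / complex_of_real c)"
  proof (intro sum.cong[OF refl])
    fix p q assume "p \<in> {..<d}" "q \<in> {..<d}"
    then have pq: "p < d" "q < d" by auto
    have "id_tensor d d (Suc d) (\<Upsilon> \<circ> \<Phi>) (ketbra (max_entangled d b)) $$ (p * Suc d + p, q * Suc d + q) =
        \<Upsilon> (\<Phi> (block d (ketbra (max_entangled d b)) p q)) $$ (p, q)"
      using pq by (subst id_tensor_index) auto
    also have "\<dots> = (\<Sum>i<d. \<Sum>j<d. w p q i j * \<Phi> (block d (ketbra (max_entangled d b)) p q) $$ (i, j))"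
      unfolding \<Upsilon>_def using pq by (intro coeff_map_index) auto
    also have "\<dots> = (\<Sum>i<d. \<Sum>j<d. cnj (W (p * d + i) (q * d + j)) * C $$ (p * d + i, q * d + j) / complex_of_real c)"
      using pq by (intro sum.cong refl) (simp add: w_def C_def id_tensor_index)
    finally show "id_tensor d d (Suc d) (\<Upsilon> \<circ> \<Phi>) (ketbra (max_entangled d b)) $$ (p * Suc d + p, q * Suc d + q) =
      (\<Sum>i<d. \<Sum>j<d. cnj (W (p * d + i) (q * d + j)) * C $$ (p * d + i, q * d + j) / complex_of_real c)" .
  qed
  also have "\<dots> = frob (d * d) W (\<lambda>r s. C $$ (r, s)) / complex_of_real c"
    unfolding frob_mult_split sum_divide_distrib ..
  finally show "0 \<le> Re (frob (d * d) W (\<lambda>r s. id_tensor d d d \<Phi> (ketbra (max_entangled d b)) $$ (r, s)))"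
    using c by (simp add: less_eq_complex_def C_def zero_le_divide_iff)
qed

section \<open>Pre-composition with positive maps\<close>

lemma inverse_matrix_coeffs:
  fixes S :: "nat \<Rightarrow> nat \<Rightarrow> complex"
  assumes inj: "\<And>v. (\<And>k. k < n \<Longrightarrow> (\<Sum>p<n. S k p * v p) = 0) \<Longrightarrow> (\<And>p. p < n \<Longrightarrow> v p = 0)"
  obtains K where "\<And>p q. p < n \<Longrightarrow> q < n \<Longrightarrow> (\<Sum>i<n. K p i * S i q) = (if p = q then 1 else 0)"
    and "\<And>p q. p < n \<Longrightarrow> q < n \<Longrightarrow> (\<Sum>i<n. S p i * K i q) = (if p = q then 1 else 0)"
proof -
  define A where "A = mat n n (\<lambda>(i, j). S i j)"
  have A: "A \<in> carrier_mat n n" by (simp add: A_def)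
  have "det A \<noteq> 0"
  proof
    assume "det A = 0"
    with det_0_iff_vec_prod_zero_field[OF A] obtain v
      where v: "v \<in> carrier_vec n" "v \<noteq> 0\<^sub>v n" "A *\<^sub>v v = 0\<^sub>v n" by auto
    have "(\<Sum>p<n. S k p * v $ p) = 0" if "k < n" for k
    proof -
      have "(A *\<^sub>v v) $ k = (\<Sum>p<n. S k p * v $ p)"
        using that v(1) by (simp add: A_def scalar_prod_def lessThan_atLeast0)
      then show ?thesis using v(3) that by simp
    qed
    then have "v $ p = 0" if "p < n" for p using inj[of "\<lambda>p. v $ p"] that by blast
    then have "v = 0\<^sub>v n" using v(1) by (intro eq_vecI) auto
    with v(2) show False ..
  qed
  from det_non_zero_imp_unit[OF A this, of undefined]
  obtain B where B: "B \<in> carrier_mat n n" "B * A = 1\<^sub>m n" "A * B = 1\<^sub>m n"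
    unfolding Units_def by (auto simp: ring_mat_def)
  have "(\<Sum>i<n. B $$ (p, i) * S i q) = (if p = q then 1 else 0)" if "p < n" "q < n" for p q
    using arg_cong[OF B(2), of "\<lambda>M. M $$ (p, q)"] that
    unfolding mult_mat_index[OF B(1) A that] by (simp add: A_def)
  moreover have "(\<Sum>i<n. S p i * B $$ (i, q)) = (if p = q then 1 else 0)" if "p < n" "q < n" for p q
    using arg_cong[OF B(3), of "\<lambda>M. M $$ (p, q)"] that
    unfolding mult_mat_index[OF A B(1) that] by (simp add: A_def)
  ultimately show ?thesis by (rule that[of "\<lambda>i j. B $$ (i, j)"])
qed

lemma sum_swap22:
  "(\<Sum>i\<in>A. \<Sum>j\<in>B. \<Sum>k\<in>C. \<Sum>l\<in>D. f i j k l) = (\<Sum>k\<in>C. \<Sum>l\<in>D. \<Sum>i\<in>A. \<Sum>j\<in>B. f i j k l)"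
  by (subst sum_swap3, rule sum.cong[OF refl], rule sum_swap3)

text \<open>The inner coefficients describe the map given by \<open>u\<close> after the substitution
  of K X K^dagger for X, here evaluated at |v><w|.\<close>

lemma sum_bilinear_coeffs:
  fixes K :: "nat \<Rightarrow> nat \<Rightarrow> complex"
  shows "(\<Sum>i<n. \<Sum>j<n. (\<Sum>p<n. \<Sum>q<n. u p q * (K p i * cnj (K q j))) * (v i * cnj (w j))) =
    (\<Sum>p<n. \<Sum>q<n. u p q * ((\<Sum>i<n. K p i * v i) * cnj (\<Sum>j<n. K q j * w j)))"
proof -
  have "(\<Sum>i<n. \<Sum>j<n. (\<Sum>p<n. \<Sum>q<n. u p q * (K p i * cnj (K q j))) * (v i * cnj (w j))) =
      (\<Sum>i<n. \<Sum>j<n. \<Sum>p<n. \<Sum>q<n. u p q * ((K p i * v i) * cnj (K q j * w j)))"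
    unfolding sum_distrib_right by (intro sum.cong refl) simp
  also have "\<dots> = (\<Sum>p<n. \<Sum>q<n. \<Sum>i<n. \<Sum>j<n. u p q * ((K p i * v i) * cnj (K q j * w j)))"
    by (rule sum_swap22)
  also have "\<dots> = (\<Sum>p<n. \<Sum>q<n. u p q * ((\<Sum>i<n. K p i * v i) * cnj (\<Sum>j<n. K q j * w j)))"
    unfolding cnj_sum sum_product unfolding sum_distrib_left ..
  finally show ?thesis .
qed

text \<open>The trace is corrected on the input side by K X K^dagger, and the test vector
  \<open>y\<close> undoes this substitution. The outputs are expanded in |v_s><v_t|, on which \<Phi>
  is known from \<open>C\<close>.\<close>

lemma separable_of_pre_composition:
  assumes onb: "orthonormal_basis d b" and d: "d \<ge> 1" and cp: "completely_positive d d \<Phi>"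
    and pre: "\<And>m \<Upsilon>. m \<ge> 1 \<Longrightarrow> positivity_preserving m d \<Upsilon> \<Longrightarrow> trace_preserving m \<Upsilon> \<Longrightarrow>
      completely_positive m d (\<Phi> \<circ> \<Upsilon>)"
  shows "separable d d (id_tensor d d d \<Phi> (ketbra (max_entangled d b)))"
proof (rule separable_of_dual)
  define C where "C = id_tensor d d d \<Phi> (ketbra (max_entangled d b))"
  have lin: "lin_map d d \<Phi>" using cp by (simp add: completely_positive_def)
  show "psd (d * d) (id_tensor d d d \<Phi> (ketbra (max_entangled d b)))"
    using psd_id_tensor_max_entangled onb cp d by blast
  fix W :: "nat \<Rightarrow> nat \<Rightarrow> complex" and \<delta> :: real
  assume \<delta>: "0 < \<delta>"
    and W_ge: "\<And>u v. complex_of_real (\<delta> * ((\<Sum>p<d. (cmod (u p))\<^sup>2) * (\<Sum>i<d. (cmod (v i))\<^sup>2))) \<le> qf (d * d) W (tensor_fun d u v)"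
  have W: "0 \<le> qf (d * d) W (tensor_fun d u v)" for u v
  proof -
    have "0 \<le> complex_of_real (\<delta> * ((\<Sum>p<d. (cmod (u p))\<^sup>2) * (\<Sum>i<d. (cmod (v i))\<^sup>2)))"
      using \<delta> by (simp add: less_eq_complex_def sum_nonneg)
    then show ?thesis using W_ge order_trans by blast
  qed
  define V where "V = entangled_coeff d b"
  have V: "(\<Sum>a<d. V s a * cnj (V t a)) = (if s = t then 1 else 0)" if "s < d" "t < d" for s t
    unfolding V_def by (rule entangled_coeff_unitary[OF onb that])
  \<comment> \<open>This map sends the matrix unit E_pq to the combination of |v_s><v_t| with
    conjugated entries of \<open>W\<close> as coefficients.\<close>
  define u where "u a c p q = (\<Sum>s<d. \<Sum>t<d. cnj (W (s * d + p) (t * d + q)) * (V s a * cnj (V t c)))" for a c p q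
  have u_pos: "0 \<le> qf d (\<lambda>a c. \<Sum>p<d. \<Sum>q<d. u a c p q * (x p * cnj (x q))) z" for x z
  proof -
    define y where "y s = (\<Sum>a<d. cnj (z a) * V s a)" for s
    have "qf d (\<lambda>a c. \<Sum>p<d. \<Sum>q<d. u a c p q * (x p * cnj (x q))) z =
        qf d (\<lambda>a c. \<Sum>p<d. \<Sum>q<d. \<Sum>s<d. \<Sum>t<d. (cnj (W (s * d + p) (t * d + q)) * (x p * cnj (x q))) * (V s a * cnj (V t c))) z"
      unfolding u_def sum_distrib_right by (intro qf_cong sum.cong refl) (simp add: mult_ac)
    also have "\<dots> = (\<Sum>p<d. \<Sum>q<d. \<Sum>s<d. \<Sum>t<d. (cnj (W (s * d + p) (t * d + q)) * (x p * cnj (x q))) * (y s * cnj (y t)))"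
      unfolding qf_sum qf_scale qf_rank_one y_def ..
    also have "\<dots> = (\<Sum>s<d. \<Sum>t<d. \<Sum>p<d. \<Sum>q<d. (cnj (W (s * d + p) (t * d + q)) * (x p * cnj (x q))) * (y s * cnj (y t)))"
      by (rule sum_swap22)
    also have "\<dots> = (\<Sum>s<d. \<Sum>p<d. \<Sum>t<d. \<Sum>q<d. (cnj (W (s * d + p) (t * d + q)) * (x p * cnj (x q))) * (y s * cnj (y t)))"
      by (rule sum.cong[OF refl]) (rule sum.swap)
    also have "\<dots> = cnj (qf (d * d) W (tensor_fun d y x))"
      unfolding qf_tensor_fun cnj_sum by (intro sum.cong refl) simp
    finally show ?thesis using W by (simp add: cnj_nonneg_iff)
  qed
  \<comment> \<open>The trace of the uncorrected map at X is Tr(T X).\<close>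
  define T where "T i j = (\<Sum>s<d. cnj (W (s * d + j) (s * d + i)))" for i j
  have u_tr: "(\<Sum>a<d. u a a p q) = T q p" for p q
  proof -
    have "(\<Sum>a<d. u a a p q) = (\<Sum>s<d. \<Sum>t<d. \<Sum>a<d. cnj (W (s * d + p) (t * d + q)) * (V s a * cnj (V t a)))"
      unfolding u_def by (rule sum_swap3[symmetric])
    also have "\<dots> = (\<Sum>s<d. \<Sum>t<d. if s = t then cnj (W (s * d + p) (t * d + q)) else 0)"
      by (intro sum.cong refl) (simp add: V flip: sum_distrib_left)
    also have "\<dots> = T q p" by (simp add: T_def)
    finally show ?thesis .
  qed
  have qf_T: "qf d T x = (\<Sum>s<d. cnj (qf (d * d) W (tensor_fun d (\<lambda>p. if p = s then 1 else 0) x)))" for x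
  proof -
    have "qf d T x = (\<Sum>s<d. qf d (\<lambda>i j. cnj (W (s * d + j) (s * d + i))) x)"
      unfolding T_def qf_sum ..
    also have "\<dots> = (\<Sum>s<d. cnj (\<Sum>j<d. \<Sum>i<d. cnj (x j) * W (s * d + j) (s * d + i) * x i))"
      unfolding qf_def cnj_sum by (rule sum.cong[OF refl], subst sum.swap) (simp add: mult_ac)
    finally show ?thesis by (simp add: qf_tensor_fun_unit)
  qed
  have T_nonneg: "0 \<le> qf d T x" for x
    unfolding qf_T using W by (intro sum_nonneg) (simp add: cnj_nonneg_iff)
  \<comment> \<open>The summand for \<open>s = 0\<close> alone has the margin \<delta>, so
    \<open>T\<close> is positive definite.\<close>
  have T_ge: "\<delta> * (\<Sum>i<d. (cmod (x i))\<^sup>2) \<le> Re (qf d T x)" for x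
  proof -
    have one: "(\<Sum>p<d. (cmod (if p = 0 then 1 else 0 :: complex))\<^sup>2) = 1"
      using d by (subst sum_single[of 0]) auto
    have "\<delta> * (\<Sum>i<d. (cmod (x i))\<^sup>2) \<le> Re (cnj (qf (d * d) W (tensor_fun d (\<lambda>p. if p = 0 then 1 else 0) x)))"
      using W_ge[of "\<lambda>p. if p = 0 then 1 else 0" x] unfolding one by (simp add: less_eq_complex_def)
    also have "\<dots> \<le> (\<Sum>s<d. Re (cnj (qf (d * d) W (tensor_fun d (\<lambda>p. if p = s then 1 else 0) x))))"
      using d W by (intro member_le_sum[of 0 "{..<d}" "\<lambda>s. Re (cnj (qf (d * d) W (tensor_fun d (\<lambda>p. if p = s then 1 else 0) x)))"])
        (auto simp: less_eq_complex_def)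
    finally show ?thesis unfolding qf_T Re_sum .
  qed
  obtain f where f: "\<And>i j. i < d \<Longrightarrow> j < d \<Longrightarrow> T i j = (\<Sum>k<d. f k i * cnj (f k j))"
    using qf_nonneg_decomp[of d T] T_nonneg by blast
  \<comment> \<open>This gives T = S^dagger S, and definiteness of \<open>T\<close> makes
    \<open>S\<close> injective.\<close>
  define S where "S k p = cnj (f k p)" for k p
  obtain K where KS: "\<And>p q. p < d \<Longrightarrow> q < d \<Longrightarrow> (\<Sum>i<d. K p i * S i q) = (if p = q then 1 else 0)"
    and SK: "\<And>p q. p < d \<Longrightarrow> q < d \<Longrightarrow> (\<Sum>i<d. S p i * K i q) = (if p = q then 1 else 0)"
  proof (rule inverse_matrix_coeffs[of d S])
    fix v p assume v: "\<And>k. k < d \<Longrightarrow> (\<Sum>p<d. S k p * v p) = 0" and p: "p < d"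
    have "(\<Sum>i<d. cnj (v i) * f k i) = 0" if "k < d" for k
      using arg_cong[OF v[OF that], of cnj] by (simp add: S_def mult.commute)
    then have "qf d T v = 0"
      using qf_cong[of d T "\<lambda>i j. \<Sum>k<d. f k i * cnj (f k j)" v v] f
      by (simp add: qf_ketbra_sum del: cnj_sum)
    then have "\<delta> * (\<Sum>i<d. (cmod (v i))\<^sup>2) \<le> 0" using T_ge[of v] by simp
    then have "(\<Sum>i<d. (cmod (v i))\<^sup>2) \<le> 0" using \<delta> by (simp add: mult_le_0_iff)
    moreover have "(cmod (v p))\<^sup>2 \<le> (\<Sum>i<d. (cmod (v i))\<^sup>2)" using p by (intro member_le_sum) auto
    ultimately have "(cmod (v p))\<^sup>2 \<le> 0" by linarith
    then show "v p = 0" by simp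
  qed (rule that)
  \<comment> \<open>With K = S^(-1), the trace Tr(T K X K^dagger) reduces to Tr X.\<close>
  define w where "w a c i j = (\<Sum>p<d. \<Sum>q<d. u a c p q * (K p i * cnj (K q j)))" for a c i j
  define \<Upsilon> where "\<Upsilon> = coeff_map d d w"
  have "positivity_preserving d d \<Upsilon>"
    unfolding \<Upsilon>_def
    by (rule positivity_preserving_coeff_map) (simp only: w_def sum_bilinear_coeffs u_pos)
  moreover have "trace_preserving d \<Upsilon>"
    unfolding \<Upsilon>_def
  proof (rule trace_preserving_coeff_map)
    fix i j assume ij: "i < d" "j < d"
    have "(\<Sum>a<d. w a a i j) = (\<Sum>p<d. \<Sum>q<d. \<Sum>a<d. u a a p q * (K p i * cnj (K q j)))"
      unfolding w_def by (rule sum_swap3[symmetric])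
    also have "\<dots> = (\<Sum>p<d. \<Sum>q<d. \<Sum>k<d. (S k p * K p i) * cnj (S k q * K q j))"
    proof (rule sum.cong[OF refl], rule sum.cong[OF refl])
      fix p q assume "p \<in> {..<d}" "q \<in> {..<d}"
      then have pq: "q < d" "p < d" by auto
      have "(\<Sum>a<d. u a a p q * (K p i * cnj (K q j))) = T q p * (K p i * cnj (K q j))"
        unfolding sum_distrib_right[symmetric] u_tr ..
      also have "\<dots> = (\<Sum>k<d. (S k p * K p i) * cnj (S k q * K q j))"
        unfolding f[OF pq] sum_distrib_right by (intro sum.cong refl) (simp add: S_def mult_ac)
      finally show "(\<Sum>a<d. u a a p q * (K p i * cnj (K q j))) = (\<Sum>k<d. (S k p * K p i) * cnj (S k q * K q j))" .
    qed
    also have "\<dots> = (\<Sum>k<d. \<Sum>p<d. \<Sum>q<d. (S k p * K p i) * cnj (S k q * K q j))"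
      by (rule sum_swap3)
    also have "\<dots> = (\<Sum>k<d. (\<Sum>p<d. S k p * K p i) * cnj (\<Sum>q<d. S k q * K q j))"
      unfolding cnj_sum sum_product ..
    also have "\<dots> = (\<Sum>k<d. if k = i then (if k = j then 1 else 0) else 0)"
      using ij by (intro sum.cong refl) (auto simp: SK simp del: cnj_sum)
    also have "\<dots> = (if i = j then 1 else 0)" using ij by simp
    finally show "(\<Sum>a<d. w a a i j) = (if i = j then 1 else 0)" .
  qed
  ultimately have cp': "completely_positive d d (\<Phi> \<circ> \<Upsilon>)" using pre d by blast
  \<comment> \<open>Block (p, q) of |y><y| is S E_pq S^dagger, so \<open>K\<close> cancels
    \<open>S\<close> and \<Upsilon> returns the uncorrected image of E_pq.\<close>
  define y where "y = vec (d * d) (\<lambda>r. S (r mod d) (r div d))"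
  have block_y: "block d (ketbra y) p q $$ (i, j) = S i p * cnj (S j q)"
    if "p < d" "q < d" "i < d" "j < d" for p q i j
    using that by (simp add: block_index ketbra_def y_def block_index_less)
  have \<Upsilon>_block: "\<Upsilon> (block d (ketbra y) p q) $$ (a, c) = u a c p q"
    if pq: "p < d" "q < d" and ac: "a < d" "c < d" for p q a c
  proof -
    have "\<Upsilon> (block d (ketbra y) p q) $$ (a, c) = (\<Sum>i<d. \<Sum>j<d. w a c i j * (S i p * cnj (S j q)))"
      unfolding \<Upsilon>_def coeff_map_index[OF ac] using pq by (intro sum.cong refl) (simp add: block_y)
    also have "\<dots> = (\<Sum>p'<d. \<Sum>q'<d. u a c p' q' * ((\<Sum>i<d. K p' i * S i p) * cnj (\<Sum>j<d. K q' j * S j q)))"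
      unfolding w_def by (rule sum_bilinear_coeffs)
    also have "\<dots> = (\<Sum>p'<d. \<Sum>q'<d. if p' = p then (if q' = q then u a c p' q' else 0) else 0)"
      using pq by (intro sum.cong refl) (auto simp: KS simp del: cnj_sum)
    also have "\<dots> = u a c p q" using pq by (subst sum_single[of p]) auto
    finally show ?thesis .
  qed
  \<comment> \<open>The factor \<open>d\<close> undoes the normalisation of the maximally entangled
    state.\<close>
  have \<Phi>\<Upsilon>: "\<Phi> (\<Upsilon> (block d (ketbra y) p q)) $$ (i, j) =
      (\<Sum>s<d. \<Sum>t<d. cnj (W (s * d + p) (t * d + q)) * (of_nat d * C $$ (s * d + i, t * d + j)))"
    if pq: "p < d" "q < d" and ij: "i < d" "j < d" for p q i j
  proof -
    define Y where "Y = (\<lambda>(s, t). mat d d (\<lambda>(k, l). V s k * cnj (V t l)))"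
    define g where "g = (\<lambda>(s, t). cnj (W (s * d + p) (t * d + q)))"
    have "\<Phi> (\<Upsilon> (block d (ketbra y) p q)) $$ (i, j) = (\<Sum>st\<in>{..<d} \<times> {..<d}. g st * \<Phi> (Y st) $$ (i, j))"
    proof (rule lin_map_expand[OF lin _ _ _ _ ij])
      show "\<Upsilon> (block d (ketbra y) p q) \<in> carrier_mat d d" by (simp add: \<Upsilon>_def coeff_map_def)
      show "\<Upsilon> (block d (ketbra y) p q) $$ (a, c) = (\<Sum>st\<in>{..<d} \<times> {..<d}. g st * Y st $$ (a, c))"
        if ac: "a < d" "c < d" for a c
      proof -
        have "(\<Sum>st\<in>{..<d} \<times> {..<d}. g st * Y st $$ (a, c)) = (\<Sum>s<d. \<Sum>t<d. g (s, t) * Y (s, t) $$ (a, c))"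
          by (simp add: sum.cartesian_product case_prod_unfold)
        also have "\<dots> = u a c p q"
          unfolding u_def using ac by (intro sum.cong refl) (simp add: g_def Y_def)
        finally show ?thesis unfolding \<Upsilon>_block[OF pq ac] by simp
      qed
    qed (auto simp: Y_def)
    also have "\<dots> = (\<Sum>s<d. \<Sum>t<d. g (s, t) * \<Phi> (Y (s, t)) $$ (i, j))"
      by (simp add: sum.cartesian_product case_prod_unfold)
    also have "\<dots> = (\<Sum>s<d. \<Sum>t<d. cnj (W (s * d + p) (t * d + q)) * (of_nat d * C $$ (s * d + i, t * d + j)))"
    proof (intro sum.cong[OF refl])
      fix s t assume "s \<in> {..<d}" "t \<in> {..<d}"
      then have st: "s < d" "t < d" by auto
      have "C $$ (s * d + i, t * d + j) = complex_of_real (1 / real d) * \<Phi> (Y (s, t)) $$ (i, j)"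
        unfolding C_def id_tensor_max_entangled_index[OF onb lin st ij] by (simp add: Y_def V_def)
      then show "g (s, t) * \<Phi> (Y (s, t)) $$ (i, j) =
          cnj (W (s * d + p) (t * d + q)) * (of_nat d * C $$ (s * d + i, t * d + j))"
        using d by (simp add: g_def)
    qed
    finally show ?thesis .
  qed
  have "psd (d * d) (ketbra y)" by (rule psd_ketbra) (simp add: y_def)
  \<comment> \<open>The sum over these entries is d times the pairing of \<open>W\<close> with
    \<open>C\<close>.\<close>
  from psdD(2)[OF completely_positiveD[OF cp' d this], of "\<lambda>r. if r mod d = r div d then 1 else 0"]
  have "0 \<le> (\<Sum>p<d. \<Sum>q<d. id_tensor d d d (\<Phi> \<circ> \<Upsilon>) (ketbra y) $$ (p * d + p, q * d + q))"
    unfolding qf_diagonal_vector[OF order_refl] .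
  also have "\<dots> = (\<Sum>p<d. \<Sum>q<d. \<Sum>s<d. \<Sum>t<d. of_nat d * (cnj (W (s * d + p) (t * d + q)) * C $$ (s * d + p, t * d + q)))"
    by (intro sum.cong refl) (simp add: id_tensor_index \<Phi>\<Upsilon> mult_ac)
  also have "\<dots> = (\<Sum>s<d. \<Sum>t<d. \<Sum>p<d. \<Sum>q<d. of_nat d * (cnj (W (s * d + p) (t * d + q)) * C $$ (s * d + p, t * d + q)))"
    by (rule sum_swap22)
  also have "\<dots> = of_nat d * frob (d * d) W (\<lambda>r s. C $$ (r, s))"
    unfolding frob_mult_split sum_distrib_left ..
  finally show "0 \<le> Re (frob (d * d) W (\<lambda>r s. id_tensor d d d \<Phi> (ketbra (max_entangled d b)) $$ (r, s)))"
    using d by (simp add: less_eq_complex_def C_def zero_le_mult_iff)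
qed

section \<open>The equivalences, in general and for trace-preserving maps\<close>

theorem theorem4:
  fixes d :: nat and b :: "nat \<Rightarrow> complex vec" and \<Phi> :: "complex mat \<Rightarrow> complex mat"
  assumes "d \<ge> 1"
    and "orthonormal_basis d b"
    and "completely_positive d d \<Phi>"
  shows
    "(let
        condA = (\<exists>K R F. holevo_rep d K R F \<Phi>);
        condB = entanglement_breaking d \<Phi>;
        condC = separable d d (id_tensor d d d \<Phi> (ketbra (max_entangled d b)));
        condD = (\<exists>K A. rank_one_kraus_rep d K A \<Phi>);
        condE = (\<forall>m\<ge>1. \<forall>\<Upsilon>. positivity_preserving d m \<Upsilon> \<longrightarrow> completely_positive d m (\<Upsilon> \<circ> \<Phi>));
        condF = (\<forall>m\<ge>1. \<forall>\<Upsilon>. positivity_preserving m d \<Upsilon> \<longrightarrow> completely_positive m d (\<Phi> \<circ> \<Upsilon>))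
      in (condA \<longleftrightarrow> condB) \<and> (condB \<longleftrightarrow> condC) \<and> (condC \<longleftrightarrow> condD) \<and>
         (condD \<longleftrightarrow> condE) \<and> (condE \<longleftrightarrow> condF))
     \<and>
     (trace_preserving d \<Phi> \<longrightarrow>
      (let
        condA = (\<exists>K R F. holevo_rep d K R F \<Phi> \<and> povm d K F);
        condB = EBT d \<Phi>;
        condC = separable d d (id_tensor d d d \<Phi> (ketbra (max_entangled d b)));
        condD = (\<exists>K A. rank_one_kraus_rep d K A \<Phi> \<and>
                 mat_sum d (\<lambda>k. mat_adjoint (A k) * A k) {..<K} = 1\<^sub>m d);
        condE = (\<forall>m\<ge>1. \<forall>\<Upsilon>. positivity_preserving d m \<Upsilon> \<and> trace_preserving d \<Upsilon> \<longrightarrow>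
                 completely_positive d m (\<Upsilon> \<circ> \<Phi>));
        condF = (\<forall>m\<ge>1. \<forall>\<Upsilon>. positivity_preserving m d \<Upsilon> \<and> trace_preserving m \<Upsilon> \<longrightarrow>
                 completely_positive m d (\<Phi> \<circ> \<Upsilon>))
      in (condA \<longleftrightarrow> condB) \<and> (condB \<longleftrightarrow> condC) \<and> (condC \<longleftrightarrow> condD) \<and>
         (condD \<longleftrightarrow> condE) \<and> (condE \<longleftrightarrow> condF)))"
proof -
  note d = assms(1) and onb = assms(2) and cp = assms(3)
  define sep where "sep \<longleftrightarrow> separable d d (id_tensor d d d \<Phi> (ketbra (max_entangled d b)))"
  define E where "E \<longleftrightarrow> (\<forall>m\<ge>1. \<forall>\<Upsilon>. positivity_preserving d m \<Upsilon> \<longrightarrow> completely_positive d m (\<Upsilon> \<circ> \<Phi>))"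
  define E' where "E' \<longleftrightarrow> (\<forall>m\<ge>1. \<forall>\<Upsilon>. positivity_preserving d m \<Upsilon> \<and> trace_preserving d \<Upsilon> \<longrightarrow>
    completely_positive d m (\<Upsilon> \<circ> \<Phi>))"
  define F where "F \<longleftrightarrow> (\<forall>m\<ge>1. \<forall>\<Upsilon>. positivity_preserving m d \<Upsilon> \<longrightarrow> completely_positive m d (\<Phi> \<circ> \<Upsilon>))"
  define F' where "F' \<longleftrightarrow> (\<forall>m\<ge>1. \<forall>\<Upsilon>. positivity_preserving m d \<Upsilon> \<and> trace_preserving m \<Upsilon> \<longrightarrow>
    completely_positive m d (\<Phi> \<circ> \<Upsilon>))"
  have lin: "lin_map d d \<Phi>" using cp by (simp add: completely_positive_def)
  have mp: "\<exists>K F R. measure_prepare d d K F R \<Phi>" if sep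
    using measure_prepare_of_separable[OF onb lin d] that unfolding sep_def by blast
  have B_sep: sep if "entanglement_breaking d \<Phi>"
    using that density_matrix_max_entangled[OF onb d] d unfolding entanglement_breaking_def sep_def by blast
  have mp_B: "entanglement_breaking d \<Phi>" if "measure_prepare d d K F R \<Phi>" for K F R
    unfolding entanglement_breaking_def density_matrix_def
    using cp separable_measure_prepare[OF that] by blast
  have A: "(\<exists>K R F. holevo_rep d K R F \<Phi>) \<longleftrightarrow> sep"
    using mp measure_prepare_normalize[OF _ d] holevo_rep_measure_prepare mp_B B_sep by meson
  have B: "entanglement_breaking d \<Phi> \<longleftrightarrow> sep"
    using mp mp_B B_sep by blast
  have D: "(\<exists>K A. rank_one_kraus_rep d K A \<Phi>) \<longleftrightarrow> sep"
    using mp rank_one_kraus_of_measure_prepare measure_prepare_of_rank_one_kraus mp_B B_sep by meson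
  have "E" if sep
  proof -
    obtain K F R where mp: "measure_prepare d d K F R \<Phi>" using mp[OF \<open>sep\<close>] by blast
    show ?thesis
      unfolding E_def
    proof (intro allI impI)
      fix m \<Upsilon> assume pos: "positivity_preserving d m \<Upsilon>"
      then have "lin_map d m \<Upsilon>" by (simp add: positivity_preserving_def)
      then show "completely_positive d m (\<Upsilon> \<circ> \<Phi>)"
        using completely_positive_measure_prepare[OF lin_map_comp[OF lin]] measure_prepare_post[OF mp pos] by blast
    qed
  qed
  \<comment> \<open>Restriction to trace-preserving maps only weakens the condition, yet the weaker
    form still yields separability; one cycle settles both versions. The same holds for
    \<open>F\<close> and \<open>F'\<close>.\<close>
  moreover have "E'" if "E" using that unfolding E_def E'_def by blast
  moreover have "sep" if "E'"
    unfolding sep_def by (rule separable_of_post_composition[OF onb d cp]) (use that in \<open>unfold E'_def, blast\<close>)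
  ultimately have E: "E \<longleftrightarrow> sep" "E' \<longleftrightarrow> sep" by blast+
  have "F" if sep
  proof -
    obtain K G R where mp: "measure_prepare d d K G R \<Phi>" using mp[OF \<open>sep\<close>] by blast
    show ?thesis
      unfolding F_def
    proof (intro allI impI)
      fix m \<Upsilon> assume pos: "positivity_preserving m d \<Upsilon>"
      then have "lin_map m d \<Upsilon>" by (simp add: positivity_preserving_def)
      from completely_positive_measure_prepare[OF lin_map_comp[OF this lin] measure_prepare_pre[OF mp pos]]
      show "completely_positive m d (\<Phi> \<circ> \<Upsilon>)" .
    qed
  qed
  moreover have "F'" if "F" using that unfolding F_def F'_def by blast
  moreover have "sep" if "F'"
    unfolding sep_def by (rule separable_of_pre_composition[OF onb d cp]) (use that in \<open>unfold F'_def, blast\<close>)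
  ultimately have F: "F \<longleftrightarrow> sep" "F' \<longleftrightarrow> sep" by blast+
  \<comment> \<open>The normalisation conditions hold for every representation of a trace-preserving
    map, so the earlier equivalences carry over.\<close>
  have tp: "((\<exists>K R F. holevo_rep d K R F \<Phi> \<and> povm d K F) \<longleftrightarrow> sep) \<and> (EBT d \<Phi> \<longleftrightarrow> sep) \<and>
      ((\<exists>K A. rank_one_kraus_rep d K A \<Phi> \<and> mat_sum d (\<lambda>k. mat_adjoint (A k) * A k) {..<K} = 1\<^sub>m d) \<longleftrightarrow> sep)"
    if tp: "trace_preserving d \<Phi>"
    using A B D holevo_rep_povm[OF _ tp] kraus_rep_trace_preserving[OF _ tp] tp
    unfolding EBT_def by meson
  show ?thesis
    unfolding Let_def sep_def[symmetric] E_def[symmetric] E'_def[symmetric] F_def[symmetric] F'_def[symmetric]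
    using A B D E F tp by blast
qed

end
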